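(* Let $(E_{x,h}^{n},E_{y,h}^{n},H_{z,h}^{n+\frac12})^T\in(U_h^k)^3$, $n=0,1,\dots,N$, be a solution of the fully discrete scheme (described in the context) for given $\mathbf J_h\in C(0,T;U_h^k)^2$, with time step $\Delta t=T/N$, and let $\mathcal E_h^n$ be the fully discrete nonlinear electromagnetic energy $$\mathcal{E}_{h}^{n}:=\|\mathbf E_{h}^{n}\|_{\varepsilon_{0}(1+\chi^{(1)})}^{2}+\|H_{z,h}^{n+\frac{1}{2}}\|_{\mu_{0}}^{2}+\big\||\mathbf E_h^{n}|^2\big\|_{\varepsilon_{0}\chi^{(3)}}^{2}.$$ Then, if $\Delta t>0$ and $h>0$ are sufficiently small and $\Delta t/h$ is bounded by some constant (i.e. there exist positive constants $\tau_0,h_0,\kappa$, independent of $h$, $\Delta t$ and the discrete solution, such that the following holds whenever $\Delta t\le\tau_0$, $h\le h_0$ and $\Delta t/h\le\kappa$), the energy satisfies $$\mathcal{E}_{h}^{N}\le 3\mathcal{E}_{h}^{0}=3\Big[\|\mathbf E_{h}^{0}\|_{\varepsilon_{0}(1+\chi^{(1)})}^{2}+\|H_{z,h}^{\frac{1}{2}}\|_{\mu_{0}}^{2}+\big\||\mathbf E_h^{0}|^2\big\|_{\varepsilon_{0}\chi^{(3)}}^{2}\Big]$$ for vanishing current density, and $$\mathcal{E}_{h}^{N}\le \exp(8T+1)\bigg[3\mathcal{E}_{h}^{0}+\Delta t\sum_{n=0}^{N-1}\|\mathbf J_h^{n+\frac{1}{2}}\|_{(\varepsilon_{0}(1+\chi^{(1)}))^{-1}}^{2}\bigg]$$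 for non-zero current density.
   Context: **Domain and coefficients.** $\Omega=(r,s)\times(p,q)\subset\mathbb R^2$ with $r<s$, $p<q$; $T>0$. $\varepsilon_0>0$ is a constant, and $\mu_0,\chi^{(1)},\chi^{(3)}:\Omega\to(0,\infty)$ belong to $L_\infty(\Omega)$. For a weight $\omega:\Omega\to(0,\infty)$ and a scalar- or vector-valued function $v$ on $\Omega$, $\|v\|_\omega:=\big(\int_\Omega|v|^2\omega\,d\mathbf x\big)^{1/2}$. $C(0,T;X)$ denotes continuous functions of $t\in[0,T]$ with values in $X$. **Mesh and space.** Let $r=x_{1/2}<x_{3/2}<\dots<x_{N_x+1/2}=s$ and $p=y_{1/2}<\dots<y_{N_y+1/2}=q$, $I_i=(x_{i-1/2},x_{i+1/2})$, $J_j=(y_{j-1/2},y_{j+1/2})$, $K_{ij}=I_i\times J_j$, $h_i^x=x_{i+1/2}-x_{i-1/2}$, $h_j^y=y_{j+1/2}-y_{j-1/2}$, $h=\max\{\max_ih_i^x,\max_jh_j^y\}$. The meshes are assumed shape-regular: there is a constant $C_{sr}>0$, the same for all meshes considered, with $h_i^x\le C_{sr}\varrho_{K_{ij}}$ and $h_j^y\le C_{sr}\varrho_{K_{ij}}$ for all cells, $\varrho_{K_{ij}}$ being the radius of the biggest circle contained in $K_{ij}$. For $k\in\mathbb N$, $U_h^k$ is the space of functions on $\Omega$ whose restriction to each $K_{ij}$ lies in $Q_k(K_{ij})$ (tensor products of univariate polynomials of degree at most $k$ in each variable); no continuity across cells is required. Superscripts $+$ and $-$ on a function at $x_{i+1/2}$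 (resp. $y_{j+1/2}$) denote the limit from the side of larger, resp. smaller, $x$ (resp. $y$). A subscript $(\cdot)_{x,j+1/2}$ means evaluation at $(x,y_{j+1/2})$, and $(\cdot)_{i+1/2,y}$ evaluation at $(x_{i+1/2},y)$. **Time grid.** $N\in\mathbb N$, $\Delta t=T/N$, $t^n=n\Delta t$; $\mathbf J_h^{n+1/2}=(J_{x,h}^{n+1/2},J_{y,h}^{n+1/2})$ is the value of $\mathbf J_h$ at time $(n+\tfrac12)\Delta t$. Write $\mathbf E_h^n=(E_{x,h}^n,E_{y,h}^n)$, $|\mathbf E_h^n|^2=(E_{x,h}^n)^2+(E_{y,h}^n)^2$. **Numerical fluxes.** Fix a constant $c_0>0$ independent of $h$. Set - $\hat E_{x,h}^{n+1}(x,y_{j+1/2})=E_{x,h}^{n+1,+}(x,y_{j+1/2})$ for $1\le j\le N_y-1$, and $\hat E_{x,h}^{n+1}(x,y_{1/2})=\hat E_{x,h}^{n+1}(x,y_{N_y+1/2})=0$; - $\hat E_{y,h}^{n+1}(x_{i+1/2},y)=E_{y,h}^{n+1,+}(x_{i+1/2},y)$ for $1\le i\le N_x-1$, and $\hat E_{y,h}^{n+1}(x_{1/2},y)=\hat E_{y,h}^{n+1}(x_{N_x+1/2},y)=0$; - $\hat H_{z,h}^{n+1/2}(x,y_{j+1/2})=H_{z,h}^{n+1/2,-}(x,y_{j+1/2})$ for $1\le j\le N_y$, and $\hat H_{z,h}^{n+1/2}(x,y_{1/2})=H_{z,h}^{n+1/2,+}(x,y_{1/2})+\frac{c_0}{2}\big[E_{x,h}^{n+1}(x,y_{1/2}^+)+E_{x,h}^{n}(x,y_{1/2}^+)\big]$;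 - $\hat H_{z,h}^{n+1/2}(x_{i+1/2},y)=H_{z,h}^{n+1/2,-}(x_{i+1/2},y)$ for $1\le i\le N_x$, and $\hat H_{z,h}^{n+1/2}(x_{1/2},y)=H_{z,h}^{n+1/2,+}(x_{1/2},y)-\frac{c_0}{2}\big[E_{y,h}^{n+1}(x_{1/2}^+,y)+E_{y,h}^{n}(x_{1/2}^+,y)\big]$. **Fully discrete scheme.** Given initial values $E_{x,h}^0,E_{y,h}^0,H_{z,h}^{1/2}\in U_h^k$, the functions $E_{x,h}^{n+1},E_{y,h}^{n+1},H_{z,h}^{n+3/2}\in U_h^k$, $n=0,1,\dots,N-1$, satisfy for all cells $K_{ij}$ and all test functions $\Phi_{1h},\Phi_{2h},\Phi_{3h}\in U_h^k$: $$\int_{K_{ij}}\frac{D_{x,h}^{n+1}-D_{x,h}^n}{\Delta t}\Phi_{1h}-\int_{I_i}\big[(\hat H_{z,h}^{n+\frac12}\Phi_{1h}^-)_{x,j+\frac12}-(\hat H_{z,h}^{n+\frac12}\Phi_{1h}^+)_{x,j-\frac12}\big]dx+\int_{K_{ij}}H_{z,h}^{n+\frac12}\partial_y\Phi_{1h}-\int_{K_{ij}}J_{x,h}^{n+\frac12}\Phi_{1h}=0,$$ $$\int_{K_{ij}}\frac{D_{y,h}^{n+1}-D_{y,h}^n}{\Delta t}\Phi_{2h}+\int_{J_j}\big[(\hat H_{z,h}^{n+\frac12}\Phi_{2h}^-)_{i+\frac12,y}-(\hat H_{z,h}^{n+\frac12}\Phi_{2h}^+)_{i-\frac12,y}\big]dy-\int_{K_{ij}}H_{z,h}^{n+\frac12}\partial_x\Phi_{2h}-\int_{K_{ij}}J_{y,h}^{n+\frac12}\Phi_{2h}=0,$$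 $$\int_{K_{ij}}\mu_0\frac{H_{z,h}^{n+\frac32}-H_{z,h}^{n+\frac12}}{\Delta t}\Phi_{3h}+\int_{J_j}\big[(\hat E_{y,h}^{n+1}\Phi_{3h}^-)_{i+\frac12,y}-(\hat E_{y,h}^{n+1}\Phi_{3h}^+)_{i-\frac12,y}\big]dy-\int_{K_{ij}}E_{y,h}^{n+1}\partial_x\Phi_{3h}$$ $$-\int_{I_i}\big[(\hat E_{x,h}^{n+1}\Phi_{3h}^-)_{x,j+\frac12}-(\hat E_{x,h}^{n+1}\Phi_{3h}^+)_{x,j-\frac12}\big]dx+\int_{K_{ij}}E_{x,h}^{n+1}\partial_y\Phi_{3h}=0,$$ where the differences $D_{x,h}^{n+1}-D_{x,h}^n$, $D_{y,h}^{n+1}-D_{y,h}^n$ are auxiliary quantities given by $$\int_{K_{ij}}(D_{x,h}^{n+1}-D_{x,h}^n)\Phi_{1h}=\int_{K_{ij}}\varepsilon_0(1+\chi^{(1)})(E_{x,h}^{n+1}-E_{x,h}^n)\Phi_{1h}+\int_{K_{ij}}\varepsilon_0\chi^{(3)}\Big[\tfrac12\big(|\mathbf E_h^{n+1}|^2+|\mathbf E_h^n|^2\big)(E_{x,h}^{n+1}-E_{x,h}^n)$$ $$+\big((E_{x,h}^{n+1})^2+(E_{x,h}^n)^2\big)(E_{x,h}^{n+1}-E_{x,h}^n)+\big(E_{x,h}^{n+1}E_{y,h}^{n+1}+E_{x,h}^nE_{y,h}^n\big)(E_{y,h}^{n+1}-E_{y,h}^n)\Big]\Phi_{1h},$$ $$\int_{K_{ij}}(D_{y,h}^{n+1}-D_{y,h}^n)\Phi_{2h}=\int_{K_{ij}}\varepsilon_0(1+\chi^{(1)})(E_{y,h}^{n+1}-E_{y,h}^n)\Phi_{2h}+\int_{K_{ij}}\varepsilon_0\chi^{(3)}\Big[\tfrac12\big(|\mathbf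 E_h^{n+1}|^2+|\mathbf E_h^n|^2\big)(E_{y,h}^{n+1}-E_{y,h}^n)$$ $$+\big((E_{y,h}^{n+1})^2+(E_{y,h}^n)^2\big)(E_{y,h}^{n+1}-E_{y,h}^n)+\big(E_{x,h}^{n+1}E_{y,h}^{n+1}+E_{x,h}^nE_{y,h}^n\big)(E_{x,h}^{n+1}-E_{x,h}^n)\Big]\Phi_{2h}.$$
   Formalization: The formal theorem additionally assumes that μ₀ is bounded below by a positive constant almost everywhere in Ω; without this the claim fails, e.g. for Ω=(0,1)² and μ₀=|x−1/2|, where Δt/h ≤ κ does not prevent growing modes. *)

theory Defs
  imports "HOL-Analysis.Analysis"
begin

section \<open>Coefficients and weighted norms\<close>

definition Linf_on :: "(real \<times> real) set \<Rightarrow> (real \<times> real \<Rightarrow> real) \<Rightarrow> bool" where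
  "Linf_on \<Omega> f \<longleftrightarrow> f \<in> borel_measurable (lebesgue_on \<Omega>) \<and>
     (\<exists>C. AE z in lebesgue_on \<Omega>. \<bar>f z\<bar> \<le> C)"

definition wnorm :: "(real \<times> real) set \<Rightarrow> (real \<times> real \<Rightarrow> real) \<Rightarrow>
    (real \<times> real \<Rightarrow> 'b::real_normed_vector) \<Rightarrow> real" where
  "wnorm \<Omega> \<omega> v = sqrt (LINT z|lebesgue_on \<Omega>. (norm (v z))\<^sup>2 * \<omega> z)"

section \<open>Mesh and finite element space\<close>

text \<open>
  Half-integer indices are shifted down: \<open>xnode M i\<close> is $x_{i+1/2}$ and \<open>ynode M j\<close> is
  $y_{j+1/2}$.  Cells keep their indices \<open>1 \<le> i \<le> Nx M\<close>, \<open>1 \<le> j \<le> Ny M\<close>.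
\<close>

record mesh =
  Nx :: nat
  Ny :: nat
  xnode :: "nat \<Rightarrow> real"
  ynode :: "nat \<Rightarrow> real"

definition is_mesh :: "real \<Rightarrow> real \<Rightarrow> real \<Rightarrow> real \<Rightarrow> mesh \<Rightarrow> bool" where
  "is_mesh r s p q M \<longleftrightarrow>
     xnode M 0 = r \<and> xnode M (Nx M) = s \<and> (\<forall>i<Nx M. xnode M i < xnode M (Suc i)) \<and>
     ynode M 0 = p \<and> ynode M (Ny M) = q \<and> (\<forall>j<Ny M. ynode M j < ynode M (Suc j))"

definition Icell :: "mesh \<Rightarrow> nat \<Rightarrow> real set" where
  "Icell M i = {xnode M (i - 1) <..< xnode M i}"

definition Jcell :: "mesh \<Rightarrow> nat \<Rightarrow> real set" where
  "Jcell M j = {ynode M (j - 1) <..< ynode M j}"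

definition Kcell :: "mesh \<Rightarrow> nat \<Rightarrow> nat \<Rightarrow> (real \<times> real) set" where
  "Kcell M i j = Icell M i \<times> Jcell M j"

definition hx :: "mesh \<Rightarrow> nat \<Rightarrow> real" where
  "hx M i = xnode M i - xnode M (i - 1)"

definition hy :: "mesh \<Rightarrow> nat \<Rightarrow> real" where
  "hy M j = ynode M j - ynode M (j - 1)"

definition meshsize :: "mesh \<Rightarrow> real" where
  "meshsize M = max (Max (hx M ` {1..Nx M})) (Max (hy M ` {1..Ny M}))"

definition inradius :: "(real \<times> real) set \<Rightarrow> real" where
  "inradius K = Sup {\<rho>. 0 < \<rho> \<and> (\<exists>c. ball c \<rho> \<subseteq> K)}"

definition shape_regular :: "real \<Rightarrow> mesh \<Rightarrow> bool" where
  "shape_regular Csr M \<longleftrightarrow>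
     (\<forall>i\<in>{1..Nx M}. \<forall>j\<in>{1..Ny M}.
        hx M i \<le> Csr * inradius (Kcell M i j) \<and> hy M j \<le> Csr * inradius (Kcell M i j))"

definition Qk :: "nat \<Rightarrow> (real \<times> real) set \<Rightarrow> (real \<times> real \<Rightarrow> real) \<Rightarrow> bool" where
  "Qk k K f \<longleftrightarrow> (\<exists>c :: nat \<Rightarrow> nat \<Rightarrow> real. \<forall>x y. (x, y) \<in> K \<longrightarrow>
      f (x, y) = (\<Sum>a\<le>k. \<Sum>b\<le>k. c a b * x ^ a * y ^ b))"

text \<open>
  The cells are open, so the values of a member of \<open>Uhk\<close> on the grid lines are arbitrary; on the
  grid lines only one-sided traces are ever used.
\<close>

definition Uhk :: "mesh \<Rightarrow> nat \<Rightarrow> (real \<times> real \<Rightarrow> real) set" where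
  "Uhk M k = {f. \<forall>i\<in>{1..Nx M}. \<forall>j\<in>{1..Ny M}. Qk k (Kcell M i j) f}"

text \<open>
  \<open>C(0,T;U\<^sub>h\<^sup>k)\<close>: continuity is taken in the norm of \<open>L\<^sub>2\<close>; all norms
  on the finite-dimensional space \<open>U\<^sub>h\<^sup>k\<close> are equivalent.
\<close>

definition cont_Uhk :: "real \<Rightarrow> (real \<times> real) set \<Rightarrow> mesh \<Rightarrow> nat \<Rightarrow> (real \<Rightarrow> real \<times> real \<Rightarrow> real) \<Rightarrow> bool"
  where
  "cont_Uhk T \<Omega> M k J \<longleftrightarrow>
     (\<forall>t\<in>{0..T}. J t \<in> Uhk M k) \<and>
     (\<forall>t\<in>{0..T}. ((\<lambda>u. wnorm \<Omega> (\<lambda>_. 1) (\<lambda>z. J u z - J t z)) \<longlongrightarrow> 0) (at t within {0..T}))"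

section \<open>Traces, partial derivatives and numerical fluxes\<close>

text \<open>One-sided limits in the first (\<open>x\<close>) and in the second (\<open>y\<close>) variable.\<close>

definition xplus :: "(real \<times> real \<Rightarrow> real) \<Rightarrow> real \<Rightarrow> real \<Rightarrow> real" where
  "xplus f x y = Lim (at_right x) (\<lambda>u. f (u, y))"

definition xminus :: "(real \<times> real \<Rightarrow> real) \<Rightarrow> real \<Rightarrow> real \<Rightarrow> real" where
  "xminus f x y = Lim (at_left x) (\<lambda>u. f (u, y))"

definition yplus :: "(real \<times> real \<Rightarrow> real) \<Rightarrow> real \<Rightarrow> real \<Rightarrow> real" where
  "yplus f x y = Lim (at_right y) (\<lambda>u. f (x, u))"

definition yminus :: "(real \<times> real \<Rightarrow> real) \<Rightarrow> real \<Rightarrow> real \<Rightarrow> real" where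
  "yminus f x y = Lim (at_left y) (\<lambda>u. f (x, u))"

definition dx :: "(real \<times> real \<Rightarrow> real) \<Rightarrow> real \<times> real \<Rightarrow> real" where
  "dx f z = deriv (\<lambda>u. f (u, snd z)) (fst z)"

definition dy :: "(real \<times> real \<Rightarrow> real) \<Rightarrow> real \<times> real \<Rightarrow> real" where
  "dy f z = deriv (\<lambda>u. f (fst z, u)) (snd z)"

text \<open>
  In the fluxes, \<open>j\<close> (resp. \<open>i\<close>) is the node number, so \<open>j = 0\<close> stands for $y_{1/2}$ and
  \<open>j = Ny M\<close> for $y_{N_y+1/2}$.  \<open>Hhat_x\<close> is the flux through horizontal edges and
  \<open>Hhat_y\<close> that through vertical edges; \<open>E1\<close>, \<open>E0\<close> are the respective component of the
  electric field at the time levels \<open>n+1\<close> and \<open>n\<close>.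
\<close>

definition Ehat_x :: "mesh \<Rightarrow> (real \<times> real \<Rightarrow> real) \<Rightarrow> real \<Rightarrow> nat \<Rightarrow> real" where
  "Ehat_x M E x j = (if 1 \<le> j \<and> j < Ny M then yplus E x (ynode M j) else 0)"

definition Ehat_y :: "mesh \<Rightarrow> (real \<times> real \<Rightarrow> real) \<Rightarrow> nat \<Rightarrow> real \<Rightarrow> real" where
  "Ehat_y M E i y = (if 1 \<le> i \<and> i < Nx M then xplus E (xnode M i) y else 0)"

definition Hhat_x :: "real \<Rightarrow> mesh \<Rightarrow> (real \<times> real \<Rightarrow> real) \<Rightarrow> (real \<times> real \<Rightarrow> real) \<Rightarrow>
    (real \<times> real \<Rightarrow> real) \<Rightarrow> real \<Rightarrow> nat \<Rightarrow> real" where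
  "Hhat_x c0 M H E1 E0 x j =
     (if j = 0
      then yplus H x (ynode M 0) + c0 / 2 * (yplus E1 x (ynode M 0) + yplus E0 x (ynode M 0))
      else yminus H x (ynode M j))"

definition Hhat_y :: "real \<Rightarrow> mesh \<Rightarrow> (real \<times> real \<Rightarrow> real) \<Rightarrow> (real \<times> real \<Rightarrow> real) \<Rightarrow>
    (real \<times> real \<Rightarrow> real) \<Rightarrow> nat \<Rightarrow> real \<Rightarrow> real" where
  "Hhat_y c0 M H E1 E0 i y =
     (if i = 0
      then xplus H (xnode M 0) y - c0 / 2 * (xplus E1 (xnode M 0) y + xplus E0 (xnode M 0) y)
      else xminus H (xnode M i) y)"

section \<open>Fully discrete scheme\<close>

text \<open>
  The bracket multiplying $\varepsilon_0\chi^{(3)}$: \<open>a1\<close>, \<open>a0\<close> are the new and old values of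
  the component under consideration, \<open>b1\<close>, \<open>b0\<close> those of the other component.
\<close>

definition kerr :: "real \<Rightarrow> real \<Rightarrow> real \<Rightarrow> real \<Rightarrow> real" where
  "kerr a1 a0 b1 b0 =
     1 / 2 * ((a1\<^sup>2 + b1\<^sup>2) + (a0\<^sup>2 + b0\<^sup>2)) * (a1 - a0)
     + (a1\<^sup>2 + a0\<^sup>2) * (a1 - a0) + (a1 * b1 + a0 * b0) * (b1 - b0)"

text \<open>
  Defining relation of the auxiliary increment \<open>D1 - D0\<close> for one component \<open>A\<close>, \<open>B\<close> being the
  other component.
\<close>

definition D_relation :: "mesh \<Rightarrow> nat \<Rightarrow> real \<Rightarrow> (real \<times> real \<Rightarrow> real) \<Rightarrow> (real \<times> real \<Rightarrow> real) \<Rightarrow>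
    (real \<times> real \<Rightarrow> real) \<Rightarrow> (real \<times> real \<Rightarrow> real) \<Rightarrow>
    (real \<times> real \<Rightarrow> real) \<Rightarrow> (real \<times> real \<Rightarrow> real) \<Rightarrow>
    (real \<times> real \<Rightarrow> real) \<Rightarrow> (real \<times> real \<Rightarrow> real) \<Rightarrow> bool" where
  "D_relation M k \<epsilon>0 \<chi>1 \<chi>3 D1 D0 A1 A0 B1 B0 \<longleftrightarrow>
     (\<forall>i\<in>{1..Nx M}. \<forall>j\<in>{1..Ny M}. \<forall>\<Phi>\<in>Uhk M k.
        (LINT z|lebesgue_on (Kcell M i j). (D1 z - D0 z) * \<Phi> z) =
        (LINT z|lebesgue_on (Kcell M i j). \<epsilon>0 * (1 + \<chi>1 z) * (A1 z - A0 z) * \<Phi> z)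
        + (LINT z|lebesgue_on (Kcell M i j).
             \<epsilon>0 * \<chi>3 z * kerr (A1 z) (A0 z) (B1 z) (B0 z) * \<Phi> z))"

definition Ex_equation :: "real \<Rightarrow> mesh \<Rightarrow> nat \<Rightarrow> real \<Rightarrow> (real \<times> real \<Rightarrow> real) \<Rightarrow> (real \<times> real \<Rightarrow> real) \<Rightarrow>
    (real \<times> real \<Rightarrow> real) \<Rightarrow> (real \<times> real \<Rightarrow> real) \<Rightarrow> (real \<times> real \<Rightarrow> real) \<Rightarrow>
    (real \<times> real \<Rightarrow> real) \<Rightarrow> bool" where
  "Ex_equation c0 M k \<Delta>t D1 D0 E1 E0 H J \<longleftrightarrow>
     (\<forall>i\<in>{1..Nx M}. \<forall>j\<in>{1..Ny M}. \<forall>\<Phi>\<in>Uhk M k.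
        (LINT z|lebesgue_on (Kcell M i j). (D1 z - D0 z) / \<Delta>t * \<Phi> z)
        - (LINT x|lebesgue_on (Icell M i).
             Hhat_x c0 M H E1 E0 x j * yminus \<Phi> x (ynode M j)
             - Hhat_x c0 M H E1 E0 x (j - 1) * yplus \<Phi> x (ynode M (j - 1)))
        + (LINT z|lebesgue_on (Kcell M i j). H z * dy \<Phi> z)
        - (LINT z|lebesgue_on (Kcell M i j). J z * \<Phi> z) = 0)"

definition Ey_equation :: "real \<Rightarrow> mesh \<Rightarrow> nat \<Rightarrow> real \<Rightarrow> (real \<times> real \<Rightarrow> real) \<Rightarrow> (real \<times> real \<Rightarrow> real) \<Rightarrow>
    (real \<times> real \<Rightarrow> real) \<Rightarrow> (real \<times> real \<Rightarrow> real) \<Rightarrow> (real \<times> real \<Rightarrow> real) \<Rightarrow>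
    (real \<times> real \<Rightarrow> real) \<Rightarrow> bool" where
  "Ey_equation c0 M k \<Delta>t D1 D0 E1 E0 H J \<longleftrightarrow>
     (\<forall>i\<in>{1..Nx M}. \<forall>j\<in>{1..Ny M}. \<forall>\<Phi>\<in>Uhk M k.
        (LINT z|lebesgue_on (Kcell M i j). (D1 z - D0 z) / \<Delta>t * \<Phi> z)
        + (LINT y|lebesgue_on (Jcell M j).
             Hhat_y c0 M H E1 E0 i y * xminus \<Phi> (xnode M i) y
             - Hhat_y c0 M H E1 E0 (i - 1) y * xplus \<Phi> (xnode M (i - 1)) y)
        - (LINT z|lebesgue_on (Kcell M i j). H z * dx \<Phi> z)
        - (LINT z|lebesgue_on (Kcell M i j). J z * \<Phi> z) = 0)"

definition Hz_equation :: "mesh \<Rightarrow> nat \<Rightarrow> real \<Rightarrow> (real \<times> real \<Rightarrow> real) \<Rightarrow> (real \<times> real \<Rightarrow> real) \<Rightarrow>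
    (real \<times> real \<Rightarrow> real) \<Rightarrow> (real \<times> real \<Rightarrow> real) \<Rightarrow> (real \<times> real \<Rightarrow> real) \<Rightarrow> bool" where
  "Hz_equation M k \<Delta>t \<mu>0 H1 H0 E1x E1y \<longleftrightarrow>
     (\<forall>i\<in>{1..Nx M}. \<forall>j\<in>{1..Ny M}. \<forall>\<Phi>\<in>Uhk M k.
        (LINT z|lebesgue_on (Kcell M i j). \<mu>0 z * ((H1 z - H0 z) / \<Delta>t) * \<Phi> z)
        + (LINT y|lebesgue_on (Jcell M j).
             Ehat_y M E1y i y * xminus \<Phi> (xnode M i) y
             - Ehat_y M E1y (i - 1) y * xplus \<Phi> (xnode M (i - 1)) y)
        - (LINT z|lebesgue_on (Kcell M i j). E1y z * dx \<Phi> z)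
        - (LINT x|lebesgue_on (Icell M i).
             Ehat_x M E1x x j * yminus \<Phi> x (ynode M j)
             - Ehat_x M E1x x (j - 1) * yplus \<Phi> x (ynode M (j - 1)))
        + (LINT z|lebesgue_on (Kcell M i j). E1x z * dy \<Phi> z) = 0)"

text \<open>
  \<open>Hzh n\<close> stands for $H_{z,h}^{n+1/2}$, and \<open>Exh n\<close>, \<open>Eyh n\<close> for the electric field components
  at $t^n$.  The sequences \<open>Dx\<close>, \<open>Dy\<close> enter only through their increments tested
  against \<open>U\<^sub>h\<^sup>k\<close>, so nothing further is required of them.
\<close>

definition discrete_solution :: "real \<Rightarrow> (real \<times> real \<Rightarrow> real) \<Rightarrow> (real \<times> real \<Rightarrow> real) \<Rightarrow>
    (real \<times> real \<Rightarrow> real) \<Rightarrow> real \<Rightarrow> mesh \<Rightarrow> nat \<Rightarrow> real \<Rightarrow> nat \<Rightarrow>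
    (real \<Rightarrow> real \<times> real \<Rightarrow> real) \<Rightarrow> (real \<Rightarrow> real \<times> real \<Rightarrow> real) \<Rightarrow>
    (nat \<Rightarrow> real \<times> real \<Rightarrow> real) \<Rightarrow> (nat \<Rightarrow> real \<times> real \<Rightarrow> real) \<Rightarrow>
    (nat \<Rightarrow> real \<times> real \<Rightarrow> real) \<Rightarrow> bool" where
  "discrete_solution \<epsilon>0 \<mu>0 \<chi>1 \<chi>3 c0 M k T N Jxh Jyh Exh Eyh Hzh \<longleftrightarrow>
     (\<forall>n\<le>N. Exh n \<in> Uhk M k \<and> Eyh n \<in> Uhk M k \<and> Hzh n \<in> Uhk M k) \<and>
     (\<exists>Dx Dy. \<forall>n<N.
        let \<Delta>t = T / real N; th = (real n + 1 / 2) * \<Delta>t in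
          D_relation M k \<epsilon>0 \<chi>1 \<chi>3 (Dx (Suc n)) (Dx n) (Exh (Suc n)) (Exh n) (Eyh (Suc n)) (Eyh n) \<and>
          D_relation M k \<epsilon>0 \<chi>1 \<chi>3 (Dy (Suc n)) (Dy n) (Eyh (Suc n)) (Eyh n) (Exh (Suc n)) (Exh n) \<and>
          Ex_equation c0 M k \<Delta>t (Dx (Suc n)) (Dx n) (Exh (Suc n)) (Exh n) (Hzh n) (Jxh th) \<and>
          Ey_equation c0 M k \<Delta>t (Dy (Suc n)) (Dy n) (Eyh (Suc n)) (Eyh n) (Hzh n) (Jyh th) \<and>
          Hz_equation M k \<Delta>t \<mu>0 (Hzh (Suc n)) (Hzh n) (Exh (Suc n)) (Eyh (Suc n)))"

text \<open>The pair \<open>(Exh z, Eyh z)\<close> carries the Euclidean norm of the product type.\<close>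

definition energy :: "(real \<times> real) set \<Rightarrow> real \<Rightarrow> (real \<times> real \<Rightarrow> real) \<Rightarrow> (real \<times> real \<Rightarrow> real) \<Rightarrow>
    (real \<times> real \<Rightarrow> real) \<Rightarrow> (real \<times> real \<Rightarrow> real) \<Rightarrow> (real \<times> real \<Rightarrow> real) \<Rightarrow>
    (real \<times> real \<Rightarrow> real) \<Rightarrow> real" where
  "energy \<Omega> \<epsilon>0 \<mu>0 \<chi>1 \<chi>3 Exh Eyh Hzh =
     (wnorm \<Omega> (\<lambda>z. \<epsilon>0 * (1 + \<chi>1 z)) (\<lambda>z. (Exh z, Eyh z)))\<^sup>2
     + (wnorm \<Omega> \<mu>0 Hzh)\<^sup>2
     + (wnorm \<Omega> (\<lambda>z. \<epsilon>0 * \<chi>3 z) (\<lambda>z. (norm (Exh z, Eyh z))\<^sup>2))\<^sup>2"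

end

theory Submission
  imports Defs
begin

text \<open>
  Test the two electric equations with $E_h^{n+1}+E_h^n$ and the magnetic equation with
  $H_h^{n+3/2}+H_h^{n+1/2}$.  The Kerr bracket is built so that it contributes exactly
  $\frac32\||\mathbf E_h|^2\|^2$ to the energy, and the alternating fluxes make the two discrete curls
  adjoint up to a penalty of favourable sign.  Hence, without current,
  $Z^n=\|\mathbf E_h^n\|^2+\frac32\||\mathbf E_h^n|^2\|^2+\|H_h^{n+1/2}\|^2+\Delta t\,B(\mathbf E_h^n,H_h^{n+1/2})$
  does not increase, where $B$ is the discrete curl form.  An inverse inequality bounds
  $|\Delta t\,B|$ by a third of the quadratic energies once $\Delta t/h$ is small, so $Z^n$ and
  $\mathcal E_h^n$ are comparable; the current is absorbed by Young's inequality and a discrete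
  Gronwall argument.
\<close>

text \<open>Electric and magnetic unknowns live at staggered times, so the sum of their energies
  need not decrease in a step; the cross term \<open>\<Delta>t * B\<close> restores a telescoping
  sum, and the smallness of \<open>\<Delta>t / h\<close> serves to dominate it. The inverse
  inequality bounds \<open>B\<close> by unweighted norms, whereas the energy is weighted. The
  electric weight is at least \<open>\<epsilon>0\<close>, but pointwise positivity of
  \<open>\<mu>0\<close> gives no uniform constant; hence the hypothesis
  \<open>mu0_bounded_below\<close>. Each half of the curl differentiates in one variable and takes
  traces in that same variable, so all planar estimates are univariate ones integrated over slices.
  The factor 3 is \<open>3 / 2 * 2\<close>: with the cross term at most a third of the quadratic
  part, the energy is at most \<open>3 / 2 * Z\<close> and \<open>Z\<close> at most twice the
  energy, the different weights of the Kerr term included. With a current, the new field also occurs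
  on the right-hand side. Its share is absorbed on the left, which is possible for
  \<open>\<Delta>t \<le> 1 / 3\<close>.\<close>

section \<open>Inverse estimate for polynomials\<close>

text \<open>
  Induction on the degree: at the point $x_0$ of \<open>[a, b]\<close> where $q^2$ is smallest, split
  $q=q(x_0)+(x-x_0)p$.  On a quarter of \<open>[a, b]\<close> away from $x_0$ the factor $x-x_0$ is bounded
  below, so the induction hypothesis applies to $p$ there.
\<close>

lemma poly_inverse_estimate_unit:
  fixes a b :: real
  assumes "a < b" "{a..b} \<subseteq> {0..1}"
  shows "\<exists>C\<ge>0. \<forall>q::real poly. degree q \<le> k \<longrightarrow> (\<forall>x\<in>{0..1}.
     (poly q x)\<^sup>2 + (poly (pderiv q) x)\<^sup>2 \<le> C * integral {a..b} (\<lambda>t. (poly q t)\<^sup>2))"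
  using assms
\<comment> \<open>The interval of integration must vary, because the quotient polynomial is
  estimated over an end quarter of \<open>[a, b]\<close>; the evaluation point ranges over all of
  \<open>[0, 1]\<close>, so it need not lie in that quarter.\<close>
proof (induction k arbitrary: a b)
  case 0
  show ?case
  proof (intro exI[of _ "1/(b-a)"] conjI allI impI ballI)
    fix q :: "real poly" and x :: real assume "degree q \<le> 0"
    then obtain c where "q = [:c:]" by (metis degree_eq_zeroE le_zero_eq)
    then show "(poly q x)\<^sup>2 + (poly (pderiv q) x)\<^sup>2 \<le> 1/(b-a) * integral {a..b} (\<lambda>t. (poly q t)\<^sup>2)"
      using \<open>a < b\<close> by (simp add: pderiv_pCons)
  qed (use \<open>a < b\<close> in simp)
next
  case (Suc k)
  define d where "d = (b - a) / 4"
  have d: "d > 0" using \<open>a < b\<close> by (simp add: d_def)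
  obtain C1 where C1: "C1 \<ge> 0" "\<And>q x. degree q \<le> k \<Longrightarrow> x \<in> {0..1} \<Longrightarrow>
     (poly q x)\<^sup>2 + (poly (pderiv q) x)\<^sup>2 \<le> C1 * integral {a..a+d} (\<lambda>t. (poly q t)\<^sup>2)"
  proof -
    have "a < a + d" "{a..a+d} \<subseteq> {0..1}" using Suc.prems d by (auto simp: d_def field_simps)
    from Suc.IH[OF this] show ?thesis using that by blast
  qed
  obtain C2 where C2: "C2 \<ge> 0" "\<And>q x. degree q \<le> k \<Longrightarrow> x \<in> {0..1} \<Longrightarrow>
     (poly q x)\<^sup>2 + (poly (pderiv q) x)\<^sup>2 \<le> C2 * integral {b-d..b} (\<lambda>t. (poly q t)\<^sup>2)"
  proof -
    have "b - d < b" "{b-d..b} \<subseteq> {0..1}" using Suc.prems d by (auto simp: d_def field_simps)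
    from Suc.IH[OF this] show ?thesis using that by blast
  qed
  \<comment> \<open>\<open>2 / (b - a)\<close> pays for the constant term \<open>m\<close>; the
    other summand is 4 times the bound \<open>(C1 + C2) * (4 * I / d\<^sup>2)\<close> for the
    quotient \<open>p\<close>, valid whichever quarter is used.\<close>
  define C where "C = 2/(b-a) + 16 * (C1+C2) / d\<^sup>2"
  show ?case
  proof (intro exI[of _ C] conjI allI impI ballI)
    show "C \<ge> 0" using C1(1) C2(1) \<open>a<b\<close> unfolding C_def by simp
    fix q :: "real poly" and x :: real assume deg: "degree q \<le> Suc k" and x: "x \<in> {0..1}"
    define I where "I = integral {a..b} (\<lambda>t. (poly q t)\<^sup>2)"
    have int: "(\<lambda>t. (poly q t)\<^sup>2) integrable_on {u..v}" for q :: "real poly" and u v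
      by (intro integrable_continuous_real continuous_intros)
    obtain x0 where x0: "x0 \<in> {a..b}" "\<And>t. t \<in> {a..b} \<Longrightarrow> (poly q x0)\<^sup>2 \<le> (poly q t)\<^sup>2"
    proof -
      have "\<exists>x0\<in>{a..b}. \<forall>t\<in>{a..b}. (poly q x0)\<^sup>2 \<le> (poly q t)\<^sup>2"
        using \<open>a<b\<close> by (intro continuous_attains_inf continuous_intros) auto
      then show ?thesis using that by blast
    qed
    define m where "m = poly q x0"
    define p where "p = synthetic_div q x0"
    have q: "q = [:-x0,1:] * p + [:m:]" unfolding p_def m_def by (rule synthetic_div_correct'[symmetric])
    have degp: "degree p \<le> k" using deg by (simp add: p_def degree_synthetic_div)
    have qe: "poly q t = (t - x0) * poly p t + m" for t by (subst q) (simp add: algebra_simps)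
    have qe': "poly (pderiv q) t = poly p t + (t - x0) * poly (pderiv p) t" for t
      by (subst q, simp only: pderiv_add pderiv_mult) (simp add: pderiv_pCons algebra_simps)
    have mI: "m\<^sup>2 * (b - a) \<le> I"
    proof -
      have "integral {a..b} (\<lambda>t. m\<^sup>2) \<le> I" unfolding I_def
        by (rule integral_le) (use x0 int in \<open>auto simp: m_def\<close>)
      then show ?thesis using \<open>a<b\<close> by (simp add: mult.commute)
    qed
    \<comment> \<open>Since \<open>x0\<close> minimises the square of \<open>q\<close>,
      \<open>m\<^sup>2\<close> is at most \<open>(poly q t)\<^sup>2\<close> throughout, so
      subtracting \<open>m\<close> costs only the factor 4.\<close>
    have sub: "d\<^sup>2 * integral {u..v} (\<lambda>t. (poly p t)\<^sup>2) \<le> 4 * I"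
      if uv: "{u..v} \<subseteq> {a..b}" "\<And>t. t \<in> {u..v} \<Longrightarrow> d \<le> \<bar>t - x0\<bar>" for u v
    proof -
      have "d\<^sup>2 * (poly p t)\<^sup>2 \<le> 4 * (poly q t)\<^sup>2" if "t \<in> {u..v}" for t
      proof -
        have "d\<^sup>2 \<le> (t-x0)\<^sup>2" using uv(2)[OF that] d by (simp add: abs_le_square_iff[symmetric])
        then have "d\<^sup>2 * (poly p t)\<^sup>2 \<le> (t-x0)\<^sup>2 * (poly p t)\<^sup>2" by (intro mult_right_mono) auto
        also have "\<dots> = (poly q t - m)\<^sup>2" by (simp add: qe power_mult_distrib)
        also have "\<dots> \<le> 2 * (poly q t)\<^sup>2 + 2 * m\<^sup>2"
          using zero_le_power2[of "poly q t + m"] by (simp add: power2_eq_square algebra_simps)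
        also have "\<dots> \<le> 4 * (poly q t)\<^sup>2" using x0(2)[of t] uv(1) that by (auto simp: m_def)
        finally show ?thesis .
      qed
      then have "integral {u..v} (\<lambda>t. d\<^sup>2 * (poly p t)\<^sup>2) \<le> integral {u..v} (\<lambda>t. 4 * (poly q t)\<^sup>2)"
        by (intro integral_le integrable_continuous_real continuous_intros)
      then have "d\<^sup>2 * integral {u..v} (\<lambda>t. (poly p t)\<^sup>2) \<le> 4 * integral {u..v} (\<lambda>t. (poly q t)\<^sup>2)"
        by simp
      also have "integral {u..v} (\<lambda>t. (poly q t)\<^sup>2) \<le> I" unfolding I_def
        by (rule integral_subset_le) (use uv int in auto)
      finally show ?thesis by simp
    qed
    \<comment> \<open>The end quarter in the half of \<open>[a, b]\<close> opposite to
      \<open>x0\<close> keeps distance at least \<open>d\<close> from it.\<close>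
    have key: "(poly p x)\<^sup>2 + (poly (pderiv p) x)\<^sup>2 \<le> (C1 + C2) * (4 * I / d\<^sup>2)"
    proof (cases "x0 \<ge> (a+b)/2")
      case True
      have "d\<^sup>2 * integral {a..a+d} (\<lambda>t. (poly p t)\<^sup>2) \<le> 4 * I"
        by (rule sub) (use True d x0(1) \<open>a<b\<close> in \<open>auto simp: d_def field_simps\<close>)
      then have "integral {a..a+d} (\<lambda>t. (poly p t)\<^sup>2) \<le> 4 * I / d\<^sup>2" using d by (simp add: field_simps)
      then have "C1 * integral {a..a+d} (\<lambda>t. (poly p t)\<^sup>2) \<le> (C1+C2) * (4 * I / d\<^sup>2)"
        using C1(1) C2(1) by (intro mult_mono integral_nonneg int) auto
      with C1(2)[OF degp x] show ?thesis by linarith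
    next
      case False
      have "d\<^sup>2 * integral {b-d..b} (\<lambda>t. (poly p t)\<^sup>2) \<le> 4 * I"
        by (rule sub) (use False d x0(1) \<open>a<b\<close> in \<open>auto simp: d_def field_simps\<close>)
      then have "integral {b-d..b} (\<lambda>t. (poly p t)\<^sup>2) \<le> 4 * I / d\<^sup>2" using d by (simp add: field_simps)
      then have "C2 * integral {b-d..b} (\<lambda>t. (poly p t)\<^sup>2) \<le> (C1+C2) * (4 * I / d\<^sup>2)"
        using C1(1) C2(1) by (intro mult_mono integral_nonneg int) auto
      with C2(2)[OF degp x] show ?thesis by linarith
    qed
    \<comment> \<open>Both points lie in \<open>[0, 1]\<close>, so the factor \<open>x - x0\<close>
      has modulus at most 1 and drops out.\<close>
    have le: "(u + (x-x0) * v)\<^sup>2 \<le> 2 * u\<^sup>2 + 2 * v\<^sup>2" for u v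
    proof -
      have "\<bar>x - x0\<bar> \<le> 1" using x x0(1) Suc.prems(2) by (auto simp: abs_le_iff)
      then have "(x-x0)\<^sup>2 \<le> 1" by (simp add: abs_square_le_1)
      then have "(x-x0)\<^sup>2 * v\<^sup>2 \<le> 1 * v\<^sup>2" by (intro mult_right_mono) auto
      moreover have "(u + (x-x0) * v)\<^sup>2 \<le> 2*u\<^sup>2 + 2*((x-x0)\<^sup>2 * v\<^sup>2)"
        using sum_squares_bound[of u "(x-x0) * v"] unfolding power2_sum power_mult_distrib by linarith
      ultimately show ?thesis by linarith
    qed
    have "(poly q x)\<^sup>2 \<le> 2 * m\<^sup>2 + 2 * (poly p x)\<^sup>2" using le[of m "poly p x"] by (simp add: qe add.commute)
    moreover have "(poly (pderiv q) x)\<^sup>2 \<le> 2 * (poly p x)\<^sup>2 + 2 * (poly (pderiv p) x)\<^sup>2"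
      using le by (simp add: qe')
    ultimately have "(poly q x)\<^sup>2 + (poly (pderiv q) x)\<^sup>2 \<le> 2 * m\<^sup>2 + 4 * ((poly p x)\<^sup>2 + (poly (pderiv p) x)\<^sup>2)"
      using zero_le_power2[of "poly (pderiv p) x"] unfolding distrib_left by linarith
    also have "\<dots> \<le> 2 * (I / (b-a)) + 4 * ((C1 + C2) * (4 * I / d\<^sup>2))"
    proof -
      have "m\<^sup>2 \<le> I / (b - a)" using mI \<open>a<b\<close> by (simp add: pos_le_divide_eq)
      with key show ?thesis by (intro add_mono mult_left_mono) simp_all
    qed
    also have "\<dots> = C * I" unfolding C_def by (simp add: algebra_simps)
    finally show "(poly q x)\<^sup>2 + (poly (pderiv q) x)\<^sup>2 \<le> C * integral {a..b} (\<lambda>t. (poly q t)\<^sup>2)"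
      unfolding I_def .
  qed
qed

text \<open>Affine change of variable from \<open>[0, 1]\<close>: a derivative picks up the factor
  \<open>b - a\<close>, the integral its inverse. The constant depends on the degree bound alone,
  which makes it uniform over all meshes.\<close>

lemma poly_inverse_estimate:
  "\<exists>C\<ge>0. \<forall>(q::real poly) a b x. degree q \<le> k \<longrightarrow> a < b \<longrightarrow> x \<in> {a..b} \<longrightarrow>
     (poly q x)\<^sup>2 \<le> C / (b - a) * integral {a..b} (\<lambda>t. (poly q t)\<^sup>2) \<and>
     ((b - a) * poly (pderiv q) x)\<^sup>2 \<le> C / (b - a) * integral {a..b} (\<lambda>t. (poly q t)\<^sup>2)"
proof -
  obtain C where C: "C \<ge> 0" "\<And>(q::real poly) x. degree q \<le> k \<Longrightarrow> x \<in> {0..1} \<Longrightarrow>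
     (poly q x)\<^sup>2 + (poly (pderiv q) x)\<^sup>2 \<le> C * integral {0..1} (\<lambda>t. (poly q t)\<^sup>2)"
    using poly_inverse_estimate_unit[OF zero_less_one order_refl, of k] by blast
  show ?thesis
  proof (intro exI[of _ C] conjI allI impI C(1))
    fix q :: "real poly" and a b x :: real
    assume deg: "degree q \<le> k" and ab: "a < b" and x: "x \<in> {a..b}"
    define l where "l = b - a"
    have l: "l > 0" using ab by (simp add: l_def)
    define p where "p = pcompose q [:a, l:]"
    define t where "t = (x - a) / l"
    have degp: "degree p \<le> k" using deg l by (simp add: p_def degree_pcompose)
    have t: "t \<in> {0..1}" "a + t * l = x" using x l by (auto simp: t_def l_def field_simps)
    have int: "integral {0..1} (\<lambda>t. (poly p t)\<^sup>2) = integral {a..b} (\<lambda>t. (poly q t)\<^sup>2) / l"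
    proof -
      have "((\<lambda>t. (poly q t)\<^sup>2) has_integral integral {a..b} (\<lambda>t. (poly q t)\<^sup>2)) (cbox a b)"
        by (simp add: integrable_integral integrable_continuous_real continuous_intros)
      from has_integral_affinity[OF this, of l a] l
      have "((\<lambda>t. (poly q (l * t + a))\<^sup>2) has_integral (integral {a..b} (\<lambda>t. (poly q t)\<^sup>2) / l))
          ((\<lambda>x. (1 / l) *\<^sub>R x + - ((1 / l) *\<^sub>R a)) ` {a..b})"
        by (simp add: divide_inverse mult.commute)
      also have "(\<lambda>x. (1 / l) *\<^sub>R x + - ((1 / l) *\<^sub>R a)) ` {a..b} = {0..1}"
      proof -
        have "b / l - a / l = 1" using l by (simp add: l_def flip: diff_divide_distrib)
        then show ?thesis using l ab image_affinity_atLeastAtMost[of "1/l" "- (1/l * a)" a b] by simp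
      qed
      finally show ?thesis
        by (intro integral_unique) (simp add: p_def poly_pcompose algebra_simps)
    qed
    have "(poly p t)\<^sup>2 + (poly (pderiv p) t)\<^sup>2 \<le> C / l * integral {a..b} (\<lambda>t. (poly q t)\<^sup>2)"
      using C(2)[OF degp t(1)] by (simp add: int)
    moreover have "poly p t = poly q x" using t(2) by (simp add: p_def poly_pcompose mult.commute)
    moreover have "poly (pderiv p) t = l * poly (pderiv q) x"
      using t(2) by (simp add: p_def pderiv_pcompose pderiv_pCons poly_pcompose mult.commute)
    ultimately have "(poly q x)\<^sup>2 + (l * poly (pderiv q) x)\<^sup>2 \<le> C / l * integral {a..b} (\<lambda>t. (poly q t)\<^sup>2)"
      by simp
    then show "(poly q x)\<^sup>2 \<le> C / (b - a) * integral {a..b} (\<lambda>t. (poly q t)\<^sup>2)"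
      "((b - a) * poly (pderiv q) x)\<^sup>2 \<le> C / (b - a) * integral {a..b} (\<lambda>t. (poly q t)\<^sup>2)"
      unfolding l_def[symmetric] using zero_le_power2[of "poly q x"] zero_le_power2[of "l * poly (pderiv q) x"]
      by linarith+
  qed
qed

section \<open>Broken forms on an interval\<close>

text \<open>
  The flux of \<open>e\<close> is its trace from the right at interior nodes and zero at the two end nodes.
\<close>

definition broken_form :: "nat \<Rightarrow> (nat \<Rightarrow> real) \<Rightarrow> (nat \<Rightarrow> real \<Rightarrow> real) \<Rightarrow> (nat \<Rightarrow> real \<Rightarrow> real) \<Rightarrow> real" where
  "broken_form n t e h = (\<Sum>j=1..n. (if j < n then e (Suc j) (t j) else 0) * h j (t j)
     - (if 1 < j then e j (t (j - 1)) else 0) * h j (t (j - 1))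
     - integral {t (j - 1)..t j} (\<lambda>y. e j y * deriv (h j) y))"

lemma deriv_poly [simp]: "deriv (poly q) x = poly (pderiv q) (x::real)"
  by (rule DERIV_imp_deriv) (rule poly_DERIV)

text \<open>Charges an interior node to the cell on its right instead of the cell on its left; the
  guards exclude the two end nodes.\<close>

lemma sum_shift_guard:
  fixes f :: "nat \<Rightarrow> real"
  shows "(\<Sum>j=1..n. if j < n then f (Suc j) else 0) = (\<Sum>j=1..n. if 1 < j then f j else 0)"
proof (cases n)
  case (Suc m)
  have "(\<Sum>j=1..n. if j < n then f (Suc j) else 0) = (\<Sum>j=1..m. f (Suc j))"
    unfolding Suc by simp
  also have "\<dots> = (\<Sum>j=Suc 1..Suc m. f j)" by (rule sum.shift_bounds_cl_Suc_ivl[symmetric])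
  also have "\<dots> = (\<Sum>j=1..n. if 1 < j then f j else 0)"
    unfolding Suc by (subst sum.atLeast_Suc_atMost[of 1]) (auto intro!: sum.cong)
  finally show ?thesis .
qed simp

text \<open>
  The left-hand side is the form with the opposite flux, the trace of \<open>h\<close> from the left; \<open>g\<close> is
  the flux at the first node, where no left trace exists.
\<close>

lemma adjoint_broken_form:
  fixes e h :: "nat \<Rightarrow> real poly"
  assumes n: "n \<ge> 1" and t: "\<And>j. j \<in> {1..n} \<Longrightarrow> t (j - 1) < t j"
  shows "(\<Sum>j=1..n. poly (h j) (t j) * poly (e j) (t j)
      - (if j = 1 then g else poly (h (j - 1)) (t (j - 1))) * poly (e j) (t (j - 1))
      - integral {t (j - 1)..t j} (\<lambda>y. poly (h j) y * deriv (poly (e j)) y))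
    = - broken_form n t (\<lambda>j. poly (e j)) (\<lambda>j. poly (h j))
      + (poly (h 1) (t 0) - g) * poly (e 1) (t 0)"
proof -
  \<comment> \<open>\<open>F\<close> pairs traces from opposite sides of the node
    \<open>t (j - 1)\<close>, \<open>G\<close> pairs the two traces from its right. After the index
    shift \<open>F\<close> is the flux term of \<open>broken_form\<close>.\<close>
  define F where "F j = poly (e j) (t (j - 1)) * poly (h (j - 1)) (t (j - 1))" for j
  define G where "G j = poly (e j) (t (j - 1)) * poly (h j) (t (j - 1))" for j
  define I where "I j = integral {t (j - 1)..t j} (\<lambda>y. poly (e j) y * poly (pderiv (h j)) y)" for j
  have parts: "integral {t (j - 1)..t j} (\<lambda>y. poly (h j) y * poly (pderiv (e j)) y)
      = poly (h j) (t j) * poly (e j) (t j) - G j - I j" if "j \<in> {1..n}" for j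
  proof -
    let ?u = "t (j - 1)" and ?v = "t j"
    have "((\<lambda>y. poly (pderiv (h j * e j)) y) has_integral (poly (h j * e j) ?v - poly (h j * e j) ?u)) {?u..?v}"
      using t[OF that] by (intro fundamental_theorem_of_calculus)
        (auto simp del: poly_mult simp flip: has_real_derivative_iff_has_vector_derivative
          intro!: DERIV_subset[OF poly_DERIV])
    then have "integral {?u..?v} (\<lambda>y. poly (h j) y * poly (pderiv (e j)) y + poly (e j) y * poly (pderiv (h j)) y)
       = poly (h j * e j) ?v - poly (h j * e j) ?u"
      by (simp add: integral_unique pderiv_mult)
    moreover have "integral {?u..?v} (\<lambda>y. poly (h j) y * poly (pderiv (e j)) y + poly (e j) y * poly (pderiv (h j)) y)
       = integral {?u..?v} (\<lambda>y. poly (h j) y * poly (pderiv (e j)) y) + I j"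
      unfolding I_def by (intro Henstock_Kurzweil_Integration.integral_add integrable_continuous_real continuous_intros)
    moreover have "G j = poly (h j) ?u * poly (e j) ?u" by (simp add: G_def)
    ultimately show ?thesis by simp
  qed
  \<comment> \<open>Integration by parts cancels the products at the right ends of all cells. At the
    last node this matches the zero flux of \<open>e\<close> there.\<close>
  have "(\<Sum>j=1..n. poly (h j) (t j) * poly (e j) (t j)
      - (if j = 1 then g else poly (h (j - 1)) (t (j - 1))) * poly (e j) (t (j - 1))
      - integral {t (j - 1)..t j} (\<lambda>y. poly (h j) y * deriv (poly (e j)) y))
    = (\<Sum>j=1..n. (if j = 1 then G 1 - g * poly (e 1) (t 0) else 0)
        + (if 1 < j then G j else 0) - (if 1 < j then F j else 0) + I j)"
  proof (intro sum.cong refl)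
    fix j assume j: "j \<in> {1..n}"
    show "poly (h j) (t j) * poly (e j) (t j)
      - (if j = 1 then g else poly (h (j - 1)) (t (j - 1))) * poly (e j) (t (j - 1))
      - integral {t (j - 1)..t j} (\<lambda>y. poly (h j) y * deriv (poly (e j)) y)
      = (if j = 1 then G 1 - g * poly (e 1) (t 0) else 0)
        + (if 1 < j then G j else 0) - (if 1 < j then F j else 0) + I j"
      unfolding deriv_poly parts[OF j] using j by (auto simp: F_def)
  qed
  also have "\<dots> = (G 1 - g * poly (e 1) (t 0)) + (\<Sum>j=1..n. (if 1 < j then G j else 0) + I j)
      - (\<Sum>j=1..n. if 1 < j then F j else 0)"
    using n by (simp add: sum.distrib sum_subtractf sum.delta)
  also have "(\<Sum>j=1..n. if 1 < j then F j else 0) = (\<Sum>j=1..n. if j < n then F (Suc j) else 0)"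
    by (rule sum_shift_guard[symmetric])
  also have "(G 1 - g * poly (e 1) (t 0)) + (\<Sum>j=1..n. (if 1 < j then G j else 0) + I j)
       - (\<Sum>j=1..n. if j < n then F (Suc j) else 0)
     = (G 1 - g * poly (e 1) (t 0)) - broken_form n t (\<lambda>j. poly (e j)) (\<lambda>j. poly (h j))"
    unfolding broken_form_def F_def G_def I_def
    by (simp add: sum.distrib sum_subtractf if_distrib[of "\<lambda>x. x * _"] cong: if_cong)
  finally show ?thesis by (simp add: G_def algebra_simps)
qed

text \<open>Traces and derivatives are controlled by the integral of the square over their own cell,
  and products are split by Young's inequality. The flux at \<open>t j\<close> uses
  \<open>e (Suc j)\<close> from the next cell, so its share is moved there by
  \<open>sum_shift_guard\<close>. Cell lengths enter only through their lower bound
  \<open>l\<close>.\<close>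

lemma broken_form_bound:
  "\<exists>K>0. \<forall>n t (e :: nat \<Rightarrow> real poly) (h :: nat \<Rightarrow> real poly) l.
     l > 0 \<longrightarrow> (\<forall>j\<in>{1..n}. l \<le> t j - t (j - 1)) \<longrightarrow> (\<forall>j. degree (e j) \<le> k \<and> degree (h j) \<le> k) \<longrightarrow>
     \<bar>broken_form n t (\<lambda>j. poly (e j)) (\<lambda>j. poly (h j))\<bar>
       \<le> K / l * (\<Sum>j=1..n. integral {t (j - 1)..t j} (\<lambda>y. (poly (e j) y)\<^sup>2 + (poly (h j) y)\<^sup>2))"
proof -
  obtain C where C: "C \<ge> 0" "\<And>(q::real poly) a b x. degree q \<le> k \<Longrightarrow> a < b \<Longrightarrow> x \<in> {a..b} \<Longrightarrow>
     (poly q x)\<^sup>2 \<le> C / (b - a) * integral {a..b} (\<lambda>t. (poly q t)\<^sup>2) \<and>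
     ((b - a) * poly (pderiv q) x)\<^sup>2 \<le> C / (b - a) * integral {a..b} (\<lambda>t. (poly q t)\<^sup>2)"
    using poly_inverse_estimate[of k] by blast
  show ?thesis
  \<comment> \<open>The coefficients collected per cell are at most
    \<open>C / l + 1 / (2 * l)\<close> for \<open>e\<close> and \<open>3 * C / (2 * l)\<close> for
    \<open>h\<close>; \<open>2 * C + 1\<close> dominates both and is positive even if
    \<open>C = 0\<close>.\<close>
  proof (intro exI[of _ "2 * C + 1"] conjI allI impI)
    show "0 < 2 * C + 1" using C(1) by simp
    fix n :: nat and t :: "nat \<Rightarrow> real" and l :: real and e h :: "nat \<Rightarrow> real poly"
    assume l: "0 < l" and t: "\<forall>j\<in>{1..n}. l \<le> t j - t (j - 1)"
      and deg: "\<forall>j. degree (e j) \<le> k \<and> degree (h j) \<le> k"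
    define I where "I q j = integral {t (j - 1)..t j} (\<lambda>y. (poly q y)\<^sup>2)" for q :: "real poly" and j
    have I0: "I q j \<ge> 0" for q j
      unfolding I_def by (intro integral_nonneg integrable_continuous_real continuous_intros) auto
    have lt: "t (j-1) < t j" if "j \<in> {1..n}" for j using bspec[OF t that] l by linarith
    have div: "c / (t j - t (j-1)) * I q j \<le> c / l * I q j" if "j \<in> {1..n}" "c \<ge> 0" for c q j
      using bspec[OF t that(1)] lt[OF that(1)] that(2) l I0[of q j]
      by (intro mult_right_mono divide_left_mono) (auto intro!: mult_pos_pos)
    have tr: "(poly q x)\<^sup>2 \<le> C / l * I q j" "((t j - t (j-1)) * poly (pderiv q) x)\<^sup>2 \<le> C / l * I q j"
      if "j \<in> {1..n}" "degree q \<le> k" "x \<in> {t (j-1)..t j}" for q j x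
      using C(2)[OF that(2) lt[OF that(1)] that(3)] div[OF that(1) C(1), of q] unfolding I_def by linarith+
    have ab: "\<bar>a * b\<bar> \<le> (A + B) / 2" if "a\<^sup>2 \<le> A" "b\<^sup>2 \<le> B" for a b A B :: real
      using sum_squares_bound[of "\<bar>a\<bar>" "\<bar>b\<bar>"] that by (simp add: abs_mult)
    have cell: "\<bar>(if j < n then poly (e (Suc j)) (t j) else 0) * poly (h j) (t j)
     - (if 1 < j then poly (e j) (t (j - 1)) else 0) * poly (h j) (t (j - 1))
     - integral {t (j - 1)..t j} (\<lambda>y. poly (e j) y * deriv (poly (h j)) y)\<bar>
     \<le> (if j < n then C / l * I (e (Suc j)) (Suc j) / 2 else 0) + (C / l + 1 / l) / 2 * I (e j) j + 3 * (C / l) / 2 * I (h j) j"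
      if j: "j \<in> {1..n}" for j
    proof -
      let ?L = "t j - t (j - 1)"
      have L: "?L > 0" using lt[OF j] by simp
      have 1: "\<bar>(if j < n then poly (e (Suc j)) (t j) else 0) * poly (h j) (t j)\<bar>
         \<le> (if j < n then C / l * I (e (Suc j)) (Suc j) / 2 else 0) + C / l * I (h j) j / 2"
      proof (cases "j < n")
        case True
        have "\<bar>poly (e (Suc j)) (t j) * poly (h j) (t j)\<bar>
          \<le> (C / l * I (e (Suc j)) (Suc j) + C / l * I (h j) j) / 2"
          by (rule ab) (use tr(1)[of "Suc j"] tr(1)[of j] lt[of "Suc j"] lt[of j] deg j True in auto)
        then show ?thesis using True by (simp add: add_divide_distrib)
      qed (use C(1) l I0 in simp)
      have 2: "\<bar>(if 1 < j then poly (e j) (t (j - 1)) else 0) * poly (h j) (t (j - 1))\<bar>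
         \<le> C / l * I (e j) j / 2 + C / l * I (h j) j / 2"
      proof -
        have "\<bar>poly (e j) (t (j-1)) * poly (h j) (t (j-1))\<bar>
          \<le> (C / l * I (e j) j + C / l * I (h j) j) / 2"
          by (rule ab) (use tr(1)[of j] lt[of j] deg j in auto)
        then show ?thesis using C(1) l I0[of "e j" j] I0[of "h j" j] by (simp add: add_divide_distrib)
      qed
      have half_div: "(X + Y) / 2 / d = 1 / d / 2 * X + Y / 2 / d" for X Y d :: real
        by (simp add: add_divide_distrib)
      \<comment> \<open>Young's inequality is applied to \<open>e j\<close> and the derivative of
        \<open>h j\<close> scaled by \<open>?L\<close>, whose square is bounded by a constant;
        integrating that constant over the cell cancels the division by \<open>?L\<close>.\<close>
      have 3: "\<bar>integral {t (j - 1)..t j} (\<lambda>y. poly (e j) y * poly (pderiv (h j)) y)\<bar>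
         \<le> 1 / l / 2 * I (e j) j + C / l * I (h j) j / 2"
      proof -
        have "norm (integral {t (j - 1)..t j} (\<lambda>y. poly (e j) y * poly (pderiv (h j)) y))
          \<le> integral {t (j - 1)..t j} (\<lambda>y. 1 / ?L / 2 * (poly (e j) y)\<^sup>2 + C / l * I (h j) j / 2 / ?L)"
        proof (intro integral_norm_bound_integral integrable_continuous_real continuous_intros)
          fix y assume y: "y \<in> {t (j - 1)..t j}"
          have "\<bar>poly (e j) y * (?L * poly (pderiv (h j)) y)\<bar> \<le> ((poly (e j) y)\<^sup>2 + C / l * I (h j) j) / 2"
            using tr(2)[OF j _ y] deg by (intro ab) auto
          then have "\<bar>poly (e j) y * poly (pderiv (h j)) y\<bar> * ?L \<le> ((poly (e j) y)\<^sup>2 + C / l * I (h j) j) / 2"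
            using L by (simp add: abs_mult mult_ac)
          then have "\<bar>poly (e j) y * poly (pderiv (h j)) y\<bar> \<le> ((poly (e j) y)\<^sup>2 + C / l * I (h j) j) / 2 / ?L"
            using L by (simp only: pos_le_divide_eq)
          then show "norm (poly (e j) y * poly (pderiv (h j)) y) \<le> 1 / ?L / 2 * (poly (e j) y)\<^sup>2 + C / l * I (h j) j / 2 / ?L"
            unfolding half_div by simp
        qed
        also have "\<dots> = 1 / ?L / 2 * I (e j) j + C / l * I (h j) j / 2 / ?L * ?L"
          using L by (subst Henstock_Kurzweil_Integration.integral_add) (auto simp: I_def intro!: integrable_continuous_real continuous_intros)
        also have "C / l * I (h j) j / 2 / ?L * ?L = C / l * I (h j) j / 2" using L by simp
        also have "1 / ?L / 2 * I (e j) j \<le> 1 / l / 2 * I (e j) j"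
        proof -
          have "1 / d / 2 * X = 1 / d * X / 2" for d X :: real by simp
          then show ?thesis using div[OF j, of 1 "e j"] by (simp only:) (rule divide_right_mono, simp_all)
        qed
        finally show ?thesis by simp
      qed
      have arith: "\<bar>a - b - c\<bar> \<le> P + (Y / 2 + Z / 2) + 3 * X / 2"
        if "\<bar>a\<bar> \<le> P + X / 2" "\<bar>b\<bar> \<le> Y / 2 + X / 2" "\<bar>c\<bar> \<le> Z / 2 + X / 2" for a b c P X Y Z :: real
        using that by linarith
      have "1 / l / 2 * I (e j) j = 1 / l * I (e j) j / 2"
        "(C / l + 1 / l) / 2 * I (e j) j = C / l * I (e j) j / 2 + 1 / l * I (e j) j / 2"
        "3 * (C / l) / 2 * I (h j) j = 3 * (C / l * I (h j) j) / 2"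
        by (simp_all add: algebra_simps add_divide_distrib)
      note eqs = this
      show ?thesis unfolding deriv_poly eqs(2,3) by (rule arith[OF 1 2 3[unfolded eqs(1)]])
    qed
    have "\<bar>broken_form n t (\<lambda>j. poly (e j)) (\<lambda>j. poly (h j))\<bar> \<le>
      (\<Sum>j=1..n. (if j < n then C / l * I (e (Suc j)) (Suc j) / 2 else 0) + (C / l + 1 / l) / 2 * I (e j) j + 3 * (C / l) / 2 * I (h j) j)"
      unfolding broken_form_def by (rule order_trans[OF sum_abs sum_mono]) (rule cell)
    also have "\<dots> = (\<Sum>j=1..n. (if 1 < j then C / l * I (e j) j / 2 else 0)) + (\<Sum>j=1..n. (C / l + 1 / l) / 2 * I (e j) j + 3 * (C / l) / 2 * I (h j) j)"
      using sum_shift_guard[of n "\<lambda>j. C / l * I (e j) j / 2"] by (simp add: sum.distrib)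
    also have "\<dots> = (\<Sum>j=1..n. (if 1 < j then C / l * I (e j) j / 2 else 0) + ((C / l + 1 / l) / 2 * I (e j) j + 3 * (C / l) / 2 * I (h j) j))"
      by (simp add: sum.distrib)
    also have "\<dots> \<le> (\<Sum>j=1..n. (2*C+1) / l * (I (e j) j + I (h j) j))"
    proof (rule sum_mono)
      fix j :: nat
      have arith: "(if 1 < j then X / 2 else 0) + ((X / 2 + Z / 2) + 3 * Y / 2) \<le> 2 * X + Z + 2 * Y + W"
        if "0 \<le> X" "0 \<le> Y" "0 \<le> Z" "0 \<le> W" for X Y Z W :: real
        using that by auto
      have "(C / l + 1 / l) / 2 * I (e j) j = C / l * I (e j) j / 2 + 1 / l * I (e j) j / 2"
        "3 * (C / l) / 2 * I (h j) j = 3 * (C / l * I (h j) j) / 2"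
        "(2*C+1) / l * (I (e j) j + I (h j) j)
          = 2 * (C / l * I (e j) j) + 1 / l * I (e j) j + 2 * (C / l * I (h j) j) + 1 / l * I (h j) j"
        by (simp_all add: algebra_simps add_divide_distrib)
      note eqs = this
      show "(if 1 < j then C / l * I (e j) j / 2 else 0) + ((C / l + 1 / l) / 2 * I (e j) j + 3 * (C / l) / 2 * I (h j) j)
        \<le> (2*C+1) / l * (I (e j) j + I (h j) j)"
        unfolding eqs by (rule arith) (use C(1) l I0 in simp_all)
    qed
    also have "\<dots> = (2*C+1) / l * (\<Sum>j=1..n. integral {t (j - 1)..t j} (\<lambda>y. (poly (e j) y)\<^sup>2 + (poly (h j) y)\<^sup>2))"
      unfolding sum_distrib_left[symmetric] I_def
      by (subst Henstock_Kurzweil_Integration.integral_add) (auto intro!: integrable_continuous_real continuous_intros)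
    finally show "\<bar>broken_form n t (\<lambda>j. poly (e j)) (\<lambda>j. poly (h j))\<bar>
       \<le> (2*C+1) / l * (\<Sum>j=1..n. integral {t (j - 1)..t j} (\<lambda>y. (poly (e j) y)\<^sup>2 + (poly (h j) y)\<^sup>2))" .
  qed
qed

section \<open>Bivariate polynomials and cell integrals\<close>

text \<open>The space \<open>Q_k\<close> on the whole plane instead of one cell: with the polynomial
  extended past the edges, one-sided traces become plain values and integrands are continuous up to
  the boundary. Currying makes slices and exchanges of variables direct.\<close>

definition bipoly :: "nat \<Rightarrow> (real \<Rightarrow> real \<Rightarrow> real) set" where
  "bipoly k = {f. \<exists>c. \<forall>x y. f x y = (\<Sum>a\<le>k. \<Sum>b\<le>k. c a b * x ^ a * y ^ b)}"

lemma bipoly_add: "f \<in> bipoly k \<Longrightarrow> g \<in> bipoly k \<Longrightarrow> (\<lambda>x y. f x y + g x y) \<in> bipoly k"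
proof -
  assume "f \<in> bipoly k" "g \<in> bipoly k"
  then obtain c d where "\<forall>x y. f x y = (\<Sum>a\<le>k. \<Sum>b\<le>k. c a b * x ^ a * y ^ b)"
    "\<forall>x y. g x y = (\<Sum>a\<le>k. \<Sum>b\<le>k. d a b * x ^ a * y ^ b)" unfolding bipoly_def by blast
  then show ?thesis unfolding bipoly_def
    by (intro CollectI exI[of _ "\<lambda>a b. c a b + d a b"]) (simp add: sum.distrib distrib_right)
qed

lemma bipoly_swap: "f \<in> bipoly k \<Longrightarrow> (\<lambda>x y. f y x) \<in> bipoly k"
proof -
  assume "f \<in> bipoly k"
  then obtain c where c: "\<forall>x y. f x y = (\<Sum>a\<le>k. \<Sum>b\<le>k. c a b * x ^ a * y ^ b)"
    unfolding bipoly_def by blast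
  have "f y x = (\<Sum>a\<le>k. \<Sum>b\<le>k. c b a * x ^ a * y ^ b)" for x y
    unfolding c[rule_format] by (subst sum.swap) (simp add: mult_ac)
  then show ?thesis unfolding bipoly_def by (intro CollectI exI[of _ "\<lambda>a b. c b a"]) simp
qed

lemma bipoly_slice:
  assumes "f \<in> bipoly k"
  shows "\<exists>q. degree q \<le> k \<and> f x = poly q"
proof -
  obtain c where c: "\<forall>x y. f x y = (\<Sum>a\<le>k. \<Sum>b\<le>k. c a b * x ^ a * y ^ b)"
    using assms unfolding bipoly_def by blast
  let ?q = "\<Sum>b\<le>k. monom (\<Sum>a\<le>k. c a b * x ^ a) b"
  have "degree ?q \<le> k"
    by (intro degree_sum_le) (auto intro: order_trans[OF degree_monom_le])
  moreover have "f x = poly ?q"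
  proof
    fix y
    have "f x y = (\<Sum>b\<le>k. \<Sum>a\<le>k. c a b * x ^ a * y ^ b)"
      unfolding c[rule_format] by (rule sum.swap)
    then show "f x y = poly ?q y" by (simp add: poly_sum poly_monom sum_distrib_right)
  qed
  ultimately show ?thesis by blast
qed

lemma continuous_on_bipoly:
  assumes "f \<in> bipoly k" "continuous_on S u" "continuous_on S v"
  shows "continuous_on S (\<lambda>z. f (u z) (v z))"
proof -
  obtain c where c: "\<And>x y. f x y = (\<Sum>a\<le>k. \<Sum>b\<le>k. c a b * x ^ a * y ^ b)"
    using assms unfolding bipoly_def by blast
  show ?thesis unfolding c by (intro continuous_intros assms)
qed

lemma continuous_on_deriv_bipoly:
  assumes "f \<in> bipoly k" "continuous_on S u" "continuous_on S v"
  shows "continuous_on S (\<lambda>z. deriv (f (u z)) (v z))"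
proof -
  obtain c where c: "\<And>x y. f x y = (\<Sum>a\<le>k. \<Sum>b\<le>k. c a b * x ^ a * y ^ b)"
    using assms unfolding bipoly_def by blast
  have "deriv (f x) y = (\<Sum>a\<le>k. \<Sum>b\<le>k. c a b * x ^ a * (real b * y ^ (b - 1)))" for x y
  proof (rule DERIV_imp_deriv)
    show "(f x has_real_derivative (\<Sum>a\<le>k. \<Sum>b\<le>k. c a b * x ^ a * (real b * y ^ (b - 1)))) (at y)"
      unfolding c[abs_def]
      by (intro DERIV_sum) (rule derivative_eq_intros refl | simp)+
  qed
  then show ?thesis by (simp only:) (intro continuous_intros assms)
qed

section \<open>Integrals over open cells as iterated integrals of continuous extensions\<close>

lemma lebesgue_integral_open_interval:
  fixes F g :: "real \<Rightarrow> real"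
  assumes "\<And>x. x \<in> {a<..<b} \<Longrightarrow> F x = g x" "continuous_on UNIV g"
  shows "(LINT x|lebesgue_on {a<..<b}. F x) = integral {a..b} g"
proof -
  have "g absolutely_integrable_on {a<..<b}"
    by (rule set_integrable_subset[OF absolutely_integrable_continuous_real[of a b]])
      (auto intro: continuous_on_subset[OF assms(2)])
  then have "(LINT x|lebesgue_on {a<..<b}. g x) = integral {a<..<b} g"
    by (intro lebesgue_integral_eq_integral absolutely_integrable_imp_integrable) auto
  moreover have "(LINT x|lebesgue_on {a<..<b}. F x) = (LINT x|lebesgue_on {a<..<b}. g x)"
    using assms(1) by (intro Bochner_Integration.integral_cong) auto
  ultimately show ?thesis by (simp add: integral_open_interval_real)
qed

lemma open_rectangle_eq_box: "{a<..<b} \<times> {c<..<d} = box (a, c) (b, d :: real)" for a b :: real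
  by (subst box_prod) simp

text \<open>Both orders are needed: forms with y-derivatives are sliced at fixed x, those with
  x-derivatives at fixed y. Open and closed rectangle differ by a null set, and \<open>F\<close> has
  to agree with \<open>g\<close> only inside, since values on grid lines are arbitrary.\<close>

lemma lebesgue_integral_open_rectangle:
  fixes F :: "real \<times> real \<Rightarrow> real"
  assumes F: "\<And>x y. x \<in> {a<..<b} \<Longrightarrow> y \<in> {c<..<d} \<Longrightarrow> F (x, y) = g x y"
    and g: "continuous_on UNIV (\<lambda>z. g (fst z) (snd z))"
  shows "(LINT z|lebesgue_on ({a<..<b} \<times> {c<..<d}). F z) = integral {a..b} (\<lambda>x. integral {c..d} (g x))"
    and "(LINT z|lebesgue_on ({a<..<b} \<times> {c<..<d}). F z) = integral {c..d} (\<lambda>y. integral {a..b} (\<lambda>x. g x y))"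
proof -
  let ?g = "\<lambda>z. g (fst z) (snd z)" and ?K = "{a<..<b} \<times> {c<..<d}"
  have K: "?K \<in> sets lebesgue" unfolding open_rectangle_eq_box by simp
  have "?g absolutely_integrable_on cbox (a, c) (b, d)"
    using g by (intro absolutely_integrable_continuous continuous_on_subset[OF g]) auto
  then have "?g absolutely_integrable_on ?K"
    by (rule set_integrable_subset) (auto simp: K)
  then have "(LINT z|lebesgue_on ?K. ?g z) = integral ?K ?g"
    by (intro lebesgue_integral_eq_integral absolutely_integrable_imp_integrable K)
  also have "\<dots> = integral (cbox (a, c) (b, d)) ?g"
    unfolding open_rectangle_eq_box by (rule integral_open_interval)
  also have "\<dots> = integral {a..b} (\<lambda>x. integral {c..d} (g x))"
    using integral_prod_continuous[of a c b d ?g] continuous_on_subset[OF g] by simp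
  finally have *: "(LINT z|lebesgue_on ?K. ?g z) = integral {a..b} (\<lambda>x. integral {c..d} (g x))" .
  have "(LINT z|lebesgue_on ?K. F z) = (LINT z|lebesgue_on ?K. ?g z)"
    using F by (intro Bochner_Integration.integral_cong) auto
  with * show 1: "(LINT z|lebesgue_on ?K. F z) = integral {a..b} (\<lambda>x. integral {c..d} (g x))" by simp
  have "continuous_on (cbox (a,c) (b,d)) (\<lambda>(x, y). g x y)"
    using continuous_on_subset[OF g] by (auto simp: case_prod_unfold)
  from integral_swap_continuous[OF this]
  show "(LINT z|lebesgue_on ?K. F z) = integral {c..d} (\<lambda>y. integral {a..b} (\<lambda>x. g x y))"
    unfolding 1 by simp
qed

section \<open>Broken forms on a rectangle\<close>

lemma bipoly_family_slice:
  assumes "\<And>i j. f i j \<in> bipoly k"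
  obtains q where "\<And>j. degree (q j) \<le> k" "\<And>j. f i j x = poly (q j)"
proof -
  have "\<forall>j. \<exists>q. degree q \<le> k \<and> f i j x = poly q" using bipoly_slice[OF assms] by blast
  then obtain q where "\<forall>j. degree (q j) \<le> k \<and> f i j x = poly (q j)" by metis
  then show ?thesis using that by blast
qed

lemma continuous_on_integral_bipoly:
  fixes g :: "real \<Rightarrow> real \<Rightarrow> real"
  assumes "continuous_on UNIV (\<lambda>z. g (fst z) (snd z))"
  shows "continuous_on S (\<lambda>x. integral {c..d} (g x))"
proof -
  have "continuous_on (S \<times> cbox c d) (\<lambda>(x, t). g x t)"
    using continuous_on_subset[OF assms] by (auto simp: case_prod_unfold)
  from integral_continuous_on_param[OF this] show ?thesis by simp
qed

text \<open>One form serves both directions: it differentiates in the second variable and integrates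
  over slices of the first. The x-direction is obtained by exchanging variables and indices.\<close>

definition broken_int :: "nat \<Rightarrow> (nat \<Rightarrow> real) \<Rightarrow> nat \<Rightarrow> (nat \<Rightarrow> real) \<Rightarrow>
    (nat \<Rightarrow> nat \<Rightarrow> real \<Rightarrow> real \<Rightarrow> real) \<Rightarrow> (nat \<Rightarrow> nat \<Rightarrow> real \<Rightarrow> real \<Rightarrow> real) \<Rightarrow> real" where
  "broken_int m s n t e h = (\<Sum>i=1..m. integral {s (i - 1)..s i} (\<lambda>x. broken_form n t (\<lambda>j. e i j x) (\<lambda>j. h i j x)))"

context
  fixes k :: nat and s t :: "nat \<Rightarrow> real" and m n :: nat
begin

lemma continuous_on_broken_form:
  assumes e: "\<And>i j. e i j \<in> bipoly k" and h: "\<And>i j. h i j \<in> bipoly k"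
  shows "continuous_on S (\<lambda>x. broken_form n t (\<lambda>j. e i j x) (\<lambda>j. h i j x))"
proof -
  have "continuous_on S (\<lambda>x. if P then e i j x y else 0)" for P j y
    by (cases P) (auto intro!: continuous_intros continuous_on_bipoly[OF e])
  then show ?thesis unfolding broken_form_def
    by (intro continuous_intros continuous_on_integral_bipoly continuous_on_bipoly[OF e]
      continuous_on_bipoly[OF h] continuous_on_deriv_bipoly[OF h])
qed

lemma integrable_broken_form:
  assumes "\<And>i j. e i j \<in> bipoly k" "\<And>i j. h i j \<in> bipoly k"
  shows "(\<lambda>x. broken_form n t (\<lambda>j. e i j x) (\<lambda>j. h i j x)) integrable_on {a..b}"
  by (intro integrable_continuous_real continuous_on_broken_form assms)

text \<open>Separates edge and volume terms per cell, the shape in which the scheme presents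
  them.\<close>

lemma broken_int_cells:
  assumes e: "\<And>i j. e i j \<in> bipoly k" and h: "\<And>i j. h i j \<in> bipoly k"
  shows "broken_int m s n t e h = (\<Sum>i=1..m. \<Sum>j=1..n.
      integral {s (i - 1)..s i} (\<lambda>x. (if j < n then e i (Suc j) x (t j) else 0) * h i j x (t j)
        - (if 1 < j then e i j x (t (j - 1)) else 0) * h i j x (t (j - 1)))
      - integral {s (i - 1)..s i} (\<lambda>x. integral {t (j - 1)..t j} (\<lambda>y. e i j x y * deriv (h i j x) y)))"
proof -
  have "continuous_on S (\<lambda>x. if P then e i j x y else 0)" for P i j y S
    by (cases P) (auto intro!: continuous_intros continuous_on_bipoly[OF e])
  then show ?thesis
    unfolding broken_int_def broken_form_def
    by (subst Henstock_Kurzweil_Integration.integral_sum)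
      (auto intro!: sum.cong Henstock_Kurzweil_Integration.integral_diff integrable_continuous_real
        continuous_intros continuous_on_integral_bipoly continuous_on_bipoly[OF e]
        continuous_on_bipoly[OF h] continuous_on_deriv_bipoly[OF h])
qed

text \<open>At fixed \<open>x\<close> all cell functions are univariate polynomials, so
  \<open>adjoint_broken_form\<close> applies slice by slice. Only the flux \<open>g\<close> on the
  first boundary edge leaves a remainder.\<close>

lemma adjoint_broken_int:
  assumes e: "\<And>i j. e i j \<in> bipoly k" and h: "\<And>i j. h i j \<in> bipoly k"
    and g: "\<And>i. continuous_on UNIV (g i)"
    and n: "n \<ge> 1" and t: "\<And>j. j \<in> {1..n} \<Longrightarrow> t (j - 1) < t j"
  shows "(\<Sum>i=1..m. \<Sum>j=1..n.
      integral {s (i - 1)..s i} (\<lambda>x. h i j x (t j) * e i j x (t j)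
        - (if j = 1 then g i x else h i (j - 1) x (t (j - 1))) * e i j x (t (j - 1)))
      - integral {s (i - 1)..s i} (\<lambda>x. integral {t (j - 1)..t j} (\<lambda>y. h i j x y * deriv (e i j x) y)))
     = - broken_int m s n t e h
       + (\<Sum>i=1..m. integral {s (i - 1)..s i} (\<lambda>x. (h i 1 x (t 0) - g i x) * e i 1 x (t 0)))"
proof -
  have g': "continuous_on S (g i)" for S i using g continuous_on_subset by blast
  have c: "continuous_on S (\<lambda>x. if P then g i x else h i j x y)" for P i j y S
    by (cases P) (auto intro!: continuous_intros continuous_on_bipoly[OF h] g')
  have pt: "(\<Sum>j=1..n. h i j x (t j) * e i j x (t j)
        - (if j = 1 then g i x else h i (j - 1) x (t (j - 1))) * e i j x (t (j - 1))
        - integral {t (j - 1)..t j} (\<lambda>y. h i j x y * deriv (e i j x) y))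
     = - broken_form n t (\<lambda>j. e i j x) (\<lambda>j. h i j x) + (h i 1 x (t 0) - g i x) * e i 1 x (t 0)" for i x
  proof -
    obtain p where p: "\<And>j. e i j x = poly (p j)" using bipoly_family_slice[of e] e by metis
    obtain q where q: "\<And>j. h i j x = poly (q j)" using bipoly_family_slice[of h] h by metis
    show ?thesis unfolding p q
      by (rule adjoint_broken_form[where h=q and e=p and g="g i x"]) (use n t in auto)
  qed
  have "(\<Sum>j=1..n. integral {s (i - 1)..s i} (\<lambda>x. h i j x (t j) * e i j x (t j)
        - (if j = 1 then g i x else h i (j - 1) x (t (j - 1))) * e i j x (t (j - 1)))
      - integral {s (i - 1)..s i} (\<lambda>x. integral {t (j - 1)..t j} (\<lambda>y. h i j x y * deriv (e i j x) y)))
     = - integral {s (i - 1)..s i} (\<lambda>x. broken_form n t (\<lambda>j. e i j x) (\<lambda>j. h i j x))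
       + integral {s (i - 1)..s i} (\<lambda>x. (h i 1 x (t 0) - g i x) * e i 1 x (t 0))" (is "?L = ?R") for i
  proof -
    have "?L = integral {s (i - 1)..s i} (\<lambda>x. \<Sum>j=1..n. h i j x (t j) * e i j x (t j)
        - (if j = 1 then g i x else h i (j - 1) x (t (j - 1))) * e i j x (t (j - 1))
        - integral {t (j - 1)..t j} (\<lambda>y. h i j x y * deriv (e i j x) y))"
      by (subst Henstock_Kurzweil_Integration.integral_sum)
        (auto intro!: sum.cong Henstock_Kurzweil_Integration.integral_diff[symmetric] integrable_continuous_real
          continuous_intros continuous_on_integral_bipoly c continuous_on_bipoly[OF h]
          continuous_on_bipoly[OF e] continuous_on_deriv_bipoly[OF e])
    also have "\<dots> = ?R" unfolding pt
      by (subst Henstock_Kurzweil_Integration.integral_add)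
        (auto intro!: integrable_continuous_real continuous_on_broken_form[OF e h] continuous_intros
          continuous_on_bipoly[OF e] continuous_on_bipoly[OF h] g')
    finally show ?thesis .
  qed
  then show ?thesis by (simp only: broken_int_def sum.distrib sum_negf)
qed

section \<open>Bilinearity and boundedness of the broken forms\<close>

lemma broken_form_add_left:
  assumes e: "\<And>i j. e i j \<in> bipoly k" "\<And>i j. e' i j \<in> bipoly k" and h: "\<And>i j. h i j \<in> bipoly k"
  shows "broken_form n t (\<lambda>j y. e i j x y + e' i j x y) (\<lambda>j. h i j x)
    = broken_form n t (\<lambda>j. e i j x) (\<lambda>j. h i j x) + broken_form n t (\<lambda>j. e' i j x) (\<lambda>j. h i j x)"
proof -
  have "integral {t (j - 1)..t j} (\<lambda>y. (e i j x y + e' i j x y) * deriv (h i j x) y)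
     = integral {t (j - 1)..t j} (\<lambda>y. e i j x y * deriv (h i j x) y)
     + integral {t (j - 1)..t j} (\<lambda>y. e' i j x y * deriv (h i j x) y)" for j
    unfolding distrib_right
    by (intro Henstock_Kurzweil_Integration.integral_add integrable_continuous_real continuous_intros
      continuous_on_bipoly[OF e(1)] continuous_on_bipoly[OF e(2)] continuous_on_deriv_bipoly[OF h])
  then show ?thesis unfolding broken_form_def sum.distrib[symmetric]
    by (intro sum.cong refl) (simp add: algebra_simps)
qed

lemma broken_form_add_right:
  assumes e: "\<And>i j. e i j \<in> bipoly k" and h: "\<And>i j. h i j \<in> bipoly k" "\<And>i j. h' i j \<in> bipoly k"
  shows "broken_form n t (\<lambda>j. e i j x) (\<lambda>j y. h i j x y + h' i j x y)
    = broken_form n t (\<lambda>j. e i j x) (\<lambda>j. h i j x) + broken_form n t (\<lambda>j. e i j x) (\<lambda>j. h' i j x)"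
proof -
  obtain q where q: "\<And>j. h i j x = poly (q j)" using bipoly_family_slice[of h] h by metis
  obtain q' where q': "\<And>j. h' i j x = poly (q' j)" using bipoly_family_slice[of h'] h by metis
  \<comment> \<open>\<open>deriv\<close> is additive only for differentiable functions; the slices
    are replaced by polynomials to supply this.\<close>
  have d: "deriv (\<lambda>y. h i j x y + h' i j x y) y = deriv (h i j x) y + deriv (h' i j x) y" for j y
    unfolding q q' by (rule DERIV_imp_deriv) (auto intro!: derivative_eq_intros)
  have "integral {t (j - 1)..t j} (\<lambda>y. e i j x y * (deriv (h i j x) y + deriv (h' i j x) y))
     = integral {t (j - 1)..t j} (\<lambda>y. e i j x y * deriv (h i j x) y)
     + integral {t (j - 1)..t j} (\<lambda>y. e i j x y * deriv (h' i j x) y)" for j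
    unfolding distrib_left
    by (intro Henstock_Kurzweil_Integration.integral_add integrable_continuous_real continuous_intros
      continuous_on_bipoly[OF e] continuous_on_deriv_bipoly[OF h(1)] continuous_on_deriv_bipoly[OF h(2)])
  then show ?thesis unfolding broken_form_def sum.distrib[symmetric] d
    by (intro sum.cong refl) (simp add: algebra_simps)
qed

lemma broken_int_add_left:
  assumes e: "\<And>i j. e i j \<in> bipoly k" "\<And>i j. e' i j \<in> bipoly k" and h: "\<And>i j. h i j \<in> bipoly k"
  shows "broken_int m s n t (\<lambda>i j x y. e i j x y + e' i j x y) h = broken_int m s n t e h + broken_int m s n t e' h"
  unfolding broken_int_def sum.distrib[symmetric] broken_form_add_left[where e=e and e'=e' and h=h, OF assms]
  by (intro sum.cong refl Henstock_Kurzweil_Integration.integral_add integrable_broken_form assms)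

lemma broken_int_add_right:
  assumes e: "\<And>i j. e i j \<in> bipoly k" and h: "\<And>i j. h i j \<in> bipoly k" "\<And>i j. h' i j \<in> bipoly k"
  shows "broken_int m s n t e (\<lambda>i j x y. h i j x y + h' i j x y) = broken_int m s n t e h + broken_int m s n t e h'"
  unfolding broken_int_def sum.distrib[symmetric] broken_form_add_right[where e=e and h=h and h'=h', OF assms]
  by (intro sum.cong refl Henstock_Kurzweil_Integration.integral_add integrable_broken_form assms)

end

text \<open>The univariate bound is integrated over the slices. Since nothing is differentiated in
  the slicing variable, the lengths \<open>s i - s (i - 1)\<close> do not enter the
  constant.\<close>

lemma broken_int_bound:
  "\<exists>K>0. \<forall>m s n t e h l. l > 0 \<longrightarrow> (\<forall>j\<in>{1..n}. l \<le> t j - t (j - 1)) \<longrightarrow>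
     (\<forall>i j. e i j \<in> bipoly k \<and> h i j \<in> bipoly k) \<longrightarrow>
     \<bar>broken_int m s n t e h\<bar> \<le> K / l * (\<Sum>i=1..m. \<Sum>j=1..n.
        integral {s (i - 1)..s i} (\<lambda>x. integral {t (j - 1)..t j} (\<lambda>y. (e i j x y)\<^sup>2 + (h i j x y)\<^sup>2)))"
proof -
  obtain K where K: "K > 0" "\<And>n t (e :: nat \<Rightarrow> real poly) (h :: nat \<Rightarrow> real poly) l. l > 0 \<Longrightarrow>
     (\<forall>j\<in>{1..n}. l \<le> t j - t (j - 1)) \<Longrightarrow> (\<forall>j. degree (e j) \<le> k \<and> degree (h j) \<le> k) \<Longrightarrow>
     \<bar>broken_form n t (\<lambda>j. poly (e j)) (\<lambda>j. poly (h j))\<bar>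
       \<le> K / l * (\<Sum>j=1..n. integral {t (j - 1)..t j} (\<lambda>y. (poly (e j) y)\<^sup>2 + (poly (h j) y)\<^sup>2))"
    using broken_form_bound[of k] by blast
  show ?thesis
  proof (intro exI[of _ K] conjI K(1) allI impI)
    fix m n :: nat and s t :: "nat \<Rightarrow> real" and e h :: "nat \<Rightarrow> nat \<Rightarrow> real \<Rightarrow> real \<Rightarrow> real" and l :: real
    assume l: "l > 0" and t: "\<forall>j\<in>{1..n}. l \<le> t j - t (j - 1)" and "\<forall>i j. e i j \<in> bipoly k \<and> h i j \<in> bipoly k"
    then have e: "\<And>i j. e i j \<in> bipoly k" and h: "\<And>i j. h i j \<in> bipoly k" by auto
    let ?I = "\<lambda>i j x. integral {t (j - 1)..t j} (\<lambda>y. (e i j x y)\<^sup>2 + (h i j x y)\<^sup>2)"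
    have pt: "norm (broken_form n t (\<lambda>j. e i j x) (\<lambda>j. h i j x)) \<le> K / l * (\<Sum>j=1..n. ?I i j x)" for i x
    proof -
      obtain p where p: "\<And>j. degree (p j) \<le> k" "\<And>j. e i j x = poly (p j)" using bipoly_family_slice[of e] e by metis
      obtain q where q: "\<And>j. degree (q j) \<le> k" "\<And>j. h i j x = poly (q j)" using bipoly_family_slice[of h] h by metis
      show ?thesis unfolding p(2) q(2) real_norm_def using K(2)[OF l t] p(1) q(1) by blast
    qed
    have cont: "continuous_on S (?I i j)" for S i j
      by (intro continuous_on_integral_bipoly continuous_intros continuous_on_bipoly[OF e] continuous_on_bipoly[OF h])
    have "\<bar>broken_int m s n t e h\<bar> \<le> (\<Sum>i=1..m. norm (integral {s (i - 1)..s i} (\<lambda>x. broken_form n t (\<lambda>j. e i j x) (\<lambda>j. h i j x))))"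
      unfolding broken_int_def real_norm_def by (rule sum_abs)
    also have "\<dots> \<le> (\<Sum>i=1..m. integral {s (i - 1)..s i} (\<lambda>x. K / l * (\<Sum>j=1..n. ?I i j x)))"
      by (intro sum_mono integral_norm_bound_integral pt integrable_broken_form[of _ k] e h
          integrable_continuous_real continuous_intros cont)
    also have "\<dots> = K / l * (\<Sum>i=1..m. \<Sum>j=1..n. integral {s (i - 1)..s i} (?I i j))"
    proof -
      have "integral {a..b} (\<lambda>x. \<Sum>j=1..n. ?I i j x) = (\<Sum>j=1..n. integral {a..b} (?I i j))" for a b i
        by (intro Henstock_Kurzweil_Integration.integral_sum finite_atLeastAtMost integrable_continuous_real cont)
      then show ?thesis by (simp only: integral_mult_right sum_distrib_left[symmetric])
    qed
    finally show "\<bar>broken_int m s n t e h\<bar> \<le> K / l * (\<Sum>i=1..m. \<Sum>j=1..n. integral {s (i - 1)..s i} (?I i j))" .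
  qed
qed

section \<open>Traces and discrete curls\<close>

text \<open>All members of the family are polynomials, also for indices outside the mesh, so that
  continuity facts carry no index conditions.\<close>

definition piecewise :: "mesh \<Rightarrow> nat \<Rightarrow> (real \<times> real \<Rightarrow> real) \<Rightarrow> (nat \<Rightarrow> nat \<Rightarrow> real \<Rightarrow> real \<Rightarrow> real) \<Rightarrow> bool" where
  "piecewise M k U f \<longleftrightarrow> (\<forall>i j. f i j \<in> bipoly k) \<and>
     (\<forall>i\<in>{1..Nx M}. \<forall>j\<in>{1..Ny M}. \<forall>x\<in>Icell M i. \<forall>y\<in>Jcell M j. U (x, y) = f i j x y)"

lemma piecewiseD:
  assumes "piecewise M k U f"
  shows "f i j \<in> bipoly k"
    and "i \<in> {1..Nx M} \<Longrightarrow> j \<in> {1..Ny M} \<Longrightarrow> x \<in> Icell M i \<Longrightarrow> y \<in> Jcell M j \<Longrightarrow> U (x, y) = f i j x y"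
  using assms unfolding piecewise_def by auto

lemma Uhk_iff_piecewise: "U \<in> Uhk M k \<longleftrightarrow> (\<exists>f. piecewise M k U f)"
proof
  assume U: "U \<in> Uhk M k"
  \<comment> \<open>The zero polynomial fills the indices outside the mesh.\<close>
  have zero: "(\<lambda>x y. 0) \<in> bipoly k" unfolding bipoly_def by (auto intro!: exI[of _ "\<lambda>_ _. 0"])
  have "\<exists>g\<in>bipoly k. i \<in> {1..Nx M} \<longrightarrow> j \<in> {1..Ny M} \<longrightarrow> (\<forall>x\<in>Icell M i. \<forall>y\<in>Jcell M j. U (x, y) = g x y)" for i j
  proof (cases "i \<in> {1..Nx M} \<and> j \<in> {1..Ny M}")
    case True
    then have "Qk k (Kcell M i j) U" using U unfolding Uhk_def by blast
    then obtain c where c: "\<forall>x y. (x, y) \<in> Kcell M i j \<longrightarrow> U (x, y) = (\<Sum>a\<le>k. \<Sum>b\<le>k. c a b * x ^ a * y ^ b)"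
      unfolding Qk_def by blast
    then show ?thesis
      by (intro bexI[of _ "\<lambda>x y. \<Sum>a\<le>k. \<Sum>b\<le>k. c a b * x ^ a * y ^ b"])
        (auto simp: Kcell_def bipoly_def)
  qed (use zero in auto)
  then have "\<forall>i. \<exists>g. \<forall>j. g j \<in> bipoly k \<and> (i \<in> {1..Nx M} \<longrightarrow> j \<in> {1..Ny M} \<longrightarrow> (\<forall>x\<in>Icell M i. \<forall>y\<in>Jcell M j. U (x, y) = g j x y))"
    by metis
  then obtain f where f: "\<forall>i j. f i j \<in> bipoly k \<and> (i \<in> {1..Nx M} \<longrightarrow> j \<in> {1..Ny M} \<longrightarrow> (\<forall>x\<in>Icell M i. \<forall>y\<in>Jcell M j. U (x, y) = f i j x y))"
    by metis
  have "piecewise M k U f" unfolding piecewise_def using f by blast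
  then show "\<exists>f. piecewise M k U f" by blast
next
  assume "\<exists>f. piecewise M k U f"
  then obtain f where f: "piecewise M k U f" ..
  show "U \<in> Uhk M k" unfolding Uhk_def
  proof (intro CollectI ballI)
    fix i j assume ij: "i \<in> {1..Nx M}" "j \<in> {1..Ny M}"
    obtain c where "\<forall>x y. f i j x y = (\<Sum>a\<le>k. \<Sum>b\<le>k. c a b * x ^ a * y ^ b)"
      using piecewiseD(1)[OF f, of i j] unfolding bipoly_def by blast
    then show "Qk k (Kcell M i j) U" unfolding Qk_def Kcell_def
      using piecewiseD(2)[OF f ij] by (intro exI[of _ c]) auto
  qed
qed

lemma piecewise_add:
  "piecewise M k U f \<Longrightarrow> piecewise M k V g \<Longrightarrow> piecewise M k (\<lambda>z. U z + V z) (\<lambda>i j x y. f i j x y + g i j x y)"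
  unfolding piecewise_def by (auto intro: bipoly_add)

lemma Uhk_add: "U \<in> Uhk M k \<Longrightarrow> V \<in> Uhk M k \<Longrightarrow> (\<lambda>z. U z + V z) \<in> Uhk M k"
  unfolding Uhk_iff_piecewise by (blast intro: piecewise_add)

lemma is_mesh_xnode_less: "is_mesh r s p q M \<Longrightarrow> i \<in> {1..Nx M} \<Longrightarrow> xnode M (i - 1) < xnode M i"
  unfolding is_mesh_def by (cases i) auto

lemma is_mesh_ynode_less: "is_mesh r s p q M \<Longrightarrow> j \<in> {1..Ny M} \<Longrightarrow> ynode M (j - 1) < ynode M j"
  unfolding is_mesh_def by (cases j) auto

text \<open>\<open>U\<close> may be arbitrary at \<open>a\<close> itself; the one-sided limit sees
  only the continuous extension \<open>g\<close> of its values next to \<open>a\<close>.\<close>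

lemma Lim_one_sided:
  fixes g :: "real \<Rightarrow> real"
  assumes "continuous_on UNIV g"
  shows Lim_at_right_eq: "b > a \<Longrightarrow> (\<And>u. u \<in> {a<..<b} \<Longrightarrow> U u = g u) \<Longrightarrow> Lim (at_right a) U = g a"
    and Lim_at_left_eq: "b < a \<Longrightarrow> (\<And>u. u \<in> {b<..<a} \<Longrightarrow> U u = g u) \<Longrightarrow> Lim (at_left a) U = g a"
proof -
  have g: "(g \<longlongrightarrow> g a) (at a within S)" for S
    using assms by (auto simp: continuous_on_def intro: tendsto_within_subset)
  show "Lim (at_right a) U = g a" if "b > a" "\<And>u. u \<in> {a<..<b} \<Longrightarrow> U u = g u"
  proof (rule tendsto_Lim)
    show "(U \<longlongrightarrow> g a) (at_right a)"
      by (rule Lim_transform_eventually[OF g]) (use that in \<open>auto intro!: eventually_at_rightI[of a b]\<close>)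
  qed simp
  show "Lim (at_left a) U = g a" if "b < a" "\<And>u. u \<in> {b<..<a} \<Longrightarrow> U u = g u"
  proof (rule tendsto_Lim)
    show "(U \<longlongrightarrow> g a) (at_left a)"
      by (rule Lim_transform_eventually[OF g]) (use that in \<open>auto intro!: eventually_at_leftI[of b a]\<close>)
  qed simp
qed

context
  fixes r s p q :: real and M :: mesh and k :: nat
  assumes mesh: "is_mesh r s p q M"
begin

lemma continuous_on_piecewise:
  assumes "piecewise M k U f"
  shows "continuous_on S (f i j x)" "continuous_on S (\<lambda>x. f i j x y)"
  by (intro continuous_on_bipoly[OF piecewiseD(1)[OF assms]] continuous_intros)+

text \<open>Node \<open>j\<close> separates the cells \<open>j\<close> and \<open>Suc j\<close>:
  traces from the larger side belong to the cell with the successor index.\<close>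

lemma trace_piecewise:
  assumes U: "piecewise M k U f"
  shows yplus_piecewise: "i \<in> {1..Nx M} \<Longrightarrow> x \<in> Icell M i \<Longrightarrow> j < Ny M \<Longrightarrow> yplus U x (ynode M j) = f i (Suc j) x (ynode M j)"
    and yminus_piecewise: "i \<in> {1..Nx M} \<Longrightarrow> x \<in> Icell M i \<Longrightarrow> j \<in> {1..Ny M} \<Longrightarrow> yminus U x (ynode M j) = f i j x (ynode M j)"
    and xplus_piecewise: "j \<in> {1..Ny M} \<Longrightarrow> y \<in> Jcell M j \<Longrightarrow> i < Nx M \<Longrightarrow> xplus U (xnode M i) y = f (Suc i) j (xnode M i) y"
    and xminus_piecewise: "j \<in> {1..Ny M} \<Longrightarrow> y \<in> Jcell M j \<Longrightarrow> i \<in> {1..Nx M} \<Longrightarrow> xminus U (xnode M i) y = f i j (xnode M i) y"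
proof -
  show "yplus U x (ynode M j) = f i (Suc j) x (ynode M j)" if "i \<in> {1..Nx M}" "x \<in> Icell M i" "j < Ny M"
    unfolding yplus_def
    by (rule Lim_at_right_eq[of _ _ "ynode M (Suc j)"])
      (use that is_mesh_ynode_less[OF mesh, of "Suc j"] in
        \<open>auto intro!: continuous_on_piecewise[OF U] piecewiseD(2)[OF U] simp: Jcell_def\<close>)
  show "yminus U x (ynode M j) = f i j x (ynode M j)" if "i \<in> {1..Nx M}" "x \<in> Icell M i" "j \<in> {1..Ny M}"
    unfolding yminus_def
    by (rule Lim_at_left_eq[of _ "ynode M (j - 1)"])
      (use that is_mesh_ynode_less[OF mesh, of j] in
        \<open>auto intro!: continuous_on_piecewise[OF U] piecewiseD(2)[OF U] simp: Jcell_def\<close>)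
  show "xplus U (xnode M i) y = f (Suc i) j (xnode M i) y" if "j \<in> {1..Ny M}" "y \<in> Jcell M j" "i < Nx M"
    unfolding xplus_def
    by (rule Lim_at_right_eq[of "\<lambda>x. f (Suc i) j x y" _ "xnode M (Suc i)"])
      (use that is_mesh_xnode_less[OF mesh, of "Suc i"] in
        \<open>auto intro!: continuous_on_piecewise[OF U] piecewiseD(2)[OF U] simp: Icell_def\<close>)
  show "xminus U (xnode M i) y = f i j (xnode M i) y" if "j \<in> {1..Ny M}" "y \<in> Jcell M j" "i \<in> {1..Nx M}"
    unfolding xminus_def
    by (rule Lim_at_left_eq[of "\<lambda>x. f i j x y" "xnode M (i - 1)"])
      (use that is_mesh_xnode_less[OF mesh, of i] in
        \<open>auto intro!: continuous_on_piecewise[OF U] piecewiseD(2)[OF U] simp: Icell_def\<close>)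
qed

text \<open>The cells are open, so \<open>U\<close> equals its cell polynomial near the point and
  \<open>deriv\<close> does not see the grid lines.\<close>

lemma partial_piecewise:
  assumes U: "piecewise M k U f" and ij: "i \<in> {1..Nx M}" "j \<in> {1..Ny M}" and xy: "x \<in> Icell M i" "y \<in> Jcell M j"
  shows dy_piecewise: "dy U (x, y) = deriv (f i j x) y"
    and dx_piecewise: "dx U (x, y) = deriv (\<lambda>u. f i j u y) x"
proof -
  have "eventually (\<lambda>u. u \<in> Jcell M j) (nhds y)"
    by (rule eventually_nhds_in_open) (use xy in \<open>auto simp: Jcell_def\<close>)
  then have "eventually (\<lambda>u. U (x, u) = f i j x u) (nhds y)"
    by eventually_elim (rule piecewiseD(2)[OF U ij xy(1)])
  then show "dy U (x, y) = deriv (f i j x) y" unfolding dy_def by (auto intro: deriv_cong_ev)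
  have "eventually (\<lambda>u. u \<in> Icell M i) (nhds x)"
    by (rule eventually_nhds_in_open) (use xy in \<open>auto simp: Icell_def\<close>)
  then have "eventually (\<lambda>u. U (u, y) = f i j u y) (nhds x)"
    by eventually_elim (rule piecewiseD(2)[OF U ij _ xy(2)])
  then show "dx U (x, y) = deriv (\<lambda>u. f i j u y) x" unfolding dx_def by (auto intro: deriv_cong_ev)
qed

end

section \<open>The curl and flux sums of the scheme\<close>

definition curl_x :: "mesh \<Rightarrow> (real \<times> real \<Rightarrow> real) \<Rightarrow> (real \<times> real \<Rightarrow> real) \<Rightarrow> real" where
  "curl_x M E H = (\<Sum>i=1..Nx M. \<Sum>j=1..Ny M.
     (LINT x|lebesgue_on (Icell M i). Ehat_x M E x j * yminus H x (ynode M j)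
        - Ehat_x M E x (j - 1) * yplus H x (ynode M (j - 1)))
     - (LINT z|lebesgue_on (Kcell M i j). E z * dy H z))"

definition curl_y :: "mesh \<Rightarrow> (real \<times> real \<Rightarrow> real) \<Rightarrow> (real \<times> real \<Rightarrow> real) \<Rightarrow> real" where
  "curl_y M E H = (\<Sum>i=1..Nx M. \<Sum>j=1..Ny M.
     (LINT y|lebesgue_on (Jcell M j). Ehat_y M E i y * xminus H (xnode M i) y
        - Ehat_y M E (i - 1) y * xplus H (xnode M (i - 1)) y)
     - (LINT z|lebesgue_on (Kcell M i j). E z * dx H z))"

text \<open>\<open>curl_x\<close> is the weak y-derivative of \<open>E\<close> tested with
  \<open>H\<close>, and \<open>flux_x\<close> that of \<open>H\<close> tested with
  \<open>\<Phi>\<close>. The first takes traces from above with zero boundary values, the second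
  traces from below except on the first boundary edge; this alternation makes them adjoint up to
  sign.\<close>

definition flux_x :: "real \<Rightarrow> mesh \<Rightarrow> (real \<times> real \<Rightarrow> real) \<Rightarrow> (real \<times> real \<Rightarrow> real) \<Rightarrow> (real \<times> real \<Rightarrow> real) \<Rightarrow>
    (real \<times> real \<Rightarrow> real) \<Rightarrow> real" where
  "flux_x c0 M H E1 E0 \<Phi> = (\<Sum>i=1..Nx M. \<Sum>j=1..Ny M.
     (LINT x|lebesgue_on (Icell M i). Hhat_x c0 M H E1 E0 x j * yminus \<Phi> x (ynode M j)
        - Hhat_x c0 M H E1 E0 x (j - 1) * yplus \<Phi> x (ynode M (j - 1)))
     - (LINT z|lebesgue_on (Kcell M i j). H z * dy \<Phi> z))"

definition flux_y :: "real \<Rightarrow> mesh \<Rightarrow> (real \<times> real \<Rightarrow> real) \<Rightarrow> (real \<times> real \<Rightarrow> real) \<Rightarrow> (real \<times> real \<Rightarrow> real) \<Rightarrow>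
    (real \<times> real \<Rightarrow> real) \<Rightarrow> real" where
  "flux_y c0 M H E1 E0 \<Phi> = (\<Sum>i=1..Nx M. \<Sum>j=1..Ny M.
     (LINT y|lebesgue_on (Jcell M j). Hhat_y c0 M H E1 E0 i y * xminus \<Phi> (xnode M i) y
        - Hhat_y c0 M H E1 E0 (i - 1) y * xplus \<Phi> (xnode M (i - 1)) y)
     - (LINT z|lebesgue_on (Kcell M i j). H z * dx \<Phi> z))"

abbreviation (input) transposed :: "(nat \<Rightarrow> nat \<Rightarrow> real \<Rightarrow> real \<Rightarrow> real) \<Rightarrow> nat \<Rightarrow> nat \<Rightarrow> real \<Rightarrow> real \<Rightarrow> real" where
  "transposed f \<equiv> (\<lambda>j i y x. f i j x y)"

lemma continuous_on_if_const:
  "(P \<Longrightarrow> continuous_on S f) \<Longrightarrow> (\<not> P \<Longrightarrow> continuous_on S g) \<Longrightarrow> continuous_on S (\<lambda>x. if P then f x else g x)"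
  by (cases P) auto

context
  fixes r s p q :: real and M :: mesh and k :: nat
  assumes mesh: "is_mesh r s p q M"
begin

lemma volume_term_y:
  assumes E: "piecewise M k E e" and H: "piecewise M k H h" and ij: "i \<in> {1..Nx M}" "j \<in> {1..Ny M}"
  shows "(LINT z|lebesgue_on (Kcell M i j). E z * dy H z) =
    integral {xnode M (i - 1)..xnode M i} (\<lambda>x. integral {ynode M (j - 1)..ynode M j} (\<lambda>y. e i j x y * deriv (h i j x) y))"
  unfolding Kcell_def Icell_def Jcell_def
proof (rule lebesgue_integral_open_rectangle(1))
  show "continuous_on UNIV (\<lambda>z. e i j (fst z) (snd z) * deriv (h i j (fst z)) (snd z))"
    by (intro continuous_intros continuous_on_bipoly[OF piecewiseD(1)[OF E]]
        continuous_on_deriv_bipoly[OF piecewiseD(1)[OF H]])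
qed (simp add: piecewiseD(2)[OF E ij] dy_piecewise[OF mesh H ij] Icell_def Jcell_def)

lemma volume_term_x:
  assumes E: "piecewise M k E e" and H: "piecewise M k H h" and ij: "i \<in> {1..Nx M}" "j \<in> {1..Ny M}"
  shows "(LINT z|lebesgue_on (Kcell M i j). E z * dx H z) =
    integral {ynode M (j - 1)..ynode M j} (\<lambda>y. integral {xnode M (i - 1)..xnode M i} (\<lambda>x. e i j x y * deriv (\<lambda>x. h i j x y) x))"
  unfolding Kcell_def Icell_def Jcell_def
proof (rule lebesgue_integral_open_rectangle(2)[where g="\<lambda>x y. e i j x y * deriv (\<lambda>x. h i j x y) x"])
  have "continuous_on UNIV (\<lambda>z. deriv (\<lambda>x. h i j x (snd z)) (fst z))"
    using continuous_on_deriv_bipoly[OF bipoly_swap[OF piecewiseD(1)[OF H]], of UNIV snd fst] by (simp add: continuous_intros)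
  then show "continuous_on UNIV (\<lambda>z. e i j (fst z) (snd z) * deriv (\<lambda>x. h i j x (snd z)) (fst z))"
    by (intro continuous_intros continuous_on_bipoly[OF piecewiseD(1)[OF E]])
qed (simp add: piecewiseD(2)[OF E ij] dx_piecewise[OF mesh H ij] Icell_def Jcell_def)

lemma curl_x_eq:
  assumes E: "piecewise M k E e" and H: "piecewise M k H h"
  shows "curl_x M E H = broken_int (Nx M) (xnode M) (Ny M) (ynode M) e h"
  unfolding curl_x_def broken_int_cells[of e k h, OF piecewiseD(1)[OF E] piecewiseD(1)[OF H]]
proof (intro sum.cong refl arg_cong2[of _ _ _ _ "(-)"])
  fix i j assume ij: "i \<in> {1..Nx M}" "j \<in> {1..Ny M}"
  show "(LINT z|lebesgue_on (Kcell M i j). E z * dy H z) =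
    integral {xnode M (i - 1)..xnode M i} (\<lambda>x. integral {ynode M (j - 1)..ynode M j} (\<lambda>y. e i j x y * deriv (h i j x) y))"
    by (rule volume_term_y[OF E H ij])
  let ?g = "\<lambda>x. (if j < Ny M then e i (Suc j) x (ynode M j) else 0) * h i j x (ynode M j) -
       (if 1 < j then e i j x (ynode M (j - 1)) else 0) * h i j x (ynode M (j - 1))"
  show "(LINT x|lebesgue_on (Icell M i). Ehat_x M E x j * yminus H x (ynode M j)
        - Ehat_x M E x (j - 1) * yplus H x (ynode M (j - 1))) = integral {xnode M (i - 1)..xnode M i} ?g"
    unfolding Icell_def
  proof (rule lebesgue_integral_open_interval)
    show "continuous_on UNIV ?g"
      by (intro continuous_intros continuous_on_if_const continuous_on_piecewise(2)[OF mesh E] continuous_on_piecewise(2)[OF mesh H])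
    fix x assume "x \<in> {xnode M (i - 1)<..<xnode M i}"
    then have x: "x \<in> Icell M i" by (simp add: Icell_def)
    \<comment> \<open>As \<open>j\<close> is at least 1, truncated subtraction is harmless: the
      trace from above at node \<open>j - 1\<close> is that of cell \<open>j\<close>.\<close>
    have j: "j - 1 < Ny M" "Suc (j - 1) = j" using ij by auto
    show "Ehat_x M E x j * yminus H x (ynode M j) - Ehat_x M E x (j - 1) * yplus H x (ynode M (j - 1)) = ?g x"
      unfolding Ehat_x_def yplus_piecewise[OF mesh H ij(1) x j(1)] yminus_piecewise[OF mesh H ij(1) x ij(2)]
      using ij j yplus_piecewise[OF mesh E ij(1) x, of j] yplus_piecewise[OF mesh E ij(1) x j(1)] by auto
  qed
qed

lemma curl_y_eq:
  assumes E: "piecewise M k E e" and H: "piecewise M k H h"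
  shows "curl_y M E H = broken_int (Ny M) (ynode M) (Nx M) (xnode M) (transposed e) (transposed h)"
  unfolding curl_y_def broken_int_cells[of "transposed e" k "transposed h", OF bipoly_swap[OF piecewiseD(1)[OF E]] bipoly_swap[OF piecewiseD(1)[OF H]]]
\<comment> \<open>With the variables exchanged, the outer sum of \<open>broken_int\<close> runs over
  \<open>j\<close>, while \<open>curl_y\<close> has \<open>i\<close> outside.\<close>
proof (subst sum.swap, intro sum.cong refl arg_cong2[of _ _ _ _ "(-)"])
  fix i j assume ji: "j \<in> {1..Ny M}" "i \<in> {1..Nx M}"
  show "(LINT z|lebesgue_on (Kcell M i j). E z * dx H z) =
    integral {ynode M (j - 1)..ynode M j} (\<lambda>y. integral {xnode M (i - 1)..xnode M i} (\<lambda>x. e i j x y * deriv (\<lambda>x. h i j x y) x))"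
    by (rule volume_term_x[OF E H ji(2,1)])
  let ?g = "\<lambda>y. (if i < Nx M then e (Suc i) j (xnode M i) y else 0) * h i j (xnode M i) y -
       (if 1 < i then e i j (xnode M (i - 1)) y else 0) * h i j (xnode M (i - 1)) y"
  show "(LINT y|lebesgue_on (Jcell M j). Ehat_y M E i y * xminus H (xnode M i) y
        - Ehat_y M E (i - 1) y * xplus H (xnode M (i - 1)) y) = integral {ynode M (j - 1)..ynode M j} ?g"
    unfolding Jcell_def
  proof (rule lebesgue_integral_open_interval)
    show "continuous_on UNIV ?g"
      by (intro continuous_intros continuous_on_if_const continuous_on_piecewise(1)[OF mesh E] continuous_on_piecewise(1)[OF mesh H])
    fix y assume "y \<in> {ynode M (j - 1)<..<ynode M j}"
    then have y: "y \<in> Jcell M j" by (simp add: Jcell_def)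
    have i: "i - 1 < Nx M" "Suc (i - 1) = i" using ji by auto
    show "Ehat_y M E i y * xminus H (xnode M i) y - Ehat_y M E (i - 1) y * xplus H (xnode M (i - 1)) y = ?g y"
      unfolding Ehat_y_def xplus_piecewise[OF mesh H ji(1) y i(1)] xminus_piecewise[OF mesh H ji(1) y ji(2)]
      using ji i xplus_piecewise[OF mesh E ji(1) y, of i] xplus_piecewise[OF mesh E ji(1) y i(1)] by auto
  qed
qed

end

text \<open>Kept as a sum over cells because the scheme is tested cell by cell and the fields are
  polynomial only there; \<open>lebesgue_integral_cells\<close> leads back to the whole
  domain.\<close>

definition cells :: "mesh \<Rightarrow> (real \<times> real \<Rightarrow> real) \<Rightarrow> real" where
  "cells M F = (\<Sum>i=1..Nx M. \<Sum>j=1..Ny M. LINT z|lebesgue_on (Kcell M i j). F z)"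

context
  fixes r s p q :: real and M :: mesh and k :: nat
  assumes mesh: "is_mesh r s p q M"
begin

section \<open>Bilinearity of the discrete curls and their adjointness up to the boundary
  penalty\<close>

lemma curl_x_add_left:
  assumes "E \<in> Uhk M k" "E' \<in> Uhk M k" "H \<in> Uhk M k"
  shows "curl_x M (\<lambda>z. E z + E' z) H = curl_x M E H + curl_x M E' H"
proof -
  obtain e e' h where P: "piecewise M k E e" "piecewise M k E' e'" "piecewise M k H h"
    using assms unfolding Uhk_iff_piecewise by blast
  show ?thesis
    unfolding curl_x_eq[OF mesh piecewise_add[OF P(1,2)] P(3)] curl_x_eq[OF mesh P(1,3)] curl_x_eq[OF mesh P(2,3)]
    by (rule broken_int_add_left[of e k e' h]) (auto intro: piecewiseD(1) P)
qed

lemma curl_x_add_right: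
  assumes "E \<in> Uhk M k" "H \<in> Uhk M k" "H' \<in> Uhk M k"
  shows "curl_x M E (\<lambda>z. H z + H' z) = curl_x M E H + curl_x M E H'"
proof -
  obtain e h h' where P: "piecewise M k E e" "piecewise M k H h" "piecewise M k H' h'"
    using assms unfolding Uhk_iff_piecewise by blast
  show ?thesis
    unfolding curl_x_eq[OF mesh P(1) piecewise_add[OF P(2,3)]] curl_x_eq[OF mesh P(1,2)] curl_x_eq[OF mesh P(1,3)]
    by (rule broken_int_add_right[of e k h h']) (auto intro: piecewiseD(1) P)
qed

lemma curl_y_add_left:
  assumes "E \<in> Uhk M k" "E' \<in> Uhk M k" "H \<in> Uhk M k"
  shows "curl_y M (\<lambda>z. E z + E' z) H = curl_y M E H + curl_y M E' H"
proof -
  obtain e e' h where P: "piecewise M k E e" "piecewise M k E' e'" "piecewise M k H h"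
    using assms unfolding Uhk_iff_piecewise by blast
  show ?thesis
    unfolding curl_y_eq[OF mesh piecewise_add[OF P(1,2)] P(3)] curl_y_eq[OF mesh P(1,3)] curl_y_eq[OF mesh P(2,3)]
    by (rule broken_int_add_left[of "transposed e" k "transposed e'" "transposed h"])
      (auto intro!: bipoly_swap piecewiseD(1)[OF P(1)] piecewiseD(1)[OF P(2)] piecewiseD(1)[OF P(3)])
qed

lemma curl_y_add_right:
  assumes "E \<in> Uhk M k" "H \<in> Uhk M k" "H' \<in> Uhk M k"
  shows "curl_y M E (\<lambda>z. H z + H' z) = curl_y M E H + curl_y M E H'"
proof -
  obtain e h h' where P: "piecewise M k E e" "piecewise M k H h" "piecewise M k H' h'"
    using assms unfolding Uhk_iff_piecewise by blast
  show ?thesis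
    unfolding curl_y_eq[OF mesh P(1) piecewise_add[OF P(2,3)]] curl_y_eq[OF mesh P(1,2)] curl_y_eq[OF mesh P(1,3)]
    by (rule broken_int_add_right[of "transposed e" k "transposed h" "transposed h'"])
      (auto intro!: bipoly_swap piecewiseD(1)[OF P(1)] piecewiseD(1)[OF P(2)] piecewiseD(1)[OF P(3)])
qed

lemma integral_penalty:
  fixes f :: "real \<Rightarrow> real"
  assumes "continuous_on UNIV f" "c \<ge> 0"
  shows "integral {a..b} (\<lambda>x. c * f x * f x) \<ge> 0"
  using assms by (intro Henstock_Kurzweil_Integration.integral_nonneg integrable_continuous_real
      continuous_intros) (auto intro: continuous_on_subset simp: mult.assoc)

text \<open>The forms are adjoint except on the lower boundary. There the flux exceeds the trace of
  \<open>H\<close> by \<open>c0 / 2\<close> times the test function itself, because the penalty in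
  the flux averages the same two time levels; the remainder is minus the integral of a
  square.\<close>

lemma flux_x_le:
  assumes c0: "c0 \<ge> 0" and pq: "p < q"
    and U: "H \<in> Uhk M k" "E1 \<in> Uhk M k" "E0 \<in> Uhk M k"
  shows "flux_x c0 M H E1 E0 (\<lambda>z. E1 z + E0 z) \<le> - curl_x M (\<lambda>z. E1 z + E0 z) H"
proof -
  obtain h e1 e0 where P: "piecewise M k H h" "piecewise M k E1 e1" "piecewise M k E0 e0"
    using U unfolding Uhk_iff_piecewise by blast
  define \<phi> where "\<phi> = (\<lambda>i j x y. e1 i j x y + e0 i j x y)"
  have \<Phi>: "piecewise M k (\<lambda>z. E1 z + E0 z) \<phi>" unfolding \<phi>_def by (rule piecewise_add[OF P(2,3)])
  \<comment> \<open>The boundary flux written with the cell polynomials; only for the test function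
    \<open>E1 + E0\<close> is its penalty a multiple of the test function.\<close>
  define g where "g = (\<lambda>i x. h i 1 x (ynode M 0) + c0 / 2 * \<phi> i 1 x (ynode M 0))"
  have g: "continuous_on UNIV (g i)" for i
    unfolding g_def by (intro continuous_intros continuous_on_piecewise(2)[OF mesh P(1)] continuous_on_piecewise(2)[OF mesh \<Phi>])
  have Ny: "Ny M \<ge> 1" using mesh pq unfolding is_mesh_def by (cases "Ny M") auto
  have "flux_x c0 M H E1 E0 (\<lambda>z. E1 z + E0 z) = (\<Sum>i=1..Nx M. \<Sum>j=1..Ny M.
      integral {xnode M (i - 1)..xnode M i} (\<lambda>x. h i j x (ynode M j) * \<phi> i j x (ynode M j)
        - (if j = 1 then g i x else h i (j - 1) x (ynode M (j - 1))) * \<phi> i j x (ynode M (j - 1)))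
      - integral {xnode M (i - 1)..xnode M i} (\<lambda>x. integral {ynode M (j - 1)..ynode M j} (\<lambda>y. h i j x y * deriv (\<phi> i j x) y)))"
    unfolding flux_x_def
  proof (intro sum.cong refl arg_cong2[of _ _ _ _ "(-)"])
    fix i j assume ij: "i \<in> {1..Nx M}" "j \<in> {1..Ny M}"
    show "(LINT z|lebesgue_on (Kcell M i j). H z * dy (\<lambda>z. E1 z + E0 z) z) =
      integral {xnode M (i - 1)..xnode M i} (\<lambda>x. integral {ynode M (j - 1)..ynode M j} (\<lambda>y. h i j x y * deriv (\<phi> i j x) y))"
      by (rule volume_term_y[OF mesh P(1) \<Phi> ij])
    let ?f = "\<lambda>x. h i j x (ynode M j) * \<phi> i j x (ynode M j)
        - (if j = 1 then g i x else h i (j - 1) x (ynode M (j - 1))) * \<phi> i j x (ynode M (j - 1))"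
    show "(LINT x|lebesgue_on (Icell M i). Hhat_x c0 M H E1 E0 x j * yminus (\<lambda>z. E1 z + E0 z) x (ynode M j)
        - Hhat_x c0 M H E1 E0 x (j - 1) * yplus (\<lambda>z. E1 z + E0 z) x (ynode M (j - 1)))
        = integral {xnode M (i - 1)..xnode M i} ?f"
      unfolding Icell_def
    proof (rule lebesgue_integral_open_interval)
      show "continuous_on UNIV ?f"
        by (intro continuous_intros continuous_on_if_const continuous_on_piecewise(2)[OF mesh P(1)]
            continuous_on_piecewise(2)[OF mesh \<Phi>] g)
      fix x assume "x \<in> {xnode M (i - 1)<..<xnode M i}"
      then have x: "x \<in> Icell M i" by (simp add: Icell_def)
      have j: "j - 1 < Ny M" "Suc (j - 1) = j" using ij by auto
      have 1: "Hhat_x c0 M H E1 E0 x j = h i j x (ynode M j)"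
        using yminus_piecewise[OF mesh P(1) ij(1) x ij(2)] ij by (simp add: Hhat_x_def)
      have 2: "Hhat_x c0 M H E1 E0 x (j - 1) = (if j = 1 then g i x else h i (j - 1) x (ynode M (j - 1)))"
      proof (cases "j = 1")
        case True
        then show ?thesis
          using yplus_piecewise[OF mesh P(1) ij(1) x, of 0] yplus_piecewise[OF mesh P(2) ij(1) x, of 0]
            yplus_piecewise[OF mesh P(3) ij(1) x, of 0] Ny
          by (simp add: Hhat_x_def g_def \<phi>_def)
      next
        case False
        then have "j - 1 \<in> {1..Ny M}" using ij by auto
        then show ?thesis
          using yminus_piecewise[OF mesh P(1) ij(1) x, of "j - 1"] False by (auto simp: Hhat_x_def)
      qed
      show "Hhat_x c0 M H E1 E0 x j * yminus (\<lambda>z. E1 z + E0 z) x (ynode M j)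
        - Hhat_x c0 M H E1 E0 x (j - 1) * yplus (\<lambda>z. E1 z + E0 z) x (ynode M (j - 1)) = ?f x"
        unfolding 1 2 yminus_piecewise[OF mesh \<Phi> ij(1) x ij(2)] yplus_piecewise[OF mesh \<Phi> ij(1) x j(1)] j(2) ..
    qed
  qed
  also have "\<dots> = - curl_x M (\<lambda>z. E1 z + E0 z) H
      + (\<Sum>i=1..Nx M. integral {xnode M (i - 1)..xnode M i} (\<lambda>x. (h i 1 x (ynode M 0) - g i x) * \<phi> i 1 x (ynode M 0)))"
    unfolding curl_x_eq[OF mesh \<Phi> P(1)]
    by (rule adjoint_broken_int[of \<phi> k h g])
      (use Ny is_mesh_ynode_less[OF mesh] in \<open>auto intro: piecewiseD(1)[OF \<Phi>] piecewiseD(1)[OF P(1)] g\<close>)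
  also have "\<dots> \<le> - curl_x M (\<lambda>z. E1 z + E0 z) H"
  proof -
    have "integral {a..b} (\<lambda>x. (h i 1 x (ynode M 0) - g i x) * \<phi> i 1 x (ynode M 0)) \<le> 0" for a b i
    proof -
      have "(\<lambda>x. (h i 1 x (ynode M 0) - g i x) * \<phi> i 1 x (ynode M 0))
          = (\<lambda>x. - (c0 / 2 * \<phi> i 1 x (ynode M 0) * \<phi> i 1 x (ynode M 0)))"
        by (simp add: g_def)
      then show ?thesis
        using integral_penalty[of "\<lambda>x. \<phi> i 1 x (ynode M 0)" "c0 / 2" a b] c0
          continuous_on_piecewise(2)[OF mesh \<Phi>] by (simp del: minus_mult_left add: integral_neg)
    qed
    then show ?thesis by (simp add: sum_nonpos)
  qed
  finally show ?thesis .
qed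

text \<open>The penalty has the opposite sign on vertical edges, and so has the flux term in the
  equation for the second electric component; this lower bound is therefore as dissipative as the
  upper bound in \<open>flux_x_le\<close>.\<close>

lemma flux_y_ge:
  assumes c0: "c0 \<ge> 0" and rs: "r < s"
    and U: "H \<in> Uhk M k" "E1 \<in> Uhk M k" "E0 \<in> Uhk M k"
  shows "flux_y c0 M H E1 E0 (\<lambda>z. E1 z + E0 z) \<ge> - curl_y M (\<lambda>z. E1 z + E0 z) H"
proof -
  obtain h e1 e0 where P: "piecewise M k H h" "piecewise M k E1 e1" "piecewise M k E0 e0"
    using U unfolding Uhk_iff_piecewise by blast
  define \<phi> where "\<phi> = (\<lambda>i j x y. e1 i j x y + e0 i j x y)"
  have \<Phi>: "piecewise M k (\<lambda>z. E1 z + E0 z) \<phi>" unfolding \<phi>_def by (rule piecewise_add[OF P(2,3)])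
  define g where "g = (\<lambda>j y. h 1 j (xnode M 0) y - c0 / 2 * \<phi> 1 j (xnode M 0) y)"
  have g: "continuous_on UNIV (g j)" for j
    unfolding g_def by (intro continuous_intros continuous_on_piecewise(1)[OF mesh P(1)] continuous_on_piecewise(1)[OF mesh \<Phi>])
  have Nx: "Nx M \<ge> 1" using mesh rs unfolding is_mesh_def by (cases "Nx M") auto
  have "flux_y c0 M H E1 E0 (\<lambda>z. E1 z + E0 z) = (\<Sum>j=1..Ny M. \<Sum>i=1..Nx M.
      integral {ynode M (j - 1)..ynode M j} (\<lambda>y. h i j (xnode M i) y * \<phi> i j (xnode M i) y
        - (if i = 1 then g j y else h (i - 1) j (xnode M (i - 1)) y) * \<phi> i j (xnode M (i - 1)) y)
      - integral {ynode M (j - 1)..ynode M j} (\<lambda>y. integral {xnode M (i - 1)..xnode M i} (\<lambda>x. h i j x y * deriv (\<lambda>x. \<phi> i j x y) x)))"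
    unfolding flux_y_def
  proof (subst sum.swap, intro sum.cong refl arg_cong2[of _ _ _ _ "(-)"])
    fix i j assume ji: "j \<in> {1..Ny M}" "i \<in> {1..Nx M}"
    show "(LINT z|lebesgue_on (Kcell M i j). H z * dx (\<lambda>z. E1 z + E0 z) z) =
      integral {ynode M (j - 1)..ynode M j} (\<lambda>y. integral {xnode M (i - 1)..xnode M i} (\<lambda>x. h i j x y * deriv (\<lambda>x. \<phi> i j x y) x))"
      by (rule volume_term_x[OF mesh P(1) \<Phi> ji(2,1)])
    let ?f = "\<lambda>y. h i j (xnode M i) y * \<phi> i j (xnode M i) y
        - (if i = 1 then g j y else h (i - 1) j (xnode M (i - 1)) y) * \<phi> i j (xnode M (i - 1)) y"
    show "(LINT y|lebesgue_on (Jcell M j). Hhat_y c0 M H E1 E0 i y * xminus (\<lambda>z. E1 z + E0 z) (xnode M i) y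
        - Hhat_y c0 M H E1 E0 (i - 1) y * xplus (\<lambda>z. E1 z + E0 z) (xnode M (i - 1)) y)
        = integral {ynode M (j - 1)..ynode M j} ?f"
      unfolding Jcell_def
    proof (rule lebesgue_integral_open_interval)
      show "continuous_on UNIV ?f"
        by (intro continuous_intros continuous_on_if_const continuous_on_piecewise(1)[OF mesh P(1)]
            continuous_on_piecewise(1)[OF mesh \<Phi>] g)
      fix y assume "y \<in> {ynode M (j - 1)<..<ynode M j}"
      then have y: "y \<in> Jcell M j" by (simp add: Jcell_def)
      have i: "i - 1 < Nx M" "Suc (i - 1) = i" using ji by auto
      have 1: "Hhat_y c0 M H E1 E0 i y = h i j (xnode M i) y"
        using xminus_piecewise[OF mesh P(1) ji(1) y ji(2)] ji by (simp add: Hhat_y_def)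
      have 2: "Hhat_y c0 M H E1 E0 (i - 1) y = (if i = 1 then g j y else h (i - 1) j (xnode M (i - 1)) y)"
      proof (cases "i = 1")
        case True
        then show ?thesis
          using xplus_piecewise[OF mesh P(1) ji(1) y, of 0] xplus_piecewise[OF mesh P(2) ji(1) y, of 0]
            xplus_piecewise[OF mesh P(3) ji(1) y, of 0] Nx
          by (simp add: Hhat_y_def g_def \<phi>_def)
      next
        case False
        then have "i - 1 \<in> {1..Nx M}" using ji by auto
        then show ?thesis
          using xminus_piecewise[OF mesh P(1) ji(1) y, of "i - 1"] False by (auto simp: Hhat_y_def)
      qed
      show "Hhat_y c0 M H E1 E0 i y * xminus (\<lambda>z. E1 z + E0 z) (xnode M i) y
        - Hhat_y c0 M H E1 E0 (i - 1) y * xplus (\<lambda>z. E1 z + E0 z) (xnode M (i - 1)) y = ?f y"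
        unfolding 1 2 xminus_piecewise[OF mesh \<Phi> ji(1) y ji(2)] xplus_piecewise[OF mesh \<Phi> ji(1) y i(1)] i(2) ..
    qed
  qed
  also have "\<dots> = - curl_y M (\<lambda>z. E1 z + E0 z) H
      + (\<Sum>j=1..Ny M. integral {ynode M (j - 1)..ynode M j} (\<lambda>y. (h 1 j (xnode M 0) y - g j y) * \<phi> 1 j (xnode M 0) y))"
    unfolding curl_y_eq[OF mesh \<Phi> P(1)]
    by (rule adjoint_broken_int[of "transposed \<phi>" k "transposed h" g])
      (use Nx is_mesh_xnode_less[OF mesh] in \<open>auto intro!: g bipoly_swap[OF piecewiseD(1)[OF \<Phi>]] bipoly_swap[OF piecewiseD(1)[OF P(1)]]\<close>)
  also have "\<dots> \<ge> - curl_y M (\<lambda>z. E1 z + E0 z) H"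
  proof -
    have "integral {a..b} (\<lambda>y. (h 1 j (xnode M 0) y - g j y) * \<phi> 1 j (xnode M 0) y) \<ge> 0" for a b j
    proof -
      have "(\<lambda>y. (h 1 j (xnode M 0) y - g j y) * \<phi> 1 j (xnode M 0) y)
          = (\<lambda>y. c0 / 2 * \<phi> 1 j (xnode M 0) y * \<phi> 1 j (xnode M 0) y)"
        by (simp add: g_def)
      then show ?thesis
        using integral_penalty[of "\<lambda>y. \<phi> 1 j (xnode M 0) y" "c0 / 2" a b] c0
          continuous_on_piecewise(1)[OF mesh \<Phi>] by simp
    qed
    then show ?thesis by (simp add: sum_nonneg)
  qed
  finally show ?thesis .
qed

end

text \<open>\<open>K\<close> depends on \<open>k\<close> alone and is chosen before the mesh. The
  two bounds use the two orders of integration, and each needs the lower bound on cell widths in its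
  own direction.\<close>

lemma curl_bound:
  "\<exists>K>0. \<forall>r s p q M E H l. is_mesh r s p q M \<longrightarrow> l > 0 \<longrightarrow>
     (\<forall>i\<in>{1..Nx M}. l \<le> hx M i) \<longrightarrow> (\<forall>j\<in>{1..Ny M}. l \<le> hy M j) \<longrightarrow> E \<in> Uhk M k \<longrightarrow> H \<in> Uhk M k \<longrightarrow>
     \<bar>curl_x M E H\<bar> \<le> K / l * cells M (\<lambda>z. (E z)\<^sup>2 + (H z)\<^sup>2) \<and>
     \<bar>curl_y M E H\<bar> \<le> K / l * cells M (\<lambda>z. (E z)\<^sup>2 + (H z)\<^sup>2)"
proof -
  obtain K where K: "K > 0" "\<And>m s n t e h l. l > 0 \<Longrightarrow> (\<forall>j\<in>{1..n}. l \<le> t j - t (j - 1)) \<Longrightarrow>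
     (\<forall>i j. e i j \<in> bipoly k \<and> h i j \<in> bipoly k) \<Longrightarrow>
     \<bar>broken_int m s n t e h\<bar> \<le> K / l * (\<Sum>i=1..m. \<Sum>j=1..n.
        integral {s (i - 1)..s i} (\<lambda>x. integral {t (j - 1)..t j} (\<lambda>y. (e i j x y)\<^sup>2 + (h i j x y)\<^sup>2)))"
    using broken_int_bound[of k] by blast
  show ?thesis
  proof (rule exI[of _ K], intro conjI K(1) allI impI)
    fix r s p q :: real and M :: mesh and E H :: "real \<times> real \<Rightarrow> real" and l :: real
    assume mesh: "is_mesh r s p q M" and l: "l > 0" and hx: "\<forall>i\<in>{1..Nx M}. l \<le> hx M i"
      and hy: "\<forall>j\<in>{1..Ny M}. l \<le> hy M j" and U: "E \<in> Uhk M k" "H \<in> Uhk M k"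
    obtain e h where P: "piecewise M k E e" "piecewise M k H h"
      using U unfolding Uhk_iff_piecewise by blast
    have c: "continuous_on UNIV (\<lambda>z. (e i j (fst z) (snd z))\<^sup>2 + (h i j (fst z) (snd z))\<^sup>2)" for i j
      by (intro continuous_intros continuous_on_bipoly[OF piecewiseD(1)[OF P(1)]] continuous_on_bipoly[OF piecewiseD(1)[OF P(2)]])
    have eq: "(E (x, y))\<^sup>2 + (H (x, y))\<^sup>2 = (e i j x y)\<^sup>2 + (h i j x y)\<^sup>2"
      if "i \<in> {1..Nx M}" "j \<in> {1..Ny M}" "x \<in> Icell M i" "y \<in> Jcell M j" for i j x y
      using piecewiseD(2)[OF P(1) that] piecewiseD(2)[OF P(2) that] by simp
    have "cells M (\<lambda>z. (E z)\<^sup>2 + (H z)\<^sup>2) = (\<Sum>i=1..Nx M. \<Sum>j=1..Ny M.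
      integral {xnode M (i - 1)..xnode M i} (\<lambda>x. integral {ynode M (j - 1)..ynode M j} (\<lambda>y. (e i j x y)\<^sup>2 + (h i j x y)\<^sup>2)))"
      unfolding cells_def Kcell_def Icell_def Jcell_def
      by (intro sum.cong refl lebesgue_integral_open_rectangle(1) c eq) (auto simp: Icell_def Jcell_def)
    then show "\<bar>curl_x M E H\<bar> \<le> K / l * cells M (\<lambda>z. (E z)\<^sup>2 + (H z)\<^sup>2)"
      unfolding curl_x_eq[OF mesh P] using K(2)[OF l, of "Ny M" "ynode M" e h] hy piecewiseD(1)[OF P(1)] piecewiseD(1)[OF P(2)]
      by (simp add: hy_def)
    have "cells M (\<lambda>z. (E z)\<^sup>2 + (H z)\<^sup>2) = (\<Sum>j=1..Ny M. \<Sum>i=1..Nx M.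
      integral {ynode M (j - 1)..ynode M j} (\<lambda>y. integral {xnode M (i - 1)..xnode M i} (\<lambda>x. (e i j x y)\<^sup>2 + (h i j x y)\<^sup>2)))"
      unfolding cells_def Kcell_def Icell_def Jcell_def
      by (subst sum.swap, intro sum.cong refl lebesgue_integral_open_rectangle(2) c eq) (auto simp: Icell_def Jcell_def)
    then show "\<bar>curl_y M E H\<bar> \<le> K / l * cells M (\<lambda>z. (E z)\<^sup>2 + (H z)\<^sup>2)"
      unfolding curl_y_eq[OF mesh P]
      using K(2)[OF l, of "Nx M" "xnode M" "transposed e" "transposed h"] hx
        bipoly_swap[OF piecewiseD(1)[OF P(1)]] bipoly_swap[OF piecewiseD(1)[OF P(2)]]
      by (simp add: hx_def)
  qed
qed

section \<open>Bounded functions and sums over cells\<close>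

lemma Linf_onI: "f \<in> borel_measurable (lebesgue_on K) \<Longrightarrow> (AE z in lebesgue_on K. \<bar>f z\<bar> \<le> C) \<Longrightarrow> Linf_on K f"
  unfolding Linf_on_def by blast

lemma Linf_onE:
  assumes "Linf_on K f"
  obtains C where "C \<ge> 0" "f \<in> borel_measurable (lebesgue_on K)" "AE z in lebesgue_on K. \<bar>f z\<bar> \<le> C"
proof -
  obtain C where C: "f \<in> borel_measurable (lebesgue_on K)" "AE z in lebesgue_on K. \<bar>f z\<bar> \<le> C"
    using assms unfolding Linf_on_def by blast
  have "AE z in lebesgue_on K. \<bar>f z\<bar> \<le> \<bar>C\<bar>" using C(2) by eventually_elim linarith
  with C(1) show ?thesis using that[of "\<bar>C\<bar>"] by simp
qed

lemma Linf_on_const: "Linf_on K (\<lambda>_. c)"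
  by (rule Linf_onI[of _ _ "\<bar>c\<bar>"]) auto

lemma Linf_on_add:
  assumes "Linf_on K f" "Linf_on K g"
  shows "Linf_on K (\<lambda>z. f z + g z)"
proof -
  obtain C where C: "f \<in> borel_measurable (lebesgue_on K)" "AE z in lebesgue_on K. \<bar>f z\<bar> \<le> C"
    using assms(1) by (rule Linf_onE)
  obtain D where D: "g \<in> borel_measurable (lebesgue_on K)" "AE z in lebesgue_on K. \<bar>g z\<bar> \<le> D"
    using assms(2) by (rule Linf_onE)
  have "AE z in lebesgue_on K. \<bar>f z + g z\<bar> \<le> C + D" using C(2) D(2) by eventually_elim linarith
  with C(1) D(1) show ?thesis by (intro Linf_onI borel_measurable_add)
qed

lemma Linf_on_mult:
  assumes "Linf_on K f" "Linf_on K g"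
  shows "Linf_on K (\<lambda>z. f z * g z)"
proof -
  obtain C where C: "C \<ge> 0" "f \<in> borel_measurable (lebesgue_on K)" "AE z in lebesgue_on K. \<bar>f z\<bar> \<le> C"
    using assms(1) by (rule Linf_onE)
  obtain D where D: "g \<in> borel_measurable (lebesgue_on K)" "AE z in lebesgue_on K. \<bar>g z\<bar> \<le> D"
    using assms(2) by (rule Linf_onE)
  have "AE z in lebesgue_on K. \<bar>f z * g z\<bar> \<le> C * D"
    using C(3) D(2) by eventually_elim (auto simp: abs_mult C(1) intro: mult_mono)
  with C(2) D(1) show ?thesis by (intro Linf_onI borel_measurable_times)
qed

lemma Linf_on_diff:
  assumes "Linf_on K f" "Linf_on K g"
  shows "Linf_on K (\<lambda>z. f z - g z)"
  using Linf_on_add[OF assms(1) Linf_on_mult[OF Linf_on_const[of K "-1"] assms(2)]] by simp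

lemma Linf_on_power: "Linf_on K f \<Longrightarrow> Linf_on K (\<lambda>z. f z ^ n)"
  by (induction n) (auto intro: Linf_on_const Linf_on_mult)

lemma Linf_on_divide_const: "Linf_on K f \<Longrightarrow> Linf_on K (\<lambda>z. f z / c)"
  using Linf_on_mult[OF _ Linf_on_const[of K "inverse c"]] by (simp add: divide_inverse)

lemmas Linf_on_intros = Linf_on_const Linf_on_add Linf_on_mult Linf_on_diff Linf_on_power Linf_on_divide_const

text \<open>Intended for the weight of the current norm, where \<open>m\<close> is
  \<open>\<epsilon>0\<close>.\<close>

lemma Linf_on_inverse:
  assumes "Linf_on K f" "m > 0" "\<And>z. z \<in> K \<Longrightarrow> m \<le> f z"
  shows "Linf_on K (\<lambda>z. inverse (f z))"
proof (rule Linf_onI)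
  show "(\<lambda>z. inverse (f z)) \<in> borel_measurable (lebesgue_on K)"
    using assms(1) by (intro borel_measurable_inverse) (simp add: Linf_on_def)
  have "\<bar>inverse (f z)\<bar> \<le> inverse m" if "z \<in> K" for z
    using assms(3)[OF that] assms(2) le_imp_inverse_le[of m "f z"] by simp
  then show "AE z in lebesgue_on K. \<bar>inverse (f z)\<bar> \<le> inverse m"
    by (intro AE_I2) simp
qed

lemma AE_lebesgue_on_subset:
  assumes "AE z in lebesgue_on S. P z" "K \<subseteq> S" "K \<in> sets lebesgue" "S \<in> sets lebesgue"
  shows "AE z in lebesgue_on K. P z"
  using assms by (auto simp: AE_restrict_space_iff elim: AE_mp)

lemma Linf_on_subset:
  assumes "Linf_on S f" "K \<subseteq> S" "K \<in> sets lebesgue" "S \<in> sets lebesgue"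
  shows "Linf_on K f"
proof -
  obtain C where C: "f \<in> borel_measurable (lebesgue_on S)" "AE z in lebesgue_on S. \<bar>f z\<bar> \<le> C"
    using assms(1) by (rule Linf_onE)
  show ?thesis
    by (rule Linf_onI[OF measurable_restrict_mono[OF C(1) assms(2)] AE_lebesgue_on_subset[OF C(2) assms(2-4)]])
qed

lemma Linf_on_integrable: "Linf_on K f \<Longrightarrow> K \<in> lmeasurable \<Longrightarrow> integrable (lebesgue_on K) f"
  by (erule Linf_onE) (auto intro!: finite_measure.integrable_const_bound finite_measure_lebesgue_on)

lemma Kcell_lmeasurable [simp]: "Kcell M i j \<in> lmeasurable"
  unfolding Kcell_def Icell_def Jcell_def open_rectangle_eq_box by simp

lemma Kcell_sets [simp]: "Kcell M i j \<in> sets lebesgue"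
  using Kcell_lmeasurable fmeasurableD by blast

text \<open>An algebra containing both the coefficients and the discrete fields, whose members are
  integrable on each cell. Integrability of the quartic Kerr terms thus reduces to closure under
  products.\<close>

definition Linf_cells :: "mesh \<Rightarrow> (real \<times> real \<Rightarrow> real) \<Rightarrow> bool" where
  "Linf_cells M f \<longleftrightarrow> (\<forall>i\<in>{1..Nx M}. \<forall>j\<in>{1..Ny M}. Linf_on (Kcell M i j) f)"

lemma Linf_cells_intros:
  "Linf_cells M (\<lambda>_. c)"
  "Linf_cells M f \<Longrightarrow> Linf_cells M g \<Longrightarrow> Linf_cells M (\<lambda>z. f z + g z)"
  "Linf_cells M f \<Longrightarrow> Linf_cells M g \<Longrightarrow> Linf_cells M (\<lambda>z. f z * g z)"
  "Linf_cells M f \<Longrightarrow> Linf_cells M g \<Longrightarrow> Linf_cells M (\<lambda>z. f z - g z)"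
  "Linf_cells M f \<Longrightarrow> Linf_cells M (\<lambda>z. f z ^ n)"
  "Linf_cells M f \<Longrightarrow> Linf_cells M (\<lambda>z. f z / c)"
  unfolding Linf_cells_def by (blast intro: Linf_on_intros)+

lemma Linf_cells_integrable:
  "Linf_cells M f \<Longrightarrow> i \<in> {1..Nx M} \<Longrightarrow> j \<in> {1..Ny M} \<Longrightarrow> integrable (lebesgue_on (Kcell M i j)) f"
  unfolding Linf_cells_def by (blast intro: Linf_on_integrable Kcell_lmeasurable)

text \<open>On a cell the function agrees with a polynomial, which is bounded on the compact
  closure.\<close>

lemma Linf_cells_Uhk:
  assumes "U \<in> Uhk M k"
  shows "Linf_cells M U"
  unfolding Linf_cells_def
proof (intro ballI)
  fix i j assume ij: "i \<in> {1..Nx M}" "j \<in> {1..Ny M}"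
  obtain f where f: "piecewise M k U f" using assms unfolding Uhk_iff_piecewise by blast
  let ?f = "\<lambda>z. f i j (fst z) (snd z)"
  let ?C = "cbox (xnode M (i - 1), ynode M (j - 1)) (xnode M i, ynode M j)"
  have cont: "continuous_on S ?f" for S
    by (intro continuous_intros continuous_on_bipoly[OF piecewiseD(1)[OF f]])
  have sub: "Kcell M i j \<subseteq> ?C" by (auto simp: Kcell_def Icell_def Jcell_def)
  have eq: "U z = ?f z" if "z \<in> Kcell M i j" for z
    using piecewiseD(2)[OF f ij, of "fst z" "snd z"] that by (auto simp: Kcell_def mem_Times_iff)
  have "compact (?f ` ?C)" by (rule compact_continuous_image[OF cont compact_cbox])
  then obtain B where B: "\<And>z. z \<in> ?C \<Longrightarrow> \<bar>?f z\<bar> \<le> B"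
    using compact_imp_bounded[of "?f ` ?C"] unfolding bounded_iff by auto
  show "Linf_on (Kcell M i j) U"
  proof (rule Linf_onI)
    have "?f \<in> borel_measurable (lebesgue_on (Kcell M i j))"
      by (rule continuous_imp_measurable_on_sets_lebesgue[OF cont Kcell_sets])
    then show "U \<in> borel_measurable (lebesgue_on (Kcell M i j))"
      by (rule measurable_cong[THEN iffD1, rotated]) (simp add: eq)
    show "AE z in lebesgue_on (Kcell M i j). \<bar>U z\<bar> \<le> B"
      using eq B sub by (intro AE_I2) auto
  qed
qed

lemma cells_add: "Linf_cells M f \<Longrightarrow> Linf_cells M g \<Longrightarrow> cells M (\<lambda>z. f z + g z) = cells M f + cells M g"
  unfolding cells_def sum.distrib[symmetric]
  by (intro sum.cong refl Bochner_Integration.integral_add Linf_cells_integrable)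

lemma cells_diff: "Linf_cells M f \<Longrightarrow> Linf_cells M g \<Longrightarrow> cells M (\<lambda>z. f z - g z) = cells M f - cells M g"
  unfolding cells_def sum_subtractf[symmetric]
  by (intro sum.cong refl Bochner_Integration.integral_diff Linf_cells_integrable)

lemma cells_cmult: "cells M (\<lambda>z. c * f z) = c * cells M f"
  unfolding cells_def by (simp add: sum_distrib_left)

text \<open>The almost-everywhere form is required because the lower bound on \<open>\<mu>0\<close>
  holds only almost everywhere.\<close>

lemma cells_mono_AE:
  assumes "Linf_cells M f" "Linf_cells M g"
    "\<And>i j. i \<in> {1..Nx M} \<Longrightarrow> j \<in> {1..Ny M} \<Longrightarrow> AE z in lebesgue_on (Kcell M i j). f z \<le> g z"
  shows "cells M f \<le> cells M g"
  unfolding cells_def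
  by (intro sum_mono integral_mono_AE Linf_cells_integrable assms)

lemma cells_mono:
  assumes "Linf_cells M f" "Linf_cells M g"
    "\<And>i j z. i \<in> {1..Nx M} \<Longrightarrow> j \<in> {1..Ny M} \<Longrightarrow> z \<in> Kcell M i j \<Longrightarrow> f z \<le> g z"
  shows "cells M f \<le> cells M g"
  by (rule cells_mono_AE[OF assms(1,2)]) (auto intro!: AE_I2 assms(3))

lemma cells_cong:
  assumes "\<And>i j z. i \<in> {1..Nx M} \<Longrightarrow> j \<in> {1..Ny M} \<Longrightarrow> z \<in> Kcell M i j \<Longrightarrow> f z = g z"
  shows "cells M f = cells M g"
  unfolding cells_def by (intro sum.cong refl Bochner_Integration.integral_cong) (auto intro: assms)

section \<open>The cells tile the domain up to a null set\<close>

lemma nodes_mono: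
  fixes t :: "nat \<Rightarrow> real"
  assumes "\<forall>i<n. t i < t (Suc i)" "i \<le> j" "j \<le> n"
  shows "t i \<le> t j"
  using assms(2,3)
proof (induction rule: dec_induct)
  case (step m)
  then have "t m < t (Suc m)" using assms(1) by simp
  with step show ?case by simp
qed simp

lemma nodes_interval_unique:
  fixes t :: "nat \<Rightarrow> real"
  assumes t: "\<forall>i<n. t i < t (Suc i)" and ij: "i \<in> {1..n}" "j \<in> {1..n}"
    and x: "x \<in> {t (i - 1)<..<t i}" "x \<in> {t (j - 1)<..<t j}"
  shows "i = j"
proof (rule ccontr)
  assume "i \<noteq> j"
  then have "i \<le> j - 1 \<or> j \<le> i - 1" using ij by auto
  then have "t i \<le> t (j - 1) \<or> t j \<le> t (i - 1)" using ij nodes_mono[OF t] by auto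
  then show False using x by auto
qed

lemma nodes_interval_exists:
  fixes t :: "nat \<Rightarrow> real"
  assumes "t 0 < x" "x < t n" "x \<notin> t ` {..n}"
  shows "\<exists>i\<in>{1..n}. x \<in> {t (i - 1)<..<t i}"
proof -
  \<comment> \<open>The first node to the right of \<open>x\<close>; its predecessor is not to the
    right, and equality is excluded by assumption.\<close>
  define i where "i = (LEAST i. x < t i)"
  have i: "x < t i" unfolding i_def by (rule LeastI[of _ n]) (rule assms)
  have "i \<le> n" unfolding i_def by (rule Least_le) (rule assms)
  have "i \<noteq> 0" using i assms(1) by (intro notI) simp
  then have "\<not> x < t (i - 1)" unfolding i_def by (intro not_less_Least) simp
  moreover have "x \<noteq> t (i - 1)" using assms(3) \<open>i \<le> n\<close> by auto
  ultimately show ?thesis using i \<open>i \<le> n\<close> \<open>i \<noteq> 0\<close> by (intro bexI[of _ i]) auto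
qed

context
  fixes r s p q :: real and M :: mesh
  assumes mesh: "is_mesh r s p q M"
begin

lemma Kcell_subset:
  assumes "i \<in> {1..Nx M}" "j \<in> {1..Ny M}"
  shows "Kcell M i j \<subseteq> {r<..<s} \<times> {p<..<q}"
proof -
  have "xnode M 0 \<le> xnode M (i - 1)" "xnode M i \<le> xnode M (Nx M)"
    "ynode M 0 \<le> ynode M (j - 1)" "ynode M j \<le> ynode M (Ny M)"
    using mesh assms unfolding is_mesh_def by (auto intro!: nodes_mono[of "Nx M" "xnode M"] nodes_mono[of "Ny M" "ynode M"])
  then show ?thesis
    using mesh unfolding is_mesh_def Kcell_def Icell_def Jcell_def by auto
qed

text \<open>The cells are pairwise disjoint, and what they leave uncovered lies on finitely many
  grid lines, which are negligible whatever values \<open>F\<close> takes there.\<close>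

lemma lebesgue_integral_cells:
  assumes F: "Linf_cells M F"
  shows "(LINT z|lebesgue_on ({r<..<s} \<times> {p<..<q}). F z) = cells M F"
proof -
  let ?I = "{1..Nx M} \<times> {1..Ny M}" and ?A = "\<lambda>(i, j). Kcell M i j" and ?S = "{r<..<s} \<times> {p<..<q}"
  let ?U = "\<Union>ij\<in>?I. ?A ij"
  have S: "?S \<in> sets lebesgue" unfolding open_rectangle_eq_box by simp
  have A: "?A ij \<in> sets lebesgue" for ij by (simp add: split_beta)
  have U: "?U \<in> sets lebesgue" by (intro sets.finite_UN A) auto
  have F_int: "set_integrable lebesgue (?A ij) F" if "ij \<in> ?I" for ij
    using Linf_cells_integrable[OF F, of "fst ij" "snd ij"] that
      integrable_restrict_space[of "Kcell M (fst ij) (snd ij)" lebesgue F]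
    unfolding set_integrable_def by (auto simp: split_beta)
  have int_U: "F absolutely_integrable_on ?U"
    by (rule set_integrable_UN) (use F_int A in auto)
  have US: "?U \<subseteq> ?S"
  proof (rule UN_least)
    fix ij assume "ij \<in> ?I"
    then show "?A ij \<subseteq> ?S" using Kcell_subset[of "fst ij" "snd ij"] by (simp add: split_beta mem_Times_iff)
  qed
  have neg: "negligible (?S - ?U)"
  proof (rule negligible_subset)
    show "negligible ((\<Union>i\<in>{..Nx M}. {z::real\<times>real. z \<bullet> (1, 0) = xnode M i}) \<union> (\<Union>j\<in>{..Ny M}. {z. z \<bullet> (0, 1) = ynode M j}))"
      by (intro negligible_Un negligible_Union)
        (auto intro!: negligible_standard_hyperplane simp: Basis_prod_def)
    show "?S - ?U \<subseteq> (\<Union>i\<in>{..Nx M}. {z::real\<times>real. z \<bullet> (1, 0) = xnode M i}) \<union> (\<Union>j\<in>{..Ny M}. {z. z \<bullet> (0, 1) = ynode M j})"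
    proof
      fix z assume z: "z \<in> ?S - ?U"
      obtain x y where xy: "z = (x, y)" by (cases z)
      have "x \<in> xnode M ` {..Nx M} \<or> y \<in> ynode M ` {..Ny M}"
      proof (rule ccontr)
        assume "\<not> (x \<in> xnode M ` {..Nx M} \<or> y \<in> ynode M ` {..Ny M})"
        then obtain i j where "i \<in> {1..Nx M}" "x \<in> Icell M i" "j \<in> {1..Ny M}" "y \<in> Jcell M j"
          using nodes_interval_exists[of "xnode M" x "Nx M"] nodes_interval_exists[of "ynode M" y "Ny M"] z xy mesh
          unfolding is_mesh_def Icell_def Jcell_def by auto
        then have "z \<in> ?U" unfolding xy Kcell_def by auto
        with z show False by simp
      qed
      then show "z \<in> (\<Union>i\<in>{..Nx M}. {z::real\<times>real. z \<bullet> (1, 0) = xnode M i}) \<union> (\<Union>j\<in>{..Ny M}. {z. z \<bullet> (0, 1) = ynode M j})"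
        unfolding xy by auto
    qed
  qed
  have neg': "negligible {z \<in> ?S - ?U. F z \<noteq> 0}" "negligible {z \<in> ?U - ?S. F z \<noteq> 0}"
  proof -
    show "negligible {z \<in> ?S - ?U. F z \<noteq> 0}" by (rule negligible_subset[OF neg]) blast
    have "{z \<in> ?U - ?S. F z \<noteq> 0} = {}" using US by blast
    then show "negligible {z \<in> ?U - ?S. F z \<noteq> 0}" by (simp only: negligible_empty)
  qed
  \<comment> \<open>Integrability over the domain is not assumed: it is inherited from the finite
    union of cells, which differs from the domain by a null set.\<close>
  have int_S: "F absolutely_integrable_on ?S"
    using absolutely_integrable_spike_set_eq[OF neg'] int_U by simp
  have "(LINT z|lebesgue_on ?S. F z) = integral ?S F"
    by (intro lebesgue_integral_eq_integral absolutely_integrable_imp_integrable int_S S)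
  also have "\<dots> = integral ?U F"
    by (rule integral_spike_set[OF neg'])
  also have "\<dots> = (LINT z:?U|lebesgue. F z)"
    using int_U by (rule set_lebesgue_integral_eq_integral(2)[symmetric])
  also have "\<dots> = (\<Sum>ij\<in>?I. LINT z:?A ij|lebesgue. F z)"
  proof (rule set_integral_finite_UN_AE)
    fix a b assume "a \<in> ?I" "b \<in> ?I"
    then show "AE z in lebesgue. z \<in> ?A a \<and> z \<in> ?A b \<longrightarrow> a = b"
      using mesh nodes_interval_unique[of "Nx M" "xnode M" "fst a" "fst b"] nodes_interval_unique[of "Ny M" "ynode M" "snd a" "snd b"]
      unfolding is_mesh_def by (intro AE_I2) (auto simp: Kcell_def Icell_def Jcell_def split_beta prod_eq_iff)
  qed (use A F_int in auto)
  also have "\<dots> = (\<Sum>ij\<in>?I. LINT z|lebesgue_on (?A ij). F z)"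
    unfolding set_lebesgue_integral_def using A by (intro sum.cong refl integral_restrict_space[symmetric]) auto
  also have "\<dots> = cells M F" unfolding cells_def by (simp add: sum.cartesian_product split_beta)
  finally show ?thesis .
qed

end

section \<open>Energy balance of one time step\<close>

text \<open>A discrete chain rule. For smooth fields the time derivative of \<open>|E|^2 E\<close>,
  tested with \<open>2 E\<close>, is \<open>3 / 2\<close> times the derivative of
  \<open>|E|^4\<close>; the averages in \<open>kerr\<close> make this exact for finite
  differences.\<close>

lemma kerr_identity:
  "kerr x1 x0 y1 y0 * (x1 + x0) + kerr y1 y0 x1 x0 * (y1 + y0)
     = 3 / 2 * ((x1\<^sup>2 + y1\<^sup>2)\<^sup>2 - (x0\<^sup>2 + y0\<^sup>2)\<^sup>2)"
  unfolding kerr_def by (simp add: field_simps power2_eq_square)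

lemma D_relation_cells:
  assumes "D_relation M k \<epsilon>0 \<chi>1 \<chi>3 D1 D0 A1 A0 B1 B0" "\<Phi> \<in> Uhk M k"
  shows "cells M (\<lambda>z. (D1 z - D0 z) * \<Phi> z) = cells M (\<lambda>z. \<epsilon>0 * (1 + \<chi>1 z) * (A1 z - A0 z) * \<Phi> z)
    + cells M (\<lambda>z. \<epsilon>0 * \<chi>3 z * kerr (A1 z) (A0 z) (B1 z) (B0 z) * \<Phi> z)"
  using assms unfolding cells_def sum.distrib[symmetric] D_relation_def by (intro sum.cong refl) blast

lemma Ex_equation_cells:
  assumes "Ex_equation c0 M k \<Delta>t D1 D0 E1 E0 H J" "\<Phi> \<in> Uhk M k"
  shows "cells M (\<lambda>z. (D1 z - D0 z) * \<Phi> z) / \<Delta>t = flux_x c0 M H E1 E0 \<Phi> + cells M (\<lambda>z. J z * \<Phi> z)"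
  unfolding cells_def flux_x_def sum.distrib[symmetric] sum_divide_distrib
proof (intro sum.cong refl)
  fix i j assume ij: "i \<in> {1..Nx M}" "j \<in> {1..Ny M}"
  \<comment> \<open>Nothing is known about the measurability of \<open>D1\<close> and
    \<open>D0\<close>; scaling by a constant commutes with the Bochner integral even when it takes
    its default value 0.\<close>
  have "(LINT z|lebesgue_on (Kcell M i j). (D1 z - D0 z) / \<Delta>t * \<Phi> z)
      = (LINT z|lebesgue_on (Kcell M i j). (D1 z - D0 z) * \<Phi> z) / \<Delta>t"
    by (simp add: Bochner_Integration.integral_divide_zero[symmetric] del: Bochner_Integration.integral_divide_zero)
  then show "(LINT z|lebesgue_on (Kcell M i j). (D1 z - D0 z) * \<Phi> z) / \<Delta>t =
      (LINT x|lebesgue_on (Icell M i). Hhat_x c0 M H E1 E0 x j * yminus \<Phi> x (ynode M j)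
        - Hhat_x c0 M H E1 E0 x (j - 1) * yplus \<Phi> x (ynode M (j - 1)))
     - (LINT z|lebesgue_on (Kcell M i j). H z * dy \<Phi> z) + (LINT z|lebesgue_on (Kcell M i j). J z * \<Phi> z)"
    using assms(1)[unfolded Ex_equation_def, rule_format, OF ij assms(2)] by linarith
qed

lemma Ey_equation_cells:
  assumes "Ey_equation c0 M k \<Delta>t D1 D0 E1 E0 H J" "\<Phi> \<in> Uhk M k"
  shows "cells M (\<lambda>z. (D1 z - D0 z) * \<Phi> z) / \<Delta>t = cells M (\<lambda>z. J z * \<Phi> z) - flux_y c0 M H E1 E0 \<Phi>"
  unfolding cells_def flux_y_def sum_subtractf[symmetric] sum_divide_distrib
proof (intro sum.cong refl)
  fix i j assume ij: "i \<in> {1..Nx M}" "j \<in> {1..Ny M}"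
  have "(LINT z|lebesgue_on (Kcell M i j). (D1 z - D0 z) / \<Delta>t * \<Phi> z)
      = (LINT z|lebesgue_on (Kcell M i j). (D1 z - D0 z) * \<Phi> z) / \<Delta>t"
    by (simp add: Bochner_Integration.integral_divide_zero[symmetric] del: Bochner_Integration.integral_divide_zero)
  then show "(LINT z|lebesgue_on (Kcell M i j). (D1 z - D0 z) * \<Phi> z) / \<Delta>t =
      (LINT z|lebesgue_on (Kcell M i j). J z * \<Phi> z) - ((LINT y|lebesgue_on (Jcell M j). Hhat_y c0 M H E1 E0 i y * xminus \<Phi> (xnode M i) y
        - Hhat_y c0 M H E1 E0 (i - 1) y * xplus \<Phi> (xnode M (i - 1)) y)
     - (LINT z|lebesgue_on (Kcell M i j). H z * dx \<Phi> z))"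
    using assms(1)[unfolded Ey_equation_def, rule_format, OF ij assms(2)] by linarith
qed

lemma Hz_equation_cells:
  assumes "Hz_equation M k \<Delta>t \<mu>0 H1 H0 Ax Ay" "\<Phi> \<in> Uhk M k"
  shows "cells M (\<lambda>z. \<mu>0 z * (H1 z - H0 z) * \<Phi> z) / \<Delta>t = curl_x M Ax \<Phi> - curl_y M Ay \<Phi>"
  unfolding cells_def curl_x_def curl_y_def sum_subtractf[symmetric] sum_divide_distrib
proof (intro sum.cong refl)
  fix i j assume ij: "i \<in> {1..Nx M}" "j \<in> {1..Ny M}"
  have "(LINT z|lebesgue_on (Kcell M i j). \<mu>0 z * ((H1 z - H0 z) / \<Delta>t) * \<Phi> z)
      = (LINT z|lebesgue_on (Kcell M i j). \<mu>0 z * (H1 z - H0 z) * \<Phi> z) / \<Delta>t"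
    by (simp add: Bochner_Integration.integral_divide_zero[symmetric] del: Bochner_Integration.integral_divide_zero)
  then show "(LINT z|lebesgue_on (Kcell M i j). \<mu>0 z * (H1 z - H0 z) * \<Phi> z) / \<Delta>t =
      (LINT x|lebesgue_on (Icell M i). Ehat_x M Ax x j * yminus \<Phi> x (ynode M j)
        - Ehat_x M Ax x (j - 1) * yplus \<Phi> x (ynode M (j - 1)))
     - (LINT z|lebesgue_on (Kcell M i j). Ax z * dy \<Phi> z)
     - ((LINT y|lebesgue_on (Jcell M j). Ehat_y M Ay i y * xminus \<Phi> (xnode M i) y
        - Ehat_y M Ay (i - 1) y * xplus \<Phi> (xnode M (i - 1)) y)
     - (LINT z|lebesgue_on (Kcell M i j). Ay z * dx \<Phi> z))"
    using assms(1)[unfolded Hz_equation_def, rule_format, OF ij assms(2)] by linarith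
qed

text \<open>The form \<open>B\<close> of the overview: the weak scalar curl of the electric field,
  x-derivative of \<open>Ay\<close> minus y-derivative of \<open>Ax\<close>, tested with
  \<open>H\<close>.\<close>

definition curl_form :: "mesh \<Rightarrow> (real \<times> real \<Rightarrow> real) \<Rightarrow> (real \<times> real \<Rightarrow> real) \<Rightarrow> (real \<times> real \<Rightarrow> real) \<Rightarrow> real" where
  "curl_form M Ax Ay H = curl_y M Ay H - curl_x M Ax H"

definition field_energy :: "mesh \<Rightarrow> real \<Rightarrow> (real \<times> real \<Rightarrow> real) \<Rightarrow> (real \<times> real \<Rightarrow> real) \<Rightarrow> (real \<times> real \<Rightarrow> real) \<Rightarrow> real" where
  "field_energy M \<epsilon>0 \<chi>1 Ax Ay = cells M (\<lambda>z. \<epsilon>0 * (1 + \<chi>1 z) * ((Ax z)\<^sup>2 + (Ay z)\<^sup>2))"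

definition kerr_energy :: "mesh \<Rightarrow> real \<Rightarrow> (real \<times> real \<Rightarrow> real) \<Rightarrow> (real \<times> real \<Rightarrow> real) \<Rightarrow> (real \<times> real \<Rightarrow> real) \<Rightarrow> real" where
  "kerr_energy M \<epsilon>0 \<chi>3 Ax Ay = cells M (\<lambda>z. \<epsilon>0 * \<chi>3 z * ((Ax z)\<^sup>2 + (Ay z)\<^sup>2)\<^sup>2)"

definition magnetic_energy :: "mesh \<Rightarrow> (real \<times> real \<Rightarrow> real) \<Rightarrow> (real \<times> real \<Rightarrow> real) \<Rightarrow> real" where
  "magnetic_energy M \<mu>0 H = cells M (\<lambda>z. \<mu>0 z * (H z)\<^sup>2)"

text \<open>
  The curl terms telescope because the magnetic field at \<open>n + 1/2\<close> meets $E^{n+1}+E^n$ while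
  $E^{n+1}$ meets $H^{n+3/2}+H^{n+1/2}$: the mixed product $B(E^{n+1},H^{n+1/2})$ cancels.
\<close>

lemma energy_step:
  assumes mesh: "is_mesh r s p q M" and rs: "r < s" and pq: "p < q" and c0: "c0 > 0" and dt: "\<Delta>t > 0"
    and L: "Linf_cells M \<chi>1" "Linf_cells M \<chi>3" "Linf_cells M \<mu>0"
    and U: "Ax1 \<in> Uhk M k" "Ax0 \<in> Uhk M k" "Ay1 \<in> Uhk M k" "Ay0 \<in> Uhk M k" "H1 \<in> Uhk M k" "H0 \<in> Uhk M k"
    and J: "Jx \<in> Uhk M k" "Jy \<in> Uhk M k"
    and Dx: "D_relation M k \<epsilon>0 \<chi>1 \<chi>3 Dx1 Dx0 Ax1 Ax0 Ay1 Ay0"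
    and Dy: "D_relation M k \<epsilon>0 \<chi>1 \<chi>3 Dy1 Dy0 Ay1 Ay0 Ax1 Ax0"
    and Exq: "Ex_equation c0 M k \<Delta>t Dx1 Dx0 Ax1 Ax0 H0 Jx"
    and Eyq: "Ey_equation c0 M k \<Delta>t Dy1 Dy0 Ay1 Ay0 H0 Jy"
    and Hzq: "Hz_equation M k \<Delta>t \<mu>0 H1 H0 Ax1 Ay1"
  shows "field_energy M \<epsilon>0 \<chi>1 Ax1 Ay1 + 3 / 2 * kerr_energy M \<epsilon>0 \<chi>3 Ax1 Ay1 + magnetic_energy M \<mu>0 H1
      + \<Delta>t * curl_form M Ax1 Ay1 H1
    \<le> field_energy M \<epsilon>0 \<chi>1 Ax0 Ay0 + 3 / 2 * kerr_energy M \<epsilon>0 \<chi>3 Ax0 Ay0 + magnetic_energy M \<mu>0 H0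
      + \<Delta>t * curl_form M Ax0 Ay0 H0
      + \<Delta>t * cells M (\<lambda>z. Jx z * (Ax1 z + Ax0 z) + Jy z * (Ay1 z + Ay0 z))"
proof -
  note bd = Linf_cells_intros L U[THEN Linf_cells_Uhk] J[THEN Linf_cells_Uhk]
  have kerr_bd: "Linf_cells M (\<lambda>z. kerr (A1 z) (A0 z) (B1 z) (B0 z))"
    if "Linf_cells M A1" "Linf_cells M A0" "Linf_cells M B1" "Linf_cells M B0" for A1 A0 B1 B0
    unfolding kerr_def by (intro Linf_cells_intros that)
  let ?\<Phi>x = "\<lambda>z. Ax1 z + Ax0 z" and ?\<Phi>y = "\<lambda>z. Ay1 z + Ay0 z" and ?\<Psi> = "\<lambda>z. H1 z + H0 z"
  have \<Phi>: "?\<Phi>x \<in> Uhk M k" "?\<Phi>y \<in> Uhk M k" "?\<Psi> \<in> Uhk M k" using U by (auto intro: Uhk_add)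
  \<comment> \<open>The boundary penalties are discarded here and in \<open>Y\<close>; these are the
    only losses in the step.\<close>
  have X: "cells M (\<lambda>z. (Dx1 z - Dx0 z) * ?\<Phi>x z) \<le> \<Delta>t * (cells M (\<lambda>z. Jx z * ?\<Phi>x z) - curl_x M ?\<Phi>x H0)"
    using Ex_equation_cells[OF Exq \<Phi>(1)] flux_x_le[OF mesh less_imp_le[OF c0] pq U(6,1,2)] dt
    by (simp add: divide_eq_eq mult.commute)
  have Y: "cells M (\<lambda>z. (Dy1 z - Dy0 z) * ?\<Phi>y z) \<le> \<Delta>t * (cells M (\<lambda>z. Jy z * ?\<Phi>y z) + curl_y M ?\<Phi>y H0)"
    using Ey_equation_cells[OF Eyq \<Phi>(2)] flux_y_ge[OF mesh less_imp_le[OF c0] rs U(6,3,4)] dt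
    by (simp add: divide_eq_eq mult.commute)
  have Z: "cells M (\<lambda>z. \<mu>0 z * (H1 z - H0 z) * ?\<Psi> z) = \<Delta>t * (curl_x M Ax1 ?\<Psi> - curl_y M Ay1 ?\<Psi>)"
    using Hz_equation_cells[OF Hzq \<Phi>(3)] dt by (simp add: divide_eq_eq mult.commute)
  have "cells M (\<lambda>z. (Dx1 z - Dx0 z) * ?\<Phi>x z) + cells M (\<lambda>z. (Dy1 z - Dy0 z) * ?\<Phi>y z)
     = cells M (\<lambda>z. (\<epsilon>0 * (1 + \<chi>1 z) * (Ax1 z - Ax0 z) * ?\<Phi>x z + \<epsilon>0 * \<chi>3 z * kerr (Ax1 z) (Ax0 z) (Ay1 z) (Ay0 z) * ?\<Phi>x z)
       + (\<epsilon>0 * (1 + \<chi>1 z) * (Ay1 z - Ay0 z) * ?\<Phi>y z + \<epsilon>0 * \<chi>3 z * kerr (Ay1 z) (Ay0 z) (Ax1 z) (Ax0 z) * ?\<Phi>y z))"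
    unfolding D_relation_cells[OF Dx \<Phi>(1)] D_relation_cells[OF Dy \<Phi>(2)]
    by (simp only: cells_add bd kerr_bd)
  also have "\<dots> = cells M (\<lambda>z. (\<epsilon>0 * (1 + \<chi>1 z) * ((Ax1 z)\<^sup>2 + (Ay1 z)\<^sup>2) - \<epsilon>0 * (1 + \<chi>1 z) * ((Ax0 z)\<^sup>2 + (Ay0 z)\<^sup>2))
      + 3 / 2 * (\<epsilon>0 * \<chi>3 z * ((Ax1 z)\<^sup>2 + (Ay1 z)\<^sup>2)\<^sup>2 - \<epsilon>0 * \<chi>3 z * ((Ax0 z)\<^sup>2 + (Ay0 z)\<^sup>2)\<^sup>2))"
  proof (rule cells_cong)
    fix z
    have lin: "a * (x1 - x0) * (x1 + x0) + b * u * (x1 + x0) + (a * (y1 - y0) * (y1 + y0) + b * v * (y1 + y0))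
       = (a * (x1\<^sup>2 + y1\<^sup>2) - a * (x0\<^sup>2 + y0\<^sup>2)) + b * (u * (x1 + x0) + v * (y1 + y0))" for a b u v x1 x0 y1 y0 :: real
      by (simp add: algebra_simps power2_eq_square)
    show "(\<epsilon>0 * (1 + \<chi>1 z) * (Ax1 z - Ax0 z) * ?\<Phi>x z + \<epsilon>0 * \<chi>3 z * kerr (Ax1 z) (Ax0 z) (Ay1 z) (Ay0 z) * ?\<Phi>x z)
       + (\<epsilon>0 * (1 + \<chi>1 z) * (Ay1 z - Ay0 z) * ?\<Phi>y z + \<epsilon>0 * \<chi>3 z * kerr (Ay1 z) (Ay0 z) (Ax1 z) (Ax0 z) * ?\<Phi>y z)
       = (\<epsilon>0 * (1 + \<chi>1 z) * ((Ax1 z)\<^sup>2 + (Ay1 z)\<^sup>2) - \<epsilon>0 * (1 + \<chi>1 z) * ((Ax0 z)\<^sup>2 + (Ay0 z)\<^sup>2))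
      + 3 / 2 * (\<epsilon>0 * \<chi>3 z * ((Ax1 z)\<^sup>2 + (Ay1 z)\<^sup>2)\<^sup>2 - \<epsilon>0 * \<chi>3 z * ((Ax0 z)\<^sup>2 + (Ay0 z)\<^sup>2)\<^sup>2)"
      unfolding lin kerr_identity by (simp add: algebra_simps)
  qed
  also have "\<dots> = field_energy M \<epsilon>0 \<chi>1 Ax1 Ay1 - field_energy M \<epsilon>0 \<chi>1 Ax0 Ay0
      + 3 / 2 * (kerr_energy M \<epsilon>0 \<chi>3 Ax1 Ay1 - kerr_energy M \<epsilon>0 \<chi>3 Ax0 Ay0)"
    unfolding field_energy_def kerr_energy_def
    by (simp only: cells_add cells_diff cells_cmult bd)
  finally have EK: "cells M (\<lambda>z. (Dx1 z - Dx0 z) * ?\<Phi>x z) + cells M (\<lambda>z. (Dy1 z - Dy0 z) * ?\<Phi>y z) = \<dots>" .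
  have "cells M (\<lambda>z. \<mu>0 z * (H1 z - H0 z) * ?\<Psi> z) = cells M (\<lambda>z. \<mu>0 z * (H1 z)\<^sup>2 - \<mu>0 z * (H0 z)\<^sup>2)"
    by (intro cells_cong) (simp add: algebra_simps power2_eq_square)
  also have "\<dots> = magnetic_energy M \<mu>0 H1 - magnetic_energy M \<mu>0 H0"
    unfolding magnetic_energy_def by (simp only: cells_diff bd)
  finally have HH: "cells M (\<lambda>z. \<mu>0 z * (H1 z - H0 z) * ?\<Psi> z) = \<dots>" .
  have JJ: "cells M (\<lambda>z. Jx z * ?\<Phi>x z + Jy z * ?\<Phi>y z) = cells M (\<lambda>z. Jx z * ?\<Phi>x z) + cells M (\<lambda>z. Jy z * ?\<Phi>y z)"
    by (simp only: cells_add bd)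
  show ?thesis
    using X Y Z EK HH JJ
    unfolding curl_form_def curl_x_add_left[OF mesh U(1,2,6)] curl_y_add_left[OF mesh U(3,4,6)]
      curl_x_add_right[OF mesh U(1,5,6)] curl_y_add_right[OF mesh U(3,5,6)]
    by (simp add: algebra_simps)
qed

section \<open>Mesh regularity and the stability bound\<close>

text \<open>Were the radius larger than a side, the centre shifted by that side length would still
  lie in the ball, although two points of an open cell are always closer in that coordinate.\<close>

lemma inradius_le_hx_hy:
  assumes "is_mesh r s p q M" "i \<in> {1..Nx M}" "j \<in> {1..Ny M}"
  shows "inradius (Kcell M i j) \<le> hx M i" "inradius (Kcell M i j) \<le> hy M j"
proof -
  let ?R = "{\<rho>. 0 < \<rho> \<and> (\<exists>c. ball c \<rho> \<subseteq> Kcell M i j)}"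
  have "open (Kcell M i j)" unfolding Kcell_def Icell_def Jcell_def by (intro open_Times) auto
  moreover have "((xnode M (i - 1) + xnode M i) / 2, (ynode M (j - 1) + ynode M j) / 2) \<in> Kcell M i j"
    using is_mesh_xnode_less[OF assms(1,2)] is_mesh_ynode_less[OF assms(1,3)]
    by (auto simp: Kcell_def Icell_def Jcell_def)
  ultimately have ne: "?R \<noteq> {}" unfolding open_contains_ball by blast
  have pos: "0 < hx M i" "0 < hy M j"
    using is_mesh_xnode_less[OF assms(1,2)] is_mesh_ynode_less[OF assms(1,3)] by (auto simp: hx_def hy_def)
  have "\<rho> \<le> hx M i" if \<rho>: "\<rho> \<in> ?R" for \<rho>
  proof (rule ccontr)
    assume "\<not> \<rho> \<le> hx M i"
    obtain c where c: "ball c \<rho> \<subseteq> Kcell M i j" using \<rho> by blast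
    have "c \<in> ball c \<rho>" "(fst c + hx M i, snd c) \<in> ball c \<rho>"
      using \<rho> \<open>\<not> \<rho> \<le> hx M i\<close> pos by (auto simp: dist_prod_def dist_real_def)
    then have "c \<in> Kcell M i j" "(fst c + hx M i, snd c) \<in> Kcell M i j" using c by blast+
    then have "fst c \<in> Icell M i" "fst c + hx M i \<in> Icell M i" by (auto simp: Kcell_def)
    then show False by (simp add: Icell_def hx_def)
  qed
  then show "inradius (Kcell M i j) \<le> hx M i" unfolding inradius_def by (intro cSup_least ne)
  have "\<rho> \<le> hy M j" if \<rho>: "\<rho> \<in> ?R" for \<rho>
  proof (rule ccontr)
    assume "\<not> \<rho> \<le> hy M j"
    obtain c where c: "ball c \<rho> \<subseteq> Kcell M i j" using \<rho> by blast
    have "c \<in> ball c \<rho>" "(fst c, snd c + hy M j) \<in> ball c \<rho>"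
      using \<rho> \<open>\<not> \<rho> \<le> hy M j\<close> pos by (auto simp: dist_prod_def dist_real_def)
    then have "c \<in> Kcell M i j" "(fst c, snd c + hy M j) \<in> Kcell M i j" using c by blast+
    then have "snd c \<in> Jcell M j" "snd c + hy M j \<in> Jcell M j" by (auto simp: Kcell_def)
    then show False by (simp add: Jcell_def hy_def)
  qed
  then show "inradius (Kcell M i j) \<le> hy M j" unfolding inradius_def by (intro cSup_least ne)
qed

text \<open>
  On a tensor-product mesh every \<open>hx M i\<close> meets every \<open>hy M j\<close> in some cell, so shape regularity
  forces quasi-uniformity.
\<close>

lemma shape_regular_quasi_uniform:
  assumes mesh: "is_mesh r s p q M" and sr: "shape_regular C M" and C: "C > 0" and "r < s" "p < q"
  shows "i \<in> {1..Nx M} \<Longrightarrow> meshsize M \<le> (C + C\<^sup>2) * hx M i"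
    and "j \<in> {1..Ny M} \<Longrightarrow> meshsize M \<le> (C + C\<^sup>2) * hy M j"
    and "meshsize M > 0"
proof -
  have N: "Nx M \<ge> 1" "Ny M \<ge> 1"
    using mesh \<open>r < s\<close> \<open>p < q\<close> unfolding is_mesh_def by (cases "Nx M"; cases "Ny M"; auto)+
  have pos: "0 < hx M i" "0 < hy M j" if "i \<in> {1..Nx M}" "j \<in> {1..Ny M}" for i j
    using is_mesh_xnode_less[OF mesh that(1)] is_mesh_ynode_less[OF mesh that(2)] by (auto simp: hx_def hy_def)
  have xy: "hx M i \<le> C * hy M j" "hy M j \<le> C * hx M i" if ij: "i \<in> {1..Nx M}" "j \<in> {1..Ny M}" for i j
  proof -
    have "hx M i \<le> C * inradius (Kcell M i j)" "hy M j \<le> C * inradius (Kcell M i j)"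
      using sr ij unfolding shape_regular_def by blast+
    moreover have "C * inradius (Kcell M i j) \<le> C * hy M j" "C * inradius (Kcell M i j) \<le> C * hx M i"
      using inradius_le_hx_hy[OF mesh ij] C by (auto intro: mult_left_mono)
    ultimately show "hx M i \<le> C * hy M j" "hy M j \<le> C * hx M i" by linarith+
  qed
  \<comment> \<open>Two columns are compared through the first row, at the cost of one factor
    \<open>C\<close> for each cell.\<close>
  have xx: "hx M i' \<le> C\<^sup>2 * hx M i" if "i \<in> {1..Nx M}" "i' \<in> {1..Nx M}" for i i'
  proof -
    have "hx M i' \<le> C * hy M 1" by (rule xy) (use that N in auto)
    also have "\<dots> \<le> C * (C * hx M i)" by (intro mult_left_mono xy) (use that N C in auto)
    finally show ?thesis by (simp add: power2_eq_square mult.assoc)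
  qed
  have yy: "hy M j' \<le> C\<^sup>2 * hy M j" if "j \<in> {1..Ny M}" "j' \<in> {1..Ny M}" for j j'
  proof -
    have "hy M j' \<le> C * hx M 1" by (rule xy) (use that N in auto)
    also have "\<dots> \<le> C * (C * hy M j)" by (intro mult_left_mono xy) (use that N C in auto)
    finally show ?thesis by (simp add: power2_eq_square mult.assoc)
  qed
  \<comment> \<open>In \<open>C + C\<^sup>2\<close> the first summand covers widths in the other
    direction, the second those in the same direction.\<close>
  have bound: "meshsize M \<le> B" if "\<And>i. i \<in> {1..Nx M} \<Longrightarrow> hx M i \<le> B" "\<And>j. j \<in> {1..Ny M} \<Longrightarrow> hy M j \<le> B" for B
    unfolding meshsize_def using that N by (intro max.boundedI Max.boundedI) auto
  show "meshsize M \<le> (C + C\<^sup>2) * hx M i" if i: "i \<in> {1..Nx M}"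
  proof (rule bound)
    have "0 \<le> C * hx M i" "0 \<le> C\<^sup>2 * hx M i" using pos(1)[OF i, of 1] N C by auto
    then show "hx M i' \<le> (C + C\<^sup>2) * hx M i" if "i' \<in> {1..Nx M}" for i'
      using xx[OF i that] unfolding distrib_right by linarith
    show "hy M j' \<le> (C + C\<^sup>2) * hx M i" if "j' \<in> {1..Ny M}" for j'
      using xy(2)[OF i that] \<open>0 \<le> C\<^sup>2 * hx M i\<close> unfolding distrib_right by linarith
  qed
  show "meshsize M \<le> (C + C\<^sup>2) * hy M j" if j: "j \<in> {1..Ny M}"
  proof (rule bound)
    have "0 \<le> C * hy M j" "0 \<le> C\<^sup>2 * hy M j" using pos(2)[OF _ j, of 1] N C by auto
    then show "hy M j' \<le> (C + C\<^sup>2) * hy M j" if "j' \<in> {1..Ny M}" for j'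
      using yy[OF j that] unfolding distrib_right by linarith
    show "hx M i' \<le> (C + C\<^sup>2) * hy M j" if "i' \<in> {1..Nx M}" for i'
      using xy(1)[OF that j] \<open>0 \<le> C\<^sup>2 * hy M j\<close> unfolding distrib_right by linarith
  qed
  have "hx M 1 \<le> Max (hx M ` {1..Nx M})" using N by (intro Max_ge) auto
  moreover have "0 < hx M 1" by (rule pos(1)[of 1 1]) (use N in auto)
  ultimately show "meshsize M > 0" unfolding meshsize_def less_max_iff_disj by linarith
qed

text \<open>The step is implicit, as \<open>Z (Suc n)\<close> stands on both sides. With
  \<open>x = 3 / 2 * d\<close> one step multiplies by at most \<open>(1 + x) / (1 - x)\<close>,
  which is below \<open>exp (3 * x)\<close> for \<open>x \<le> 1 / 2\<close>, and
  \<open>3 * x = 9 / 2 * d\<close> is at most \<open>8 * d\<close>.\<close>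

lemma discrete_Gronwall:
  fixes Z Q :: "nat \<Rightarrow> real"
  assumes d: "0 < d" "d \<le> 1 / 3" and Z: "\<And>n. n \<le> N \<Longrightarrow> 0 \<le> Z n" and Q: "\<And>n. 0 \<le> Q n"
    and step: "\<And>n. n < N \<Longrightarrow> Z (Suc n) \<le> Z n + d / 2 * Q n + 3 / 2 * d * (Z n + Z (Suc n))"
  shows "Z N \<le> exp (8 * (d * real N)) * (Z 0 + d / 2 * (\<Sum>n<N. Q n))"
proof -
  have "n \<le> N \<Longrightarrow> Z n \<le> exp (8 * (d * real n)) * (Z 0 + d / 2 * (\<Sum>k<n. Q k))" for n
  proof (induction n)
    case (Suc n)
    let ?x = "3 / 2 * d"
    have x: "0 \<le> ?x" "?x \<le> 1 / 2" using d by auto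
    have "(1 - ?x) * Z (Suc n) \<le> (1 + ?x) * Z n + d / 2 * Q n"
      using step[of n] Suc.prems unfolding left_diff_distrib distrib_left distrib_right by simp
    also have "\<dots> \<le> (1 + ?x) * (Z n + d / 2 * Q n)"
      using Q[of n] d by (simp add: distrib_left distrib_right)
    also have "\<dots> \<le> exp ?x * (Z n + d / 2 * Q n)"
      using Z[of n] Q[of n] d Suc.prems by (intro mult_right_mono exp_ge_add_one_self) auto
    finally have 1: "(1 - ?x) * Z (Suc n) \<le> exp ?x * (Z n + d / 2 * Q n)" .
    \<comment> \<open>This is \<open>1 / (1 - x) \<le> 1 + 2 * x\<close>, the place where
      \<open>d \<le> 1 / 3\<close> is used.\<close>
    have "?x * ?x \<le> 1 / 2 * ?x" using x by (intro mult_right_mono) auto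
    then have "1 \<le> (1 + 2 * ?x) * (1 - ?x)" by (simp add: algebra_simps)
    also have "\<dots> \<le> exp (2 * ?x) * (1 - ?x)"
      using x by (intro mult_right_mono exp_ge_add_one_self) auto
    finally have "1 * Z (Suc n) \<le> (exp (2 * ?x) * (1 - ?x)) * Z (Suc n)"
      using Z[of "Suc n"] Suc.prems by (intro mult_right_mono) auto
    also have "\<dots> \<le> exp (2 * ?x) * (exp ?x * (Z n + d / 2 * Q n))"
      unfolding mult.assoc by (intro mult_left_mono 1) auto
    also have "\<dots> = exp (3 * ?x) * (Z n + d / 2 * Q n)"
      by (simp add: mult_exp_exp[symmetric] exp_add[symmetric] mult.assoc[symmetric])
    also have "\<dots> \<le> exp (8 * d) * (Z n + d / 2 * Q n)"
      using Z[of n] Q[of n] d Suc.prems by (intro mult_right_mono) auto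
    also have "\<dots> \<le> exp (8 * d) * (exp (8 * (d * real n)) * (Z 0 + d / 2 * (\<Sum>k<n. Q k)) + exp (8 * (d * real n)) * (d / 2 * Q n))"
    proof (intro mult_left_mono add_mono)
      show "Z n \<le> exp (8 * (d * real n)) * (Z 0 + d / 2 * (\<Sum>k<n. Q k))" using Suc by simp
      have "1 * (d / 2 * Q n) \<le> exp (8 * (d * real n)) * (d / 2 * Q n)"
        using Q[of n] d by (intro mult_right_mono) auto
      then show "d / 2 * Q n \<le> exp (8 * (d * real n)) * (d / 2 * Q n)" by simp
    qed simp
    also have "\<dots> = exp (8 * d) * exp (8 * (d * real n)) * (Z 0 + d / 2 * (\<Sum>k<Suc n. Q k))"
      by (simp add: algebra_simps)
    also have "exp (8 * d) * exp (8 * (d * real n)) = exp (8 * (d * real (Suc n)))"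
      by (simp add: exp_add[symmetric] algebra_simps)
    finally show ?case by simp
  qed simp
  then show ?thesis by simp
qed

section \<open>Weighted norms as cell sums and the energy bounds\<close>

lemma wnorm_sq_cells:
  assumes mesh: "is_mesh r s p q M" and \<Omega>: "\<Omega> = {r<..<s} \<times> {p<..<q}"
    and L: "Linf_cells M (\<lambda>z. (norm (v z))\<^sup>2 * \<omega> z)" and pos: "\<And>z. z \<in> \<Omega> \<Longrightarrow> \<omega> z \<ge> 0"
  shows "(wnorm \<Omega> \<omega> v)\<^sup>2 = cells M (\<lambda>z. (norm (v z))\<^sup>2 * \<omega> z)"
proof -
  have "(LINT z|lebesgue_on \<Omega>. (norm (v z))\<^sup>2 * \<omega> z) \<ge> 0"
    by (intro Bochner_Integration.integral_nonneg mult_nonneg_nonneg pos) auto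
  then show ?thesis
    unfolding wnorm_def using lebesgue_integral_cells[OF mesh L] \<Omega> by simp
qed

lemma Linf_cells_of_Linf_on:
  assumes "is_mesh r s p q M" "\<Omega> = {r<..<s} \<times> {p<..<q}" "Linf_on \<Omega> f"
  shows "Linf_cells M f"
proof -
  have "\<Omega> \<in> sets lebesgue" unfolding assms(2) open_rectangle_eq_box by simp
  then show ?thesis
    unfolding Linf_cells_def using Kcell_subset[OF assms(1)] assms(2,3)
    by (intro ballI Linf_on_subset[OF assms(3)]) (simp_all del: atLeastAtMost_iff)
qed

theorem theorem7p1:
  fixes r s p q T \<epsilon>0 c0 Csr :: real
    and \<mu>0 \<chi>1 \<chi>3 :: "real \<times> real \<Rightarrow> real"
    and \<Omega> :: "(real \<times> real) set"
    and k :: nat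
  assumes "r < s" and "p < q" and "\<Omega> = {r<..<s} \<times> {p<..<q}"
    and "T > 0" and "\<epsilon>0 > 0" and "c0 > 0" and "Csr > 0"
    and "Linf_on \<Omega> \<mu>0" and "\<forall>z\<in>\<Omega>. \<mu>0 z > 0"
    and "Linf_on \<Omega> \<chi>1" and "\<forall>z\<in>\<Omega>. \<chi>1 z > 0"
    and "Linf_on \<Omega> \<chi>3" and "\<forall>z\<in>\<Omega>. \<chi>3 z > 0"
    and mu0_bounded_below: "\<exists>m>0. AE z in lebesgue_on \<Omega>. m \<le> \<mu>0 z"
  shows "\<exists>\<tau>0>0. \<exists>h0>0. \<exists>\<kappa>>0.
    \<forall>(M :: mesh) (N :: nat) (Jxh :: real \<Rightarrow> real \<times> real \<Rightarrow> real) (Jyh :: real \<Rightarrow> real \<times> real \<Rightarrow> real)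
      (Exh :: nat \<Rightarrow> real \<times> real \<Rightarrow> real) (Eyh :: nat \<Rightarrow> real \<times> real \<Rightarrow> real)
      (Hzh :: nat \<Rightarrow> real \<times> real \<Rightarrow> real).
      is_mesh r s p q M \<longrightarrow> shape_regular Csr M \<longrightarrow> N \<ge> 1 \<longrightarrow>
      cont_Uhk T \<Omega> M k Jxh \<longrightarrow> cont_Uhk T \<Omega> M k Jyh \<longrightarrow>
      discrete_solution \<epsilon>0 \<mu>0 \<chi>1 \<chi>3 c0 M k T N Jxh Jyh Exh Eyh Hzh \<longrightarrow>
      T / real N \<le> \<tau>0 \<longrightarrow> meshsize M \<le> h0 \<longrightarrow> T / real N / meshsize M \<le> \<kappa> \<longrightarrow>
      ((\<forall>t\<in>{0..T}. AE z in lebesgue_on \<Omega>. Jxh t z = 0 \<and> Jyh t z = 0) \<longrightarrow>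
         energy \<Omega> \<epsilon>0 \<mu>0 \<chi>1 \<chi>3 (Exh N) (Eyh N) (Hzh N)
           \<le> 3 * energy \<Omega> \<epsilon>0 \<mu>0 \<chi>1 \<chi>3 (Exh 0) (Eyh 0) (Hzh 0)) \<and>
      energy \<Omega> \<epsilon>0 \<mu>0 \<chi>1 \<chi>3 (Exh N) (Eyh N) (Hzh N)
        \<le> exp (8 * T + 1) *
          (3 * energy \<Omega> \<epsilon>0 \<mu>0 \<chi>1 \<chi>3 (Exh 0) (Eyh 0) (Hzh 0)
           + T / real N * (\<Sum>n<N. (wnorm \<Omega> (\<lambda>z. inverse (\<epsilon>0 * (1 + \<chi>1 z)))
               (\<lambda>z. (Jxh ((real n + 1 / 2) * (T / real N)) z,
                     Jyh ((real n + 1 / 2) * (T / real N)) z)))\<^sup>2))"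

proof -
  note \<Omega> = assms(3) and \<epsilon>0 = assms(5)
  obtain m where m: "m > 0" "AE z in lebesgue_on \<Omega>. m \<le> \<mu>0 z" using mu0_bounded_below by blast
  have \<Omega>_sets: "\<Omega> \<in> sets lebesgue" unfolding \<Omega> open_rectangle_eq_box by simp
  obtain K where K: "K > 0" "\<And>r s p q M E H l. is_mesh r s p q M \<Longrightarrow> l > 0 \<Longrightarrow>
     (\<forall>i\<in>{1..Nx M}. l \<le> hx M i) \<Longrightarrow> (\<forall>j\<in>{1..Ny M}. l \<le> hy M j) \<Longrightarrow> E \<in> Uhk M k \<Longrightarrow> H \<in> Uhk M k \<Longrightarrow>
     \<bar>curl_x M E H\<bar> \<le> K / l * cells M (\<lambda>z. (E z)\<^sup>2 + (H z)\<^sup>2) \<and>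
     \<bar>curl_y M E H\<bar> \<le> K / l * cells M (\<lambda>z. (E z)\<^sup>2 + (H z)\<^sup>2)"
    using curl_bound[of k] by blast
  \<comment> \<open>\<open>c\<close> bounds both quadratic weights from below, and
    \<open>meshsize M / L\<close> bounds all cell widths from below. Then the cross term is at most
    \<open>2 * K * L / c\<close> times \<open>d / meshsize M\<close> times the quadratic energy, and
    \<open>\<kappa>\<close> is chosen to make this product one third.\<close>
  define c where "c = min \<epsilon>0 m"
  define L where "L = Csr + Csr\<^sup>2"
  define \<kappa> where "\<kappa> = c / (6 * K * L)"
  have c: "c > 0" using m \<epsilon>0 by (simp add: c_def)
  have L: "L > 0" using assms(7) by (simp add: L_def add_pos_pos)
  have \<kappa>: "\<kappa> > 0" using c K(1) L by (simp add: \<kappa>_def)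
  show ?thesis
  proof (rule exI[of _ "1/3"], intro conjI, simp, rule exI[of _ 1], intro conjI, simp, rule exI[of _ \<kappa>],
      intro conjI \<kappa>, intro allI impI)
    fix M :: mesh and N :: nat and Jxh Jyh :: "real \<Rightarrow> real \<times> real \<Rightarrow> real"
      and Exh Eyh Hzh :: "nat \<Rightarrow> real \<times> real \<Rightarrow> real"
    assume mesh: "is_mesh r s p q M" and sr: "shape_regular Csr M" and N: "1 \<le> N"
      and Jx: "cont_Uhk T \<Omega> M k Jxh" and Jy: "cont_Uhk T \<Omega> M k Jyh"
      and sol: "discrete_solution \<epsilon>0 \<mu>0 \<chi>1 \<chi>3 c0 M k T N Jxh Jyh Exh Eyh Hzh"
      and dt: "T / real N \<le> 1 / 3" and "meshsize M \<le> 1" and cfl: "T / real N / meshsize M \<le> \<kappa>"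
    define d where "d = T / real N"
    have d: "d > 0" "d \<le> 1 / 3" "d * real N = T" using N \<open>T > 0\<close> dt by (auto simp: d_def)
    define th where "th n = (real n + 1 / 2) * d" for n :: nat
    have th: "th n \<in> {0..T}" if "n < N" for n
    proof -
      \<comment> \<open>Midpoints of time steps stay in \<open>[0, T]\<close> because
        \<open>n + 1 / 2 \<le> N\<close> for \<open>n < N\<close>.\<close>
      have "(real n + 1 / 2) * d \<le> real N * d" using that d by (intro mult_right_mono) auto
      then show ?thesis using d by (simp add: th_def mult.commute)
    qed
    have JU: "Jxh (th n) \<in> Uhk M k" "Jyh (th n) \<in> Uhk M k" if "n < N" for n
      using Jx Jy th[OF that] unfolding cont_Uhk_def by blast+
    have U: "Exh n \<in> Uhk M k" "Eyh n \<in> Uhk M k" "Hzh n \<in> Uhk M k" if "n \<le> N" for n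
      using sol that unfolding discrete_solution_def by blast+
    have Lc: "Linf_cells M \<chi>1" "Linf_cells M \<chi>3" "Linf_cells M \<mu>0"
      using Linf_cells_of_Linf_on[OF mesh \<Omega>] assms(8,10,12) by blast+
    have sub: "z \<in> \<Omega>" if "i \<in> {1..Nx M}" "j \<in> {1..Ny M}" "z \<in> Kcell M i j" for i j z
      using Kcell_subset[OF mesh that(1,2)] that(3) \<Omega> by blast
    have weight: "c \<le> \<epsilon>0 * (1 + \<chi>1 z)" "0 < \<epsilon>0 * (1 + \<chi>1 z)" "\<epsilon>0 \<le> \<epsilon>0 * (1 + \<chi>1 z)" "0 \<le> \<epsilon>0 * \<chi>3 z" "0 \<le> \<mu>0 z"
      if "z \<in> \<Omega>" for z
    proof -
      have *: "0 < \<chi>1 z" "0 < \<chi>3 z" "0 < \<mu>0 z" using assms(9,11,13) that by blast+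
      then have "0 < \<epsilon>0 * \<chi>1 z" "0 \<le> \<epsilon>0 * \<chi>3 z" using \<epsilon>0 by simp_all
      moreover have "c \<le> \<epsilon>0" by (simp add: c_def)
      ultimately show "c \<le> \<epsilon>0 * (1 + \<chi>1 z)" "0 < \<epsilon>0 * (1 + \<chi>1 z)" "\<epsilon>0 \<le> \<epsilon>0 * (1 + \<chi>1 z)"
        "0 \<le> \<epsilon>0 * \<chi>3 z" "0 \<le> \<mu>0 z"
        using * \<epsilon>0 unfolding distrib_left by linarith+
    qed
    have inv: "Linf_cells M (\<lambda>z. inverse (\<epsilon>0 * (1 + \<chi>1 z)))"
      unfolding Linf_cells_def
    proof (intro ballI)
      fix i j assume ij: "i \<in> {1..Nx M}" "j \<in> {1..Ny M}"
      show "Linf_on (Kcell M i j) (\<lambda>z. inverse (\<epsilon>0 * (1 + \<chi>1 z)))"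
      proof (rule Linf_on_inverse[OF _ \<epsilon>0])
        show "Linf_on (Kcell M i j) (\<lambda>z. \<epsilon>0 * (1 + \<chi>1 z))"
          using Lc(1) ij unfolding Linf_cells_def by (intro Linf_on_intros) blast
      qed (use weight(3) sub ij in blast)
    qed

    \<comment> \<open>Energies, cross term and current along the discrete evolution\<close>
    define F where "F n = field_energy M \<epsilon>0 \<chi>1 (Exh n) (Eyh n)" for n
    define G where "G n = kerr_energy M \<epsilon>0 \<chi>3 (Exh n) (Eyh n)" for n
    define H where "H n = magnetic_energy M \<mu>0 (Hzh n)" for n
    define B where "B n = d * curl_form M (Exh n) (Eyh n) (Hzh n)" for n
    define Z where "Z n = F n + 3 / 2 * G n + H n + B n" for n
    define Q where "Q n = (wnorm \<Omega> (\<lambda>z. inverse (\<epsilon>0 * (1 + \<chi>1 z))) (\<lambda>z. (Jxh (th n) z, Jyh (th n) z)))\<^sup>2" for n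
    define S where "S n = cells M (\<lambda>z. Jxh (th n) z * (Exh (Suc n) z + Exh n z) + Jyh (th n) z * (Eyh (Suc n) z + Eyh n z))" for n
    define En where "En n = energy \<Omega> \<epsilon>0 \<mu>0 \<chi>1 \<chi>3 (Exh n) (Eyh n) (Hzh n)" for n
    note bd = Linf_cells_intros Lc inv
    have UL: "Linf_cells M (Exh n)" "Linf_cells M (Eyh n)" "Linf_cells M (Hzh n)" if "n \<le> N" for n
      using U[OF that] Linf_cells_Uhk by blast+
    have norm_pair: "(norm (a, b))\<^sup>2 = a\<^sup>2 + b\<^sup>2" for a b :: real by (simp add: norm_Pair)
    have nonneg: "0 \<le> F n" "0 \<le> G n" "0 \<le> H n" if n: "n \<le> N" for n
    proof -
      have zero: "cells M (\<lambda>z. 0) = 0" by (simp add: cells_def)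
      show "0 \<le> F n" unfolding F_def field_energy_def
        by (subst zero[symmetric], rule cells_mono)
          (auto intro!: bd UL[OF n] mult_nonneg_nonneg less_imp_le[OF weight(2)] sub simp del: distrib_left_numeral)
      show "0 \<le> G n" unfolding G_def kerr_energy_def
        by (subst zero[symmetric], rule cells_mono)
          (auto intro!: bd UL[OF n] mult_nonneg_nonneg[OF weight(4)] sub)
      show "0 \<le> H n" unfolding H_def magnetic_energy_def
        by (subst zero[symmetric], rule cells_mono)
          (auto intro!: bd UL[OF n] mult_nonneg_nonneg[OF weight(5)] sub)
    qed
    have En: "En n = F n + H n + G n" if n: "n \<le> N" for n
    proof -
      have "(wnorm \<Omega> (\<lambda>z. \<epsilon>0 * (1 + \<chi>1 z)) (\<lambda>z. (Exh n z, Eyh n z)))\<^sup>2 = F n"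
        unfolding F_def field_energy_def
        by (subst wnorm_sq_cells[OF mesh \<Omega>])
          (auto intro!: bd UL[OF n] less_imp_le[OF weight(2)] cells_cong simp: norm_pair mult_ac)
      moreover have "(wnorm \<Omega> \<mu>0 (Hzh n))\<^sup>2 = H n"
        unfolding H_def magnetic_energy_def
        by (subst wnorm_sq_cells[OF mesh \<Omega>])
          (auto intro!: bd UL[OF n] weight(5) cells_cong simp: mult_ac)
      moreover have "(wnorm \<Omega> (\<lambda>z. \<epsilon>0 * \<chi>3 z) (\<lambda>z. (norm (Exh n z, Eyh n z))\<^sup>2))\<^sup>2 = G n"
        unfolding G_def kerr_energy_def
        by (subst wnorm_sq_cells[OF mesh \<Omega>])
          (auto intro!: bd UL[OF n] weight(4) cells_cong simp: norm_pair mult_ac)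
      ultimately show ?thesis unfolding En_def energy_def by simp
    qed
    have Bn: "\<bar>B n\<bar> \<le> (F n + H n) / 3" if n: "n \<le> N" for n
    proof -
      define l where "l = meshsize M / L"
      note qu = shape_regular_quasi_uniform[OF mesh sr \<open>Csr > 0\<close> \<open>r < s\<close> \<open>p < q\<close>]
      have l: "l > 0" using qu(3) L by (simp add: l_def)
      have lx: "\<forall>i\<in>{1..Nx M}. l \<le> hx M i" and ly: "\<forall>j\<in>{1..Ny M}. l \<le> hy M j"
        using qu(1,2) L by (auto simp: l_def L_def[symmetric] pos_divide_le_eq mult.commute)
      let ?A = "cells M (\<lambda>z. (Exh n z)\<^sup>2 + (Hzh n z)\<^sup>2) + cells M (\<lambda>z. (Eyh n z)\<^sup>2 + (Hzh n z)\<^sup>2)"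
      have "\<bar>curl_form M (Exh n) (Eyh n) (Hzh n)\<bar> \<le> K / l * ?A"
        using K(2)[OF mesh l lx ly U(1,3)[OF n]] K(2)[OF mesh l lx ly U(2,3)[OF n]]
        unfolding curl_form_def distrib_left by linarith
      \<comment> \<open>The magnetic field is paired with each electric component and so counted
        twice, whence the 2 in \<open>2 / c\<close>.\<close>
      moreover have "?A \<le> 2 / c * (F n + H n)"
      proof -
        have "?A = cells M (\<lambda>z. ((Exh n z)\<^sup>2 + (Hzh n z)\<^sup>2) + ((Eyh n z)\<^sup>2 + (Hzh n z)\<^sup>2))"
          by (intro cells_add[symmetric] bd UL[OF n])
        also have "\<dots> \<le> cells M (\<lambda>z. 2 / c * (\<epsilon>0 * (1 + \<chi>1 z) * ((Exh n z)\<^sup>2 + (Eyh n z)\<^sup>2) + \<mu>0 z * (Hzh n z)\<^sup>2))"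
        proof (rule cells_mono_AE)
          fix i j assume ij: "i \<in> {1..Nx M}" "j \<in> {1..Ny M}"
          have "AE z in lebesgue_on (Kcell M i j). m \<le> \<mu>0 z"
            by (rule AE_lebesgue_on_subset[OF m(2)]) (use sub[OF ij] \<Omega>_sets in auto)
          moreover have "AE z in lebesgue_on (Kcell M i j). z \<in> \<Omega>"
            using sub[OF ij] by (intro AE_I2) simp
          ultimately show "AE z in lebesgue_on (Kcell M i j). (Exh n z)\<^sup>2 + (Hzh n z)\<^sup>2 + ((Eyh n z)\<^sup>2 + (Hzh n z)\<^sup>2)
              \<le> 2 / c * (\<epsilon>0 * (1 + \<chi>1 z) * ((Exh n z)\<^sup>2 + (Eyh n z)\<^sup>2) + \<mu>0 z * (Hzh n z)\<^sup>2)"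
          proof eventually_elim
            case (elim z)
            have "c * ((Exh n z)\<^sup>2 + (Eyh n z)\<^sup>2) \<le> \<epsilon>0 * (1 + \<chi>1 z) * ((Exh n z)\<^sup>2 + (Eyh n z)\<^sup>2)"
              by (rule mult_right_mono[OF weight(1)[OF elim(2)]]) simp
            moreover have "c * (Hzh n z)\<^sup>2 \<le> \<mu>0 z * (Hzh n z)\<^sup>2"
              by (rule mult_right_mono) (use elim(1) in \<open>auto simp: c_def\<close>)
            moreover have "0 \<le> c * ((Exh n z)\<^sup>2 + (Eyh n z)\<^sup>2)" using c by simp
            ultimately have "c * ((Exh n z)\<^sup>2 + (Hzh n z)\<^sup>2 + ((Eyh n z)\<^sup>2 + (Hzh n z)\<^sup>2))
              \<le> 2 * (\<epsilon>0 * (1 + \<chi>1 z) * ((Exh n z)\<^sup>2 + (Eyh n z)\<^sup>2) + \<mu>0 z * (Hzh n z)\<^sup>2)"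
              unfolding distrib_left by linarith
            then show ?case using c by (simp add: pos_le_divide_eq mult.commute)
          qed
        qed (intro bd UL[OF n])+
        also have "\<dots> = 2 / c * (F n + H n)"
          unfolding F_def H_def field_energy_def magnetic_energy_def
          by (simp only: cells_cmult cells_add bd UL[OF n])
        finally show ?thesis .
      qed
      ultimately have "\<bar>curl_form M (Exh n) (Eyh n) (Hzh n)\<bar> \<le> K / l * (2 / c * (F n + H n))"
        using mult_left_mono[of ?A "2 / c * (F n + H n)" "K / l"] K(1) l by auto
      then have "d * \<bar>curl_form M (Exh n) (Eyh n) (Hzh n)\<bar> \<le> d * (K / l * (2 / c * (F n + H n)))"
        using d by (intro mult_left_mono) auto
      also have "\<dots> = d / meshsize M * (2 * K * L / c * (F n + H n))"
        unfolding l_def by simp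
      also have "\<dots> \<le> \<kappa> * (2 * K * L / c * (F n + H n))"
        using cfl K(1) L c nonneg[OF n] unfolding d_def[symmetric] by (intro mult_right_mono) auto
      also have "\<dots> = (F n + H n) / 3"
        unfolding \<kappa>_def using K(1) L c by (simp add: field_simps)
      finally show ?thesis unfolding B_def using d by (simp add: abs_mult)
    qed
    \<comment> \<open>\<open>Z n\<close> is at least
      \<open>2 / 3 * (F n + H n) + 3 / 2 * G n\<close>, so multiplication by \<open>3 / 2\<close>
      recovers every term.\<close>
    have Zlow: "F n + 3 / 2 * G n + H n \<le> 3 / 2 * Z n" if n: "n \<le> N" for n
      using Bn[OF n] nonneg[OF n] unfolding Z_def by (simp add: abs_le_iff)
    have FZ: "F n \<le> 3 / 2 * Z n" if n: "n \<le> N" for n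
      using Zlow[OF n] nonneg[OF n] by linarith
    \<comment> \<open>The quadratic part gets at most the factor \<open>4 / 3\<close>, the Kerr part
      \<open>3 / 2\<close>; 2 covers both.\<close>
    have Z0: "Z 0 \<le> 2 * En 0"
      using Bn[of 0] nonneg[of 0] En[of 0] unfolding Z_def by (simp add: abs_le_iff)
    have ZN: "En N \<le> 3 / 2 * Z N" using Zlow[of N] nonneg[of N] En[of N] by simp
    have step: "Z (Suc n) \<le> Z n + d * S n" if n: "n < N" for n
    proof -
      obtain Dx Dy where "\<forall>n<N. let \<Delta>t = T / real N; th = (real n + 1 / 2) * \<Delta>t in
          D_relation M k \<epsilon>0 \<chi>1 \<chi>3 (Dx (Suc n)) (Dx n) (Exh (Suc n)) (Exh n) (Eyh (Suc n)) (Eyh n) \<and>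
          D_relation M k \<epsilon>0 \<chi>1 \<chi>3 (Dy (Suc n)) (Dy n) (Eyh (Suc n)) (Eyh n) (Exh (Suc n)) (Exh n) \<and>
          Ex_equation c0 M k \<Delta>t (Dx (Suc n)) (Dx n) (Exh (Suc n)) (Exh n) (Hzh n) (Jxh th) \<and>
          Ey_equation c0 M k \<Delta>t (Dy (Suc n)) (Dy n) (Eyh (Suc n)) (Eyh n) (Hzh n) (Jyh th) \<and>
          Hz_equation M k \<Delta>t \<mu>0 (Hzh (Suc n)) (Hzh n) (Exh (Suc n)) (Eyh (Suc n))"
        using sol unfolding discrete_solution_def by blast
      then have eqs: "D_relation M k \<epsilon>0 \<chi>1 \<chi>3 (Dx (Suc n)) (Dx n) (Exh (Suc n)) (Exh n) (Eyh (Suc n)) (Eyh n)"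
          "D_relation M k \<epsilon>0 \<chi>1 \<chi>3 (Dy (Suc n)) (Dy n) (Eyh (Suc n)) (Eyh n) (Exh (Suc n)) (Exh n)"
          "Ex_equation c0 M k d (Dx (Suc n)) (Dx n) (Exh (Suc n)) (Exh n) (Hzh n) (Jxh (th n))"
          "Ey_equation c0 M k d (Dy (Suc n)) (Dy n) (Eyh (Suc n)) (Eyh n) (Hzh n) (Jyh (th n))"
          "Hz_equation M k d \<mu>0 (Hzh (Suc n)) (Hzh n) (Exh (Suc n)) (Eyh (Suc n))"
        using n unfolding Let_def d_def th_def by blast+
      have n': "n \<le> N" "Suc n \<le> N" using n by auto
      show ?thesis
        using energy_step[OF mesh \<open>r < s\<close> \<open>p < q\<close> \<open>c0 > 0\<close> d(1) Lc U(1)[OF n'(2)] U(1)[OF n'(1)]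
            U(2)[OF n'(2)] U(2)[OF n'(1)] U(3)[OF n'(2)] U(3)[OF n'(1)] JU[OF n] eqs]
        unfolding Z_def F_def G_def H_def B_def S_def .
    qed
    have Qc: "Q n = cells M (\<lambda>z. ((Jxh (th n) z)\<^sup>2 + (Jyh (th n) z)\<^sup>2) * inverse (\<epsilon>0 * (1 + \<chi>1 z)))" if n: "n < N" for n
      unfolding Q_def
      by (subst wnorm_sq_cells[OF mesh \<Omega>])
        (auto intro!: bd JU[OF n, THEN Linf_cells_Uhk] less_imp_le[OF weight(2)] cells_cong simp: norm_pair simp del: inverse_mult_distrib)
    \<comment> \<open>Young's inequality with the weight
      \<open>\<epsilon>0 * (1 + \<chi>1 z)\<close> puts its inverse on the current, as in the norm
      defining \<open>Q\<close>; the square of the sum of two time levels then splits into twice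
      each square.\<close>
    have SQ: "S n \<le> Q n / 2 + F (Suc n) + F n" if n: "n < N" for n
    proof -
      have n': "n \<le> N" "Suc n \<le> N" using n by auto
      note bd' = bd JU[OF n, THEN Linf_cells_Uhk] UL[OF n'(1)] UL[OF n'(2)]
      have young: "u * v \<le> u\<^sup>2 * inverse a / 2 + a * v\<^sup>2 / 2" if "a > 0" for a u v :: real
      proof -
        have "0 \<le> (u - a * v)\<^sup>2 * inverse a / 2" using that by simp
        also have "\<dots> = u\<^sup>2 * inverse a / 2 + a * v\<^sup>2 / 2 - u * v"
          using that by (simp add: power2_eq_square field_simps)
        finally show ?thesis by simp
      qed
      have sq: "a * (v1 + v0)\<^sup>2 / 2 \<le> a * v1\<^sup>2 + a * v0\<^sup>2" if "a > 0" for a v1 v0 :: real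
      proof -
        have "0 \<le> a * (v1 - v0)\<^sup>2 / 2" using that by simp
        also have "\<dots> = a * v1\<^sup>2 + a * v0\<^sup>2 - a * (v1 + v0)\<^sup>2 / 2"
          by (simp add: power2_eq_square field_simps)
        finally show ?thesis by simp
      qed
      have "S n \<le> cells M (\<lambda>z. ((Jxh (th n) z)\<^sup>2 + (Jyh (th n) z)\<^sup>2) * inverse (\<epsilon>0 * (1 + \<chi>1 z)) / 2
          + \<epsilon>0 * (1 + \<chi>1 z) * ((Exh (Suc n) z)\<^sup>2 + (Eyh (Suc n) z)\<^sup>2) + \<epsilon>0 * (1 + \<chi>1 z) * ((Exh n z)\<^sup>2 + (Eyh n z)\<^sup>2))"
        unfolding S_def
      proof (rule cells_mono)
        fix i j z assume z: "i \<in> {1..Nx M}" "j \<in> {1..Ny M}" "z \<in> Kcell M i j"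
        define a where "a = \<epsilon>0 * (1 + \<chi>1 z)"
        have a: "a > 0" unfolding a_def by (rule weight(2)[OF sub[OF z]])
        show "Jxh (th n) z * (Exh (Suc n) z + Exh n z) + Jyh (th n) z * (Eyh (Suc n) z + Eyh n z)
          \<le> ((Jxh (th n) z)\<^sup>2 + (Jyh (th n) z)\<^sup>2) * inverse (\<epsilon>0 * (1 + \<chi>1 z)) / 2
          + \<epsilon>0 * (1 + \<chi>1 z) * ((Exh (Suc n) z)\<^sup>2 + (Eyh (Suc n) z)\<^sup>2) + \<epsilon>0 * (1 + \<chi>1 z) * ((Exh n z)\<^sup>2 + (Eyh n z)\<^sup>2)"
          using young[OF a, of "Jxh (th n) z" "Exh (Suc n) z + Exh n z"] young[OF a, of "Jyh (th n) z" "Eyh (Suc n) z + Eyh n z"]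
            sq[OF a, of "Exh (Suc n) z" "Exh n z"] sq[OF a, of "Eyh (Suc n) z" "Eyh n z"]
          unfolding a_def[symmetric] unfolding distrib_right distrib_left add_divide_distrib by linarith
      qed (intro bd')+
      also have "\<dots> = Q n / 2 + F (Suc n) + F n"
      proof -
        have half: "cells M (\<lambda>z. f z / 2) = cells M f / 2" for f
          using cells_cmult[of M "1/2" f] by simp
        show ?thesis unfolding Qc[OF n] F_def field_energy_def by (simp only: cells_add half bd')
      qed
      finally show ?thesis .
    qed
    have Q0: "0 \<le> Q n" for n unfolding Q_def by simp

    \<comment> \<open>The bounds without and with current\<close>
    have "En N \<le> 3 * En 0" if J0: "\<forall>t\<in>{0..T}. AE z in lebesgue_on \<Omega>. Jxh t z = 0 \<and> Jyh t z = 0"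
    proof -
      \<comment> \<open>The current vanishes only almost everywhere and enters at midpoints in time,
        which lie in \<open>[0, T]\<close>.\<close>
      have S0: "S n = 0" if n: "n < N" for n
        unfolding S_def cells_def
      proof (intro sum.neutral ballI)
        fix i j assume ij: "i \<in> {1..Nx M}" "j \<in> {1..Ny M}"
        have "AE z in lebesgue_on (Kcell M i j). Jxh (th n) z = 0 \<and> Jyh (th n) z = 0"
          by (rule AE_lebesgue_on_subset[OF bspec[OF J0 th[OF n]]]) (use sub[OF ij] \<Omega>_sets in auto)
        then show "(LINT z|lebesgue_on (Kcell M i j). Jxh (th n) z * (Exh (Suc n) z + Exh n z) + Jyh (th n) z * (Eyh (Suc n) z + Eyh n z)) = 0"
          by (intro integral_eq_zero_AE) (auto elim: eventually_mono)
      qed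
      have "n \<le> N \<Longrightarrow> Z n \<le> Z 0" for n
      proof (induction n)
        case (Suc n)
        then show ?case using step[of n] S0[of n] by simp
      qed simp
      then show ?thesis using ZN Z0 by force
    qed
    moreover have "En N \<le> exp (8 * T + 1) * (3 * En 0 + d * (\<Sum>n<N. Q n))"
    proof -
      have "Z N \<le> exp (8 * (d * real N)) * (Z 0 + d / 2 * (\<Sum>n<N. Q n))"
      proof (rule discrete_Gronwall[OF d(1,2) _ Q0])
        show "0 \<le> Z n" if "n \<le> N" for n using Zlow[OF that] nonneg[OF that] by simp
        show "Z (Suc n) \<le> Z n + d / 2 * Q n + 3 / 2 * d * (Z n + Z (Suc n))" if n: "n < N" for n
        proof -
          \<comment> \<open>The field energies of both time levels are replaced by
            \<open>3 / 2 * Z\<close>, which closes the recursion in \<open>Z\<close> alone.\<close>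
          have "S n \<le> Q n / 2 + 3 / 2 * (Z n + Z (Suc n))"
            using SQ[OF n] FZ[OF less_imp_le[OF n]] FZ[OF Suc_leI[OF n]] unfolding distrib_left by linarith
          then have "d * S n \<le> d * (Q n / 2 + 3 / 2 * (Z n + Z (Suc n)))" using d by (intro mult_left_mono) auto
          then show ?thesis using step[OF n] by (simp add: algebra_simps)
        qed
      qed
      \<comment> \<open>The factor \<open>3 / 2\<close> turns the bound \<open>2 * En 0\<close> on
        \<open>Z 0\<close> into \<open>3 * En 0\<close>, and \<open>d / 2\<close> in front of the
        currents into \<open>3 / 4 * d\<close>, at most \<open>d\<close>.\<close>
      then have "En N \<le> 3 / 2 * (exp (8 * T) * (Z 0 + d / 2 * (\<Sum>n<N. Q n)))"
        using ZN unfolding d(3) by linarith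
      also have "\<dots> = exp (8 * T) * (3 / 2 * Z 0 + 3 / 4 * (d * (\<Sum>n<N. Q n)))"
        by (simp add: algebra_simps)
      also have "\<dots> \<le> exp (8 * T) * (3 * En 0 + d * (\<Sum>n<N. Q n))"
      proof -
        have "0 \<le> d * (\<Sum>n<N. Q n)" using d Q0 by (simp add: sum_nonneg)
        then show ?thesis using Z0 by (intro mult_left_mono) auto
      qed
      also have "\<dots> \<le> exp (8 * T + 1) * (3 * En 0 + d * (\<Sum>n<N. Q n))"
      proof (rule mult_right_mono)
        show "0 \<le> 3 * En 0 + d * (\<Sum>n<N. Q n)"
          using En[of 0] nonneg[of 0] d Q0 by (simp add: sum_nonneg)
      qed simp
      finally show ?thesis .
    qed
    ultimately show "((\<forall>t\<in>{0..T}. AE z in lebesgue_on \<Omega>. Jxh t z = 0 \<and> Jyh t z = 0) \<longrightarrow>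
         energy \<Omega> \<epsilon>0 \<mu>0 \<chi>1 \<chi>3 (Exh N) (Eyh N) (Hzh N)
           \<le> 3 * energy \<Omega> \<epsilon>0 \<mu>0 \<chi>1 \<chi>3 (Exh 0) (Eyh 0) (Hzh 0)) \<and>
      energy \<Omega> \<epsilon>0 \<mu>0 \<chi>1 \<chi>3 (Exh N) (Eyh N) (Hzh N)
        \<le> exp (8 * T + 1) *
          (3 * energy \<Omega> \<epsilon>0 \<mu>0 \<chi>1 \<chi>3 (Exh 0) (Eyh 0) (Hzh 0)
           + T / real N * (\<Sum>n<N. (wnorm \<Omega> (\<lambda>z. inverse (\<epsilon>0 * (1 + \<chi>1 z)))
               (\<lambda>z. (Jxh ((real n + 1 / 2) * (T / real N)) z,
                     Jyh ((real n + 1 / 2) * (T / real N)) z)))\<^sup>2))"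
      unfolding En_def Q_def th_def d_def by blast
  qed
qed

end
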